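(* Let $(\mathrm X,\mathsf d,\mathfrak m)$ be a metric measure space, let $(I,\leq)$ be a directed partially ordered set, and let $\big(\{\mathscr M_i\}_{i\in I},\{\varphi_{ij}\}_{i\leq j}\big)$ be a direct system over $I$ of normed $L^0(\mathfrak m)$-modules, with direct limit $\big(\varinjlim\mathscr M_\star,\{\varphi_i\}_{i\in I}\big)$. Then $\big(\{\mathscr M_i^*\}_{i\in I},\{\varphi_{ij}^{\rm adj}\}_{i\leq j}\big)$ is an inverse system of normed $L^0(\mathfrak m)$-modules. Moreover, $$\varprojlim\mathscr M_\star^*\cong\big(\varinjlim\mathscr M_\star\big)^*,$$ the natural projections being given by $\varphi_i^{\rm adj}\colon\big(\varinjlim\mathscr M_\star\big)^*\to\mathscr M_i^*$ for every $i\in I$.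
   Context: A metric measure space $(\mathrm X,\mathsf d,\mathfrak m)$ is a complete separable metric space $(\mathrm X,\mathsf d)$ with a Radon measure $\mathfrak m\geq 0$. $L^0(\mathfrak m)$ is the commutative ring of Borel functions $f\colon\mathrm X\to\mathbb R$ up to $\mathfrak m$-a.e. equality, with distance $\mathsf d_{L^0(\mathfrak m)}(f,g)=\int|f-g|\wedge 1\,\mathrm d\mathfrak m'$, where $\mathfrak m'$ is any Borel probability measure with $\mathfrak m\ll\mathfrak m'\ll\mathfrak m$. A pointwise norm on an $L^0(\mathfrak m)$-module $\mathscr M$ is a map $|\cdot|\colon\mathscr M\to L^0(\mathfrak m)$ such that, $\mathfrak m$-a.e., $|v|\geq 0$, $|v+w|\leq|v|+|w|$, $|f\cdot v|=|f||v|$ for all $v,w\in\mathscr M$, $f\in L^0(\mathfrak m)$, and $|v|=0$ $\mathfrak m$-a.e. if and only if $v=0$. A normed $L^0(\mathfrak m)$-module is an $L^0(\mathfrak m)$-module $\mathscr M$ with a pointwise norm such that the distance $\mathsf d_{\mathscr M}(v,w)=\int|v-w|\wedge 1\,\mathrm d\mathfrak m'$ is complete. A morphism $\varphi\colon\mathscr M\to\mathscr N$ of normed $L^0(\mathfrak m)$-modules is an $L^0(\mathfrak m)$-linear map with $|\varphi(v)|\leq|v|$ $\mathfrak m$-a.e. for every $v\in\mathscr M$. This defines the category of normed $L^0(\mathfrak m)$-modules; $\cong$ denotes isomorphism in it. Dual: $\mathscr M^*$ is the set of all $L^0(\mathfrak m)$-linear continuous maps $T\colon\mathscr M\to L^0(\mathfrak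 m)$, which is a normed $L^0(\mathfrak m)$-module with operations $(T+S)(v)=T(v)+S(v)$, $(f\cdot T)(v)=f\cdot T(v)$ and pointwise norm $|T|=\mathrm{ess\,sup}\{|T(v)|:v\in\mathscr M,\ |v|\leq 1\ \mathfrak m\text{-a.e.}\}\in L^0(\mathfrak m)$. For a morphism $\varphi\colon\mathscr M\to\mathscr N$, the adjoint morphism $\varphi^{\rm adj}\colon\mathscr N^*\to\mathscr M^*$ is $\varphi^{\rm adj}(\omega)=\omega\circ\varphi$. A directed partially ordered set is a nonempty partially ordered set in which any two elements have an upper bound. A direct system over $I$ consists of objects $\{\mathscr M_i\}_{i\in I}$ and morphisms $\varphi_{ij}\colon\mathscr M_i\to\mathscr M_j$ for $i\leq j$ with $\varphi_{ii}=\mathrm{id}$ and $\varphi_{ik}=\varphi_{jk}\circ\varphi_{ij}$ for $i\leq j\leq k$. A target of it is a couple $(\mathscr N,\{\psi_i\}_{i\in I})$ of an object $\mathscr N$ and morphisms $\psi_i\colon\mathscr M_i\to\mathscr N$ with $\psi_j\circ\varphi_{ij}=\psi_i$ for all $i\leq j$. The direct limit $\big(\varinjlim\mathscr M_\star,\{\varphi_i\}_{i\in I}\big)$ is a target such that for every target $(\mathscr N,\{\psi_i\}_{i\in I})$ there is a unique morphism $\Phi\colon\varinjlim\mathscr M_\star\to\mathscr N$ with $\Phi\circ\varphi_i=\psi_i$ for every $i\in I$. Direct limits exist in the category of normed $L^0(\mathfrak m)$-modules. An inverse system over $I$ consists of objects $\{\mathscr N_i\}_{i\in I}$ and morphisms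 $\mathrm P_{ij}\colon\mathscr N_j\to\mathscr N_i$ for $i\leq j$ with $\mathrm P_{ii}=\mathrm{id}$ and $\mathrm P_{ik}=\mathrm P_{ij}\circ\mathrm P_{jk}$ for $i\leq j\leq k$. Its inverse limit $\big(\varprojlim\mathscr N_\star,\{\mathrm P_i\}_{i\in I}\big)$ is an object with morphisms (natural projections) $\mathrm P_i\colon\varprojlim\mathscr N_\star\to\mathscr N_i$ satisfying $\mathrm P_i=\mathrm P_{ij}\circ\mathrm P_j$ for $i\leq j$, such that for every object $\mathscr O$ with morphisms $\mathrm Q_i\colon\mathscr O\to\mathscr N_i$ satisfying $\mathrm Q_i=\mathrm P_{ij}\circ\mathrm Q_j$ for $i\leq j$ there is a unique morphism $\Phi\colon\mathscr O\to\varprojlim\mathscr N_\star$ with $\mathrm P_i\circ\Phi=\mathrm Q_i$ for every $i\in I$. Inverse limits exist in the category of normed $L^0(\mathfrak m)$-modules. *)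

theory Defs
  imports
    "HOL-Analysis.Analysis"
    "HOL-Probability.Probability_Measure"
    "HOL-Algebra.Module"
    "HOL-Algebra.QuotRing"
begin

section \<open>Metric measure spaces\<close>

text \<open>The type class \<open>polish_space\<close> fixes a complete distance with a countable base, i.e. a complete
  separable metric space. A Radon measure is a locally finite Borel measure that is inner regular with
  respect to compact sets (on a metric space, for inner regular measures, locally finite is the same
  as finite on compact sets).\<close>

definition radon_measure :: "'x::topological_space measure \<Rightarrow> bool" where
  "radon_measure m \<longleftrightarrow>
     sets m = sets borel \<and>
     (\<forall>x. \<exists>U. open U \<and> x \<in> U \<and> emeasure m U < \<infinity>) \<and>
     (\<forall>B\<in>sets borel. emeasure m B = (SUP K\<in>{K. compact K \<and> K \<subseteq> B}. emeasure m K))"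

definition metric_measure_space :: "'x::polish_space measure \<Rightarrow> bool" where
  "metric_measure_space m \<longleftrightarrow> radon_measure m"

text \<open>The auxiliary probability measures \<open>m'\<close> with \<open>m \<lless> m' \<lless> m\<close>. Everything below that uses \<open>m'\<close>
  is required for all of them: the notions do not depend on the choice, and in the degenerate case
  \<open>m = 0\<close>, where there is no such \<open>m'\<close>, every module below is trivial anyway.\<close>

definition equivalent_prob :: "'x measure \<Rightarrow> 'x measure \<Rightarrow> bool" where
  "equivalent_prob m m' \<longleftrightarrow>
     prob_space m' \<and> sets m' = sets m \<and> absolutely_continuous m m' \<and> absolutely_continuous m' m"


section \<open>The ring \<open>L\<^sup>0(m)\<close>\<close>

definition borel_ring :: "'x measure \<Rightarrow> ('x \<Rightarrow> real) ring" where
  "borel_ring m =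
     \<lparr>carrier = borel_measurable m, mult = (\<lambda>f g x. f x * g x), one = (\<lambda>x. 1),
      zero = (\<lambda>x. 0), add = (\<lambda>f g x. f x + g x)\<rparr>"

definition null_functions :: "'x measure \<Rightarrow> ('x \<Rightarrow> real) set" where
  "null_functions m = {f \<in> borel_measurable m. AE x in m. f x = 0}"

type_synonym 'x L0 = "('x \<Rightarrow> real) set"

definition L0 :: "'x measure \<Rightarrow> 'x L0 ring" where
  "L0 m = borel_ring m Quot null_functions m"

definition L0_class :: "'x measure \<Rightarrow> ('x \<Rightarrow> real) \<Rightarrow> 'x L0" where
  "L0_class m f = null_functions m +>\<^bsub>borel_ring m\<^esub> f"

lemma cring_borel_ring: "cring (borel_ring m)"
proof (rule cringI)
  show "abelian_group (borel_ring m)"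
  proof (rule abelian_groupI)
    show "\<exists>y\<in>carrier (borel_ring m). y \<oplus>\<^bsub>borel_ring m\<^esub> f = \<zero>\<^bsub>borel_ring m\<^esub>"
      if "f \<in> carrier (borel_ring m)" for f
      using that by (intro bexI[of _ "\<lambda>x. - f x"]) (auto simp: borel_ring_def)
  qed (auto simp: borel_ring_def algebra_simps)
  show "comm_monoid (borel_ring m)"
    by (rule comm_monoidI) (auto simp: borel_ring_def algebra_simps)
qed (auto simp: borel_ring_def algebra_simps)

lemma ideal_null_functions: "ideal (null_functions m) (borel_ring m)"
proof (rule idealI)
  show R: "ring (borel_ring m)"
    using cring_borel_ring by (rule cring.axioms)
  interpret ring "borel_ring m" by (fact R)
  show "subgroup (null_functions m) (add_monoid (borel_ring m))"
  proof (rule add.subgroupI)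
    fix f assume f: "f \<in> null_functions m"
    then have fc: "f \<in> carrier (borel_ring m)" by (simp add: null_functions_def borel_ring_def)
    have "\<ominus>\<^bsub>borel_ring m\<^esub> f = (\<lambda>x. - f x)"
      by (rule minus_equality) (use fc in \<open>auto simp: borel_ring_def\<close>)
    with f show "\<ominus>\<^bsub>borel_ring m\<^esub> f \<in> null_functions m"
      by (auto simp: null_functions_def)
  qed (auto simp: null_functions_def borel_ring_def intro!: exI[of _ "\<lambda>x. 0"])
qed (auto simp: null_functions_def borel_ring_def)

lemma cring_L0: "cring (L0 m)"
  unfolding L0_def by (rule ideal.quotient_is_cring[OF ideal_null_functions cring_borel_ring])

lemma L0_class_eq:
  assumes f: "f \<in> borel_measurable m"
  shows "L0_class m f = {g \<in> borel_measurable m. AE x in m. g x = f x}"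
proof -
  have "\<exists>h\<in>null_functions m. g = (\<lambda>x. h x + f x)"
    if "g \<in> borel_measurable m" "AE x in m. g x = f x" for g
    using that f by (intro bexI[of _ "\<lambda>x. g x - f x"]) (auto simp: null_functions_def)
  with f show ?thesis
    by (auto simp: L0_class_def a_r_coset_def r_coset_def borel_ring_def null_functions_def)
qed

definition L0_rep :: "'x L0 \<Rightarrow> 'x \<Rightarrow> real" where
  "L0_rep a = (SOME f. f \<in> a)"

definition L0_le :: "'x measure \<Rightarrow> 'x L0 \<Rightarrow> 'x L0 \<Rightarrow> bool" where
  "L0_le m a b \<longleftrightarrow> (AE x in m. L0_rep a x \<le> L0_rep b x)"

definition L0_abs :: "'x measure \<Rightarrow> 'x L0 \<Rightarrow> 'x L0" where
  "L0_abs m a = L0_class m (\<lambda>x. \<bar>L0_rep a x\<bar>)"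

text \<open>The essential supremum of a family: its least upper bound for the a.e. order
  (only meaningful when that exists in \<open>L\<^sup>0(m)\<close>).\<close>

definition L0_esssup :: "'x measure \<Rightarrow> 'x L0 set \<Rightarrow> 'x L0" where
  "L0_esssup m A =
     (THE s. s \<in> carrier (L0 m) \<and> (\<forall>a\<in>A. L0_le m a s) \<and>
             (\<forall>t\<in>carrier (L0 m). (\<forall>a\<in>A. L0_le m a t) \<longrightarrow> L0_le m s t))"


section \<open>Normed \<open>L\<^sup>0(m)\<close>-modules\<close>

record ('a, 'b) normed_module = "('a, 'b) module" +
  pnorm :: "'b \<Rightarrow> 'a"

text \<open>The distance is set to 0 off the carrier, since the locale \<open>Metric_space\<close> wants
  nonnegativity and symmetry on the whole type.\<close>

definition module_dist :: "'x measure \<Rightarrow> ('x L0, 'v) normed_module \<Rightarrow> 'v \<Rightarrow> 'v \<Rightarrow> real" where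
  "module_dist m' M v w =
     (if v \<in> carrier M \<and> w \<in> carrier M
      then \<integral>x. min (L0_rep (pnorm M (v \<ominus>\<^bsub>M\<^esub> w)) x) 1 \<partial>m' else 0)"

definition pointwise_norm :: "'x measure \<Rightarrow> ('x L0, 'v) normed_module \<Rightarrow> bool" where
  "pointwise_norm m M \<longleftrightarrow>
     pnorm M \<in> carrier M \<rightarrow> carrier (L0 m) \<and>
     (\<forall>v\<in>carrier M. L0_le m \<zero>\<^bsub>L0 m\<^esub> (pnorm M v)) \<and>
     (\<forall>v\<in>carrier M. \<forall>w\<in>carrier M. L0_le m (pnorm M (v \<oplus>\<^bsub>M\<^esub> w)) (pnorm M v \<oplus>\<^bsub>L0 m\<^esub> pnorm M w)) \<and>
     (\<forall>f\<in>carrier (L0 m). \<forall>v\<in>carrier M. pnorm M (f \<odot>\<^bsub>M\<^esub> v) = L0_abs m f \<otimes>\<^bsub>L0 m\<^esub> pnorm M v) \<and>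
     (\<forall>v\<in>carrier M. pnorm M v = \<zero>\<^bsub>L0 m\<^esub> \<longleftrightarrow> v = \<zero>\<^bsub>M\<^esub>)"

definition normed_L0_module :: "'x measure \<Rightarrow> ('x L0, 'v) normed_module \<Rightarrow> bool" where
  "normed_L0_module m M \<longleftrightarrow>
     Module.module (L0 m) M \<and> pointwise_norm m M \<and>
     (\<forall>m'. equivalent_prob m m' \<longrightarrow> Metric_space.mcomplete (carrier M) (module_dist m' M))"

text \<open>Maps are taken extensional (\<open>undefined\<close> off the carrier), so that equality of maps
  is equality on the carrier.\<close>

definition L0_linear ::
  "'x measure \<Rightarrow> ('x L0, 'v) normed_module \<Rightarrow> ('x L0, 'w) normed_module \<Rightarrow> ('v \<Rightarrow> 'w) \<Rightarrow> bool" where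
  "L0_linear m M N \<phi> \<longleftrightarrow>
     \<phi> \<in> carrier M \<rightarrow>\<^sub>E carrier N \<and>
     (\<forall>v\<in>carrier M. \<forall>w\<in>carrier M. \<phi> (v \<oplus>\<^bsub>M\<^esub> w) = \<phi> v \<oplus>\<^bsub>N\<^esub> \<phi> w) \<and>
     (\<forall>f\<in>carrier (L0 m). \<forall>v\<in>carrier M. \<phi> (f \<odot>\<^bsub>M\<^esub> v) = f \<odot>\<^bsub>N\<^esub> \<phi> v)"

definition morphism ::
  "'x measure \<Rightarrow> ('x L0, 'v) normed_module \<Rightarrow> ('x L0, 'w) normed_module \<Rightarrow> ('v \<Rightarrow> 'w) \<Rightarrow> bool" where
  "morphism m M N \<phi> \<longleftrightarrow>
     L0_linear m M N \<phi> \<and> (\<forall>v\<in>carrier M. L0_le m (pnorm N (\<phi> v)) (pnorm M v))"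

definition identity :: "('x L0, 'v) normed_module \<Rightarrow> 'v \<Rightarrow> 'v" where
  "identity M = (\<lambda>v\<in>carrier M. v)"

definition isomorphism ::
  "'x measure \<Rightarrow> ('x L0, 'v) normed_module \<Rightarrow> ('x L0, 'w) normed_module \<Rightarrow> ('v \<Rightarrow> 'w) \<Rightarrow> bool" where
  "isomorphism m M N \<phi> \<longleftrightarrow>
     morphism m M N \<phi> \<and>
     (\<exists>\<psi>. morphism m N M \<psi> \<and>
          compose (carrier M) \<psi> \<phi> = identity M \<and> compose (carrier N) \<phi> \<psi> = identity N)"


section \<open>Duals and adjoints\<close>

definition L0_module :: "'x measure \<Rightarrow> ('x L0, 'x L0) normed_module" where
  "L0_module m =
     \<lparr>carrier = carrier (L0 m), mult = mult (L0 m), one = one (L0 m), zero = zero (L0 m),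
      add = add (L0 m), smult = mult (L0 m), pnorm = L0_abs m\<rparr>"

definition L0_continuous ::
  "'x measure \<Rightarrow> ('x L0, 'v) normed_module \<Rightarrow> ('x L0, 'w) normed_module \<Rightarrow> ('v \<Rightarrow> 'w) \<Rightarrow> bool" where
  "L0_continuous m M N T \<longleftrightarrow>
     (\<forall>m'. equivalent_prob m m' \<longrightarrow>
        continuous_map (Metric_space.mtopology (carrier M) (module_dist m' M))
                       (Metric_space.mtopology (carrier N) (module_dist m' N)) T)"

text \<open>The record of modules extends that of rings; its fields \<open>mult\<close> and \<open>one\<close> play no role.\<close>

definition dual_module ::
  "'x measure \<Rightarrow> ('x L0, 'v) normed_module \<Rightarrow> ('x L0, 'v \<Rightarrow> 'x L0) normed_module" where
  "dual_module m M =
     \<lparr>carrier = {T. L0_linear m M (L0_module m) T \<and> L0_continuous m M (L0_module m) T},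
      mult = undefined, one = undefined,
      zero = (\<lambda>v\<in>carrier M. \<zero>\<^bsub>L0 m\<^esub>),
      add = (\<lambda>T S. \<lambda>v\<in>carrier M. T v \<oplus>\<^bsub>L0 m\<^esub> S v),
      smult = (\<lambda>f T. \<lambda>v\<in>carrier M. f \<otimes>\<^bsub>L0 m\<^esub> T v),
      pnorm = (\<lambda>T. L0_esssup m {L0_abs m (T v) |v. v \<in> carrier M \<and> L0_le m (pnorm M v) \<one>\<^bsub>L0 m\<^esub>})\<rparr>"

definition adjoint_map ::
  "'x measure \<Rightarrow> ('x L0, 'v) normed_module \<Rightarrow> ('x L0, 'w) normed_module \<Rightarrow> ('v \<Rightarrow> 'w) \<Rightarrow>
   ('w \<Rightarrow> 'x L0) \<Rightarrow> ('v \<Rightarrow> 'x L0)" where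
  "adjoint_map m M N \<phi> = (\<lambda>\<omega>\<in>carrier (dual_module m N). compose (carrier M) \<omega> \<phi>)"


section \<open>Direct and inverse systems and their limits\<close>

text \<open>The order is a relation \<open>r\<close> with \<open>i \<le> j\<close> iff \<open>(i, j) \<in> r\<close>.\<close>

definition directed_poset :: "'i set \<Rightarrow> 'i rel \<Rightarrow> bool" where
  "directed_poset I r \<longleftrightarrow>
     I \<noteq> {} \<and> partial_order_on I r \<and> (\<forall>i\<in>I. \<forall>j\<in>I. \<exists>k\<in>I. (i, k) \<in> r \<and> (j, k) \<in> r)"

definition direct_system ::
  "'x measure \<Rightarrow> 'i set \<Rightarrow> 'i rel \<Rightarrow> ('i \<Rightarrow> ('x L0, 'v) normed_module) \<Rightarrow> ('i \<Rightarrow> 'i \<Rightarrow> 'v \<Rightarrow> 'v) \<Rightarrow> bool"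
where
  "direct_system m I r M \<phi> \<longleftrightarrow>
     (\<forall>i\<in>I. normed_L0_module m (M i)) \<and>
     (\<forall>i j. (i, j) \<in> r \<longrightarrow> morphism m (M i) (M j) (\<phi> i j)) \<and>
     (\<forall>i\<in>I. \<phi> i i = identity (M i)) \<and>
     (\<forall>i j k. (i, j) \<in> r \<longrightarrow> (j, k) \<in> r \<longrightarrow> \<phi> i k = compose (carrier (M i)) (\<phi> j k) (\<phi> i j))"

definition direct_target ::
  "'x measure \<Rightarrow> 'i set \<Rightarrow> 'i rel \<Rightarrow> ('i \<Rightarrow> ('x L0, 'v) normed_module) \<Rightarrow> ('i \<Rightarrow> 'i \<Rightarrow> 'v \<Rightarrow> 'v) \<Rightarrow>
   ('x L0, 'w) normed_module \<Rightarrow> ('i \<Rightarrow> 'v \<Rightarrow> 'w) \<Rightarrow> bool" where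
  "direct_target m I r M \<phi> N \<psi> \<longleftrightarrow>
     normed_L0_module m N \<and>
     (\<forall>i\<in>I. morphism m (M i) N (\<psi> i)) \<and>
     (\<forall>i j. (i, j) \<in> r \<longrightarrow> compose (carrier (M i)) (\<psi> j) (\<phi> i j) = \<psi> i)"

text \<open>A formula cannot quantify over types, so the universal properties are stated relative to a
  type \<open>'u\<close>, which holds the carriers of the objects they are tested on. Tested on a type that can
  hold the carriers of both the given limit and some true limit (one for all types), the universal
  property makes the two isomorphic, so that it is the universal property for all types.
  Such a type is \<open>direct_tests\<close>: a true direct limit is the closure of the images of the modules of
  the system, so its elements can be encoded as sets of sequences in their disjoint union.
  The summand \<open>'x L0\<close> just makes \<open>L\<^sup>0(m)\<close> itself directly available as a target.
  For inverse limits such a type is \<open>inverse_tests\<close>: an inverse limit can be realized inside the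
  product of the modules of the system.\<close>

type_synonym ('x, 'i, 'v, 'l) direct_tests = "'l + (nat \<Rightarrow> 'i \<times> 'v) set + 'x L0"

type_synonym ('i, 'v, 'p) inverse_tests = "'p + ('i \<Rightarrow> 'v)"

definition direct_limit ::
  "'u itself \<Rightarrow> 'x measure \<Rightarrow> 'i set \<Rightarrow> 'i rel \<Rightarrow>
   ('i \<Rightarrow> ('x L0, 'v) normed_module) \<Rightarrow> ('i \<Rightarrow> 'i \<Rightarrow> 'v \<Rightarrow> 'v) \<Rightarrow>
   ('x L0, 'l) normed_module \<Rightarrow> ('i \<Rightarrow> 'v \<Rightarrow> 'l) \<Rightarrow> bool" where
  "direct_limit U m I r M \<phi> L \<eta> \<longleftrightarrow>
     direct_target m I r M \<phi> L \<eta> \<and>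
     (\<forall>(N :: ('x L0, 'u) normed_module) \<psi>. direct_target m I r M \<phi> N \<psi> \<longrightarrow>
        (\<exists>!\<Phi>. morphism m L N \<Phi> \<and> (\<forall>i\<in>I. compose (carrier (M i)) \<Phi> (\<eta> i) = \<psi> i)))"

definition inverse_system ::
  "'x measure \<Rightarrow> 'i set \<Rightarrow> 'i rel \<Rightarrow> ('i \<Rightarrow> ('x L0, 'v) normed_module) \<Rightarrow> ('i \<Rightarrow> 'i \<Rightarrow> 'v \<Rightarrow> 'v) \<Rightarrow> bool"
where
  "inverse_system m I r N P \<longleftrightarrow>
     (\<forall>i\<in>I. normed_L0_module m (N i)) \<and>
     (\<forall>i j. (i, j) \<in> r \<longrightarrow> morphism m (N j) (N i) (P i j)) \<and>
     (\<forall>i\<in>I. P i i = identity (N i)) \<and>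
     (\<forall>i j k. (i, j) \<in> r \<longrightarrow> (j, k) \<in> r \<longrightarrow> P i k = compose (carrier (N k)) (P i j) (P j k))"

definition inverse_cone ::
  "'x measure \<Rightarrow> 'i set \<Rightarrow> 'i rel \<Rightarrow> ('i \<Rightarrow> ('x L0, 'v) normed_module) \<Rightarrow> ('i \<Rightarrow> 'i \<Rightarrow> 'v \<Rightarrow> 'v) \<Rightarrow>
   ('x L0, 'w) normed_module \<Rightarrow> ('i \<Rightarrow> 'w \<Rightarrow> 'v) \<Rightarrow> bool" where
  "inverse_cone m I r N P Ob Q \<longleftrightarrow>
     normed_L0_module m Ob \<and>
     (\<forall>i\<in>I. morphism m Ob (N i) (Q i)) \<and>
     (\<forall>i j. (i, j) \<in> r \<longrightarrow> Q i = compose (carrier Ob) (P i j) (Q j))"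

definition inverse_limit ::
  "'u itself \<Rightarrow> 'x measure \<Rightarrow> 'i set \<Rightarrow> 'i rel \<Rightarrow>
   ('i \<Rightarrow> ('x L0, 'v) normed_module) \<Rightarrow> ('i \<Rightarrow> 'i \<Rightarrow> 'v \<Rightarrow> 'v) \<Rightarrow>
   ('x L0, 'l) normed_module \<Rightarrow> ('i \<Rightarrow> 'l \<Rightarrow> 'v) \<Rightarrow> bool" where
  "inverse_limit U m I r N P L \<pi> \<longleftrightarrow>
     inverse_cone m I r N P L \<pi> \<and>
     (\<forall>(Ob :: ('x L0, 'u) normed_module) Q. inverse_cone m I r N P Ob Q \<longrightarrow>
        (\<exists>!\<Phi>. morphism m Ob L \<Phi> \<and> (\<forall>i\<in>I. compose (carrier Ob) (\<pi> i) \<Phi> = Q i)))"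

end

theory Submission
  imports Defs
begin

text \<open>A functional is continuous iff it is bounded by \<open>c\<bar>v\<bar>\<close> for some \<open>c \<in> L\<^sup>0(m)\<close>; this makes the dual a normed
  module. A compatible family \<open>T\<^sub>i \<in> M\<^sub>i\<^sup>*\<close> with \<open>\<bar>T\<^sub>i\<bar> \<le> c\<close> becomes, after division by \<open>c\<close>, a target of the
  direct system with vertex \<open>L\<^sup>0(m)\<close>, so it factors through the direct limit and glues to a unique functional
  of norm at most \<open>c\<close> there. Hence cones over the duals factor uniquely through the dual of the direct limit.
  Since universal properties are only assumed on particular carrier types, the objects they are tested
  on are first moved there along injections.\<close>

section \<open>The ring \<open>L\<^sup>0(m)\<close> through representatives\<close>

text \<open>The obstacle is that a continuous functional is bounded by a function in
  \<open>L0 m\<close>, not by a constant, and that the dual norm is an essential supremum which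
  might be infinite. Finiteness comes from gluing: vectors of the unit ball can be patched along
  measurable sets, so the values \<open>\<bar>T v\<bar>\<close> form a directed family and a single
  vector witnesses the bound for finitely many. Morphisms are contractions while functionals need
  not be; this forces the divisions, and since elements of \<open>L0 m\<close> may vanish on sets of
  positive measure, zero sets have to be treated separately. Density of the images of the modules in
  the direct limit is never established. That a functional on the limit is determined by its
  adjoints follows instead from the uniqueness clause of the universal property with vertex
  \<open>L0 m\<close>. The same fact makes mediating maps linear although they are chosen vector by
  vector. Completeness is always reduced to sequences whose increments have a.e. summable pointwise
  norms, a condition in which the auxiliary probability no longer occurs.\<close>

lemma L0_class_eq_iff:
  assumes "f \<in> borel_measurable m" "g \<in> borel_measurable m"
  shows "L0_class m f = L0_class m g \<longleftrightarrow> (AE x in m. f x = g x)"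
proof
  assume "L0_class m f = L0_class m g"
  moreover have "f \<in> L0_class m f" using assms by (simp add: L0_class_eq)
  ultimately have "f \<in> L0_class m g" by simp
  then show "AE x in m. f x = g x" using assms by (simp add: L0_class_eq)
next
  assume *: "AE x in m. f x = g x"
  have "(AE x in m. h x = f x) \<longleftrightarrow> (AE x in m. h x = g x)" for h
    using * by (auto elim!: eventually_elim2)
  then show "L0_class m f = L0_class m g" using assms by (simp add: L0_class_eq)
qed

lemma carrier_L0: "carrier (L0 m) = L0_class m ` borel_measurable m"
  by (auto simp: L0_def FactRing_def A_RCOSETS_def' L0_class_def borel_ring_def image_def)

lemma L0_class_closed [simp]: "f \<in> borel_measurable m \<Longrightarrow> L0_class m f \<in> carrier (L0 m)"
  by (simp add: carrier_L0)

text \<open>Classes are nonempty, so \<open>SOME\<close> picks a genuine member, but not a canonical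
  one: this is why every identity between representatives below is only almost everywhere.\<close>

lemma L0_rep_class:
  assumes "f \<in> borel_measurable m"
  shows "L0_rep (L0_class m f) \<in> borel_measurable m \<and> (AE x in m. L0_rep (L0_class m f) x = f x)"
proof -
  have "f \<in> L0_class m f" using assms by (simp add: L0_class_eq)
  then have "L0_rep (L0_class m f) \<in> L0_class m f" unfolding L0_rep_def by (rule someI[of "\<lambda>g. g \<in> L0_class m f"])
  then show ?thesis using assms by (simp add: L0_class_eq)
qed

lemma AE_L0_rep_class: "f \<in> borel_measurable m \<Longrightarrow> AE x in m. L0_rep (L0_class m f) x = f x"
  using L0_rep_class by blast

lemma L0_rep_measurable [measurable, simp]: "a \<in> carrier (L0 m) \<Longrightarrow> L0_rep a \<in> borel_measurable m"
  using L0_rep_class by (auto simp: carrier_L0)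

lemma L0_class_rep [simp]: "a \<in> carrier (L0 m) \<Longrightarrow> L0_class m (L0_rep a) = a"
  using L0_class_eq_iff[of "L0_rep a" m] L0_rep_class by (auto simp: carrier_L0)

lemma L0_eqI:
  assumes "a \<in> carrier (L0 m)" "b \<in> carrier (L0 m)" "AE x in m. L0_rep a x = L0_rep b x"
  shows "a = b"
  using L0_class_eq_iff[of "L0_rep a" m "L0_rep b"] assms by simp

lemma L0_add_class:
  assumes "f \<in> borel_measurable m" "g \<in> borel_measurable m"
  shows "L0_class m f \<oplus>\<^bsub>L0 m\<^esub> L0_class m g = L0_class m (\<lambda>x. f x + g x)"
proof -
  interpret ideal "null_functions m" "borel_ring m" by (rule ideal_null_functions)
  show ?thesis
    using a_rcos_sum[of f g] assms by (simp add: L0_def FactRing_def L0_class_def borel_ring_def)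
qed

lemma L0_mult_class:
  assumes "f \<in> borel_measurable m" "g \<in> borel_measurable m"
  shows "L0_class m f \<otimes>\<^bsub>L0 m\<^esub> L0_class m g = L0_class m (\<lambda>x. f x * g x)"
proof -
  interpret ideal "null_functions m" "borel_ring m" by (rule ideal_null_functions)
  show ?thesis
    using rcoset_mult_add[of f g] assms by (simp add: L0_def FactRing_def L0_class_def borel_ring_def)
qed

lemma L0_one_class: "\<one>\<^bsub>L0 m\<^esub> = L0_class m (\<lambda>x. 1)"
  by (simp add: L0_def FactRing_def L0_class_def borel_ring_def)

lemma L0_zero_class: "\<zero>\<^bsub>L0 m\<^esub> = L0_class m (\<lambda>x. 0)"
  by (auto simp: L0_class_eq L0_def FactRing_def null_functions_def)

text \<open>Together with its companions for the other operations, this turns ring identities into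
  pointwise ones, which are then combined outside a common null set by
  \<open>eventually_elim\<close>.\<close>

lemma L0_rep_add:
  assumes "a \<in> carrier (L0 m)" "b \<in> carrier (L0 m)"
  shows "AE x in m. L0_rep (a \<oplus>\<^bsub>L0 m\<^esub> b) x = L0_rep a x + L0_rep b x"
proof -
  have "a \<oplus>\<^bsub>L0 m\<^esub> b = L0_class m (\<lambda>x. L0_rep a x + L0_rep b x)"
    using L0_add_class[of "L0_rep a" m "L0_rep b"] assms by simp
  then show ?thesis
    using AE_L0_rep_class[of "\<lambda>x. L0_rep a x + L0_rep b x" m] assms by simp
qed

lemma L0_rep_mult:
  assumes "a \<in> carrier (L0 m)" "b \<in> carrier (L0 m)"
  shows "AE x in m. L0_rep (a \<otimes>\<^bsub>L0 m\<^esub> b) x = L0_rep a x * L0_rep b x"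
proof -
  have "a \<otimes>\<^bsub>L0 m\<^esub> b = L0_class m (\<lambda>x. L0_rep a x * L0_rep b x)"
    using L0_mult_class[of "L0_rep a" m "L0_rep b"] assms by simp
  then show ?thesis
    using AE_L0_rep_class[of "\<lambda>x. L0_rep a x * L0_rep b x" m] assms by simp
qed

lemma L0_rep_one: "AE x in m. L0_rep (\<one>\<^bsub>L0 m\<^esub>) x = 1"
  unfolding L0_one_class by (rule AE_L0_rep_class) simp

lemma L0_rep_zero: "AE x in m. L0_rep (\<zero>\<^bsub>L0 m\<^esub>) x = 0"
  unfolding L0_zero_class by (rule AE_L0_rep_class) simp

lemma L0_abs_closed [simp]: "a \<in> carrier (L0 m) \<Longrightarrow> L0_abs m a \<in> carrier (L0 m)"
  by (simp add: L0_abs_def)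

lemma L0_rep_abs: "a \<in> carrier (L0 m) \<Longrightarrow> AE x in m. L0_rep (L0_abs m a) x = \<bar>L0_rep a x\<bar>"
  unfolding L0_abs_def by (rule AE_L0_rep_class) simp

lemma L0_ops_closed [simp]:
  "\<zero>\<^bsub>L0 m\<^esub> \<in> carrier (L0 m)" "\<one>\<^bsub>L0 m\<^esub> \<in> carrier (L0 m)"
  "a \<in> carrier (L0 m) \<Longrightarrow> b \<in> carrier (L0 m) \<Longrightarrow> a \<oplus>\<^bsub>L0 m\<^esub> b \<in> carrier (L0 m)"
  "a \<in> carrier (L0 m) \<Longrightarrow> b \<in> carrier (L0 m) \<Longrightarrow> a \<otimes>\<^bsub>L0 m\<^esub> b \<in> carrier (L0 m)"
  "a \<in> carrier (L0 m) \<Longrightarrow> \<ominus>\<^bsub>L0 m\<^esub> a \<in> carrier (L0 m)"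
  "a \<in> carrier (L0 m) \<Longrightarrow> b \<in> carrier (L0 m) \<Longrightarrow> a \<ominus>\<^bsub>L0 m\<^esub> b \<in> carrier (L0 m)"
proof -
  interpret cring "L0 m" by (rule cring_L0)
  show "\<zero>\<^bsub>L0 m\<^esub> \<in> carrier (L0 m)" "\<one>\<^bsub>L0 m\<^esub> \<in> carrier (L0 m)"
    "a \<in> carrier (L0 m) \<Longrightarrow> b \<in> carrier (L0 m) \<Longrightarrow> a \<oplus>\<^bsub>L0 m\<^esub> b \<in> carrier (L0 m)"
    "a \<in> carrier (L0 m) \<Longrightarrow> b \<in> carrier (L0 m) \<Longrightarrow> a \<otimes>\<^bsub>L0 m\<^esub> b \<in> carrier (L0 m)"
    "a \<in> carrier (L0 m) \<Longrightarrow> \<ominus>\<^bsub>L0 m\<^esub> a \<in> carrier (L0 m)"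
    "a \<in> carrier (L0 m) \<Longrightarrow> b \<in> carrier (L0 m) \<Longrightarrow> a \<ominus>\<^bsub>L0 m\<^esub> b \<in> carrier (L0 m)"
    by simp_all
qed

text \<open>The inverse in the quotient ring is given abstractly; its representative is read off
  from \<open>a \<oplus> (\<ominus> a) = \<zero>\<close>.\<close>

lemma L0_rep_uminus:
  assumes a: "a \<in> carrier (L0 m)"
  shows "AE x in m. L0_rep (\<ominus>\<^bsub>L0 m\<^esub> a) x = - L0_rep a x"
proof -
  interpret cring "L0 m" by (rule cring_L0)
  have "a \<oplus>\<^bsub>L0 m\<^esub> (\<ominus>\<^bsub>L0 m\<^esub> a) = \<zero>\<^bsub>L0 m\<^esub>" using a by (rule r_neg)
  then show ?thesis
    using L0_rep_add[of a m "\<ominus>\<^bsub>L0 m\<^esub> a"] L0_rep_zero[of m] a by (auto elim!: eventually_elim2)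
qed

lemma L0_rep_minus:
  assumes "a \<in> carrier (L0 m)" "b \<in> carrier (L0 m)"
  shows "AE x in m. L0_rep (a \<ominus>\<^bsub>L0 m\<^esub> b) x = L0_rep a x - L0_rep b x"
  using L0_rep_add[of a m "\<ominus>\<^bsub>L0 m\<^esub> b"] L0_rep_uminus[of b m] assms
  by (auto simp: a_minus_def elim!: eventually_elim2)

lemma L0_le_antisym:
  assumes "a \<in> carrier (L0 m)" "b \<in> carrier (L0 m)" "L0_le m a b" "L0_le m b a"
  shows "a = b"
proof (rule L0_eqI[OF assms(1,2)])
  show "AE x in m. L0_rep a x = L0_rep b x"
    using assms(3,4) unfolding L0_le_def by eventually_elim simp
qed

section \<open>Essential suprema\<close>

text \<open>Least upper bounds are unique by antisymmetry of the a.e. order, so the definite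
  description can be evaluated at any candidate that is exhibited.\<close>

lemma L0_esssup_eqI:
  assumes "s \<in> carrier (L0 m)" "\<And>a. a \<in> A \<Longrightarrow> L0_le m a s"
    and "\<And>t. t \<in> carrier (L0 m) \<Longrightarrow> (\<And>a. a \<in> A \<Longrightarrow> L0_le m a t) \<Longrightarrow> L0_le m s t"
  shows "L0_esssup m A = s"
  unfolding L0_esssup_def
proof (rule the_equality)
  fix u assume "u \<in> carrier (L0 m) \<and> (\<forall>a\<in>A. L0_le m a u) \<and>
      (\<forall>t\<in>carrier (L0 m). (\<forall>a\<in>A. L0_le m a t) \<longrightarrow> L0_le m u t)"
  then show "u = s" using assms by (intro L0_le_antisym[where m = m]) auto
qed (use assms in auto)

text \<open>Composing with \<open>arctan\<close> makes every family in \<open>L\<^sup>0(m)\<close> uniformly bounded, so that its essential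
  supremum is found by maximising an integral over countable subfamilies.\<close>

lemma (in prob_space) countable_ess_upper_bound:
  fixes A :: "('a \<Rightarrow> real) set"
  assumes "A \<noteq> {}" and meas: "\<And>a. a \<in> A \<Longrightarrow> a \<in> borel_measurable M"
  obtains s :: "nat \<Rightarrow> 'a \<Rightarrow> real" where "range s \<subseteq> A"
    and "(\<lambda>x. SUP n. arctan (s n x)) \<in> borel_measurable M"
    and "\<And>a. a \<in> A \<Longrightarrow> AE x in M. arctan (a x) \<le> (SUP n. arctan (s n x))"
proof -
  define h where "h s x = (SUP n. arctan (s n x))" for s :: "nat \<Rightarrow> 'a \<Rightarrow> real" and x
  have bdd: "bdd_above (range (\<lambda>n. arctan (f n)))" for f :: "nat \<Rightarrow> real"
    using arctan_ubound by (intro bdd_aboveI[of _ "pi/2"]) (auto simp: less_imp_le)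
  have h_ge: "arctan (s n x) \<le> h s x" for s n x
    unfolding h_def by (rule cSUP_upper[OF _ bdd]) simp
  have h_le: "h s x \<le> c" if "\<And>n. arctan (s n x) \<le> c" for s x c
    unfolding h_def by (rule cSUP_least) (use that in auto)
  have h_bound: "\<bar>h s x\<bar> \<le> pi / 2" for s x
    using h_le[of s x "pi/2"] h_ge[of s 0 x] arctan_ubound arctan_lbound[of "s 0 x"]
    by (auto simp: abs_le_iff less_imp_le intro: order_trans)
  have h_meas: "h s \<in> borel_measurable M" if "range s \<subseteq> A" for s
    unfolding h_def using that meas
    by (intro borel_measurable_cSUP bdd) (auto intro!: measurable_compose[OF _ borel_measurable_arctan])
  have h_int: "integrable M (h s)" if "range s \<subseteq> A" for s
    by (rule integrable_const_bound[of _ "pi/2"]) (use h_bound h_meas[OF that] in auto)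
  define S where "S = {s :: nat \<Rightarrow> 'a \<Rightarrow> real. range s \<subseteq> A}"
  define J where "J s = (\<integral>x. h s x \<partial>M)" for s
  have J_mono: "J s \<le> J t" if "s \<in> S" "t \<in> S" "range s \<subseteq> range t" for s t
    unfolding J_def
  proof (rule integral_mono)
    show "h s x \<le> h t x" for x
    proof (rule h_le)
      fix n
      obtain k where "s n = t k" using \<open>range s \<subseteq> range t\<close> by (metis imageE rangeI subsetD)
      then show "arctan (s n x) \<le> h t x" using h_ge[of t k x] by simp
    qed
  qed (use that h_int in \<open>auto simp: S_def\<close>)
  obtain a0 where "a0 \<in> A" using \<open>A \<noteq> {}\<close> by blast
  then have "(\<lambda>_. a0) \<in> S" by (auto simp: S_def)
  then have Sne: "S \<noteq> {}" by blast
  have Jbdd: "bdd_above (J ` S)"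
  proof (rule bdd_aboveI2)
    fix s assume "s \<in> S"
    then have "J s \<le> (\<integral>x. pi/2 \<partial>M)" unfolding J_def
      by (intro integral_mono) (use h_int abs_le_D1[OF h_bound] in \<open>auto simp: S_def\<close>)
    then show "J s \<le> pi/2" by (simp add: prob_space)
  qed
  have "\<exists>s\<in>S. Sup (J ` S) - 1 / Suc n < J s" for n
    using less_cSup_iff[of "J ` S" "Sup (J ` S) - 1 / Suc n"] Sne Jbdd by auto
  then obtain t where t: "\<And>n. t n \<in> S" "\<And>n. Sup (J ` S) - 1 / Suc n < J (t n)" by metis
  \<comment> \<open>A pairing function merges the near-maximizers \<open>t n\<close> into one
    sequence whose range contains all of theirs; as \<open>J\<close> is monotone in the range, this
    sequence attains the supremum.\<close>
  define s where "s k = t (fst (prod_decode k)) (snd (prod_decode k))" for k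
  have sS: "s \<in> S" using t(1) by (auto simp: S_def s_def)
  have "range (t n) \<subseteq> range s" for n
    by (auto simp: s_def intro!: image_eqI[where x = "prod_encode (n, _)"])
  then have lt: "Sup (J ` S) - 1 / Suc n < J s" for n
    using J_mono[OF t(1) sS, of n] t(2)[of n] by simp
  have Jmax: "Sup (J ` S) \<le> J s"
  proof (rule ccontr)
    assume "\<not> ?thesis"
    then obtain n where "inverse (real (Suc n)) < Sup (J ` S) - J s"
      using reals_Archimedean[of "Sup (J ` S) - J s"] by auto
    then show False using lt[of n] by (simp add: inverse_eq_divide)
  qed
  have "AE x in M. arctan (a x) \<le> h s x" if "a \<in> A" for a
  proof -
    \<comment> \<open>Prepending \<open>a\<close> cannot raise the maximal integral, so
      \<open>h u\<close> and \<open>h s\<close> have equal integrals, and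
      \<open>h s \<le> h u\<close> forces equality a.e.\<close>
    define u where "u k = (case k of 0 \<Rightarrow> a | Suc n \<Rightarrow> s n)" for k
    have uS: "u \<in> S" using sS that by (auto simp: S_def u_def image_subset_iff split: nat.splits)
    have le: "h s x \<le> h u x" for x
      using h_ge[of u "Suc _" x] by (intro h_le) (simp add: u_def)
    have "J u \<le> J s" using Jmax cSUP_upper[OF uS Jbdd] by simp
    then have "(\<integral>x. h u x - h s x \<partial>M) \<le> 0"
      using h_int sS uS by (simp add: J_def S_def)
    moreover have "(\<integral>x. h u x - h s x \<partial>M) \<ge> 0" by (rule integral_nonneg_AE) (simp add: le)
    ultimately have "(\<integral>x. h u x - h s x \<partial>M) = 0" by simp
    then have "AE x in M. h u x - h s x = 0"
      using integral_nonneg_eq_0_iff_AE[of M "\<lambda>x. h u x - h s x"] h_int sS uS le by (auto simp: S_def)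
    then show ?thesis
    proof eventually_elim
      case (elim x)
      then show ?case using h_ge[of u 0 x] by (simp add: u_def)
    qed
  qed
  then show ?thesis using that[of s] sS h_meas[of s] by (auto simp: S_def h_def[abs_def])
qed

section \<open>Pointwise norms and completeness\<close>

lemma equivalent_prob_AE:
  "equivalent_prob m m' \<Longrightarrow> (AE x in m'. P x) \<longleftrightarrow> (AE x in m. P x)"
  using absolutely_continuous_AE[of m' m P] absolutely_continuous_AE[of m m' P]
  by (auto simp: equivalent_prob_def)

lemma equivalent_prob_measurable:
  "equivalent_prob m m' \<Longrightarrow> measurable m' N = measurable m N"
  by (rule measurable_cong_sets) (auto simp: equivalent_prob_def)

text \<open>A strictly positive integrable function, divided by its integral, is the density of a
  measure with the same null sets. The second alternative is the case \<open>m = 0\<close>, in which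
  every property holds a.e.\<close>

lemma ex_equivalent_prob:
  assumes "sigma_finite_measure m"
  shows "(\<exists>m'. equivalent_prob m m') \<or> (\<forall>P. AE x in m. P x)"
proof (cases "emeasure m (space m) = 0")
  case True
  then have "AE x in m. P x" for P by (intro AE_I[of _ _ "space m"]) auto
  then show ?thesis by blast
next
  case False
  interpret sigma_finite_measure m by fact
  obtain h where h: "h \<in> borel_measurable m" "integral\<^sup>N m h \<noteq> \<infinity>" "\<And>x. x \<in> space m \<Longrightarrow> 0 < h x"
    using Ex_finite_integrable_function by blast
  define c where "c = integral\<^sup>N m h"
  have c0: "c \<noteq> 0"
  proof
    assume "c = 0"
    then have "AE x in m. h x = 0" unfolding c_def using h(1) by (simp add: nn_integral_0_iff_AE)
    moreover have "AE x in m. h x > 0" using h(3) by auto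
    ultimately have "AE x in m. False" by eventually_elim simp
    then show False using False AE_iff_measurable[of "space m" m "\<lambda>x. False"] by auto
  qed
  have ct: "c \<noteq> \<infinity>" using h(2) by (simp add: c_def)
  define g where "g = (\<lambda>x. h x / c)"
  have g: "g \<in> borel_measurable m" using h(1) by (simp add: g_def)
  have gpos: "g x > 0" if "x \<in> space m" for x
    using h(3)[OF that] ct by (auto simp: g_def zero_less_iff_neq_zero ennreal_divide_eq_0_iff)
  have "prob_space (density m g)"
  proof
    have "emeasure (density m g) (space (density m g)) = (\<integral>\<^sup>+x. g x \<partial>m)"
      using g by (simp add: emeasure_density cong: nn_integral_cong)
    also have "\<dots> = c / c" using h(1) by (simp add: g_def c_def nn_integral_divide)
    finally show "emeasure (density m g) (space (density m g)) = 1"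
      using c0 ct by (simp add: ennreal_divide_self less_top)
  qed
  moreover have "absolutely_continuous (density m g) m"
    unfolding absolutely_continuous_def
  proof
    fix A assume "A \<in> null_sets (density m g)"
    then have A: "A \<in> sets m" "AE x in m. x \<in> A \<longrightarrow> g x = 0"
      using null_sets_density_iff[OF g] by auto
    have "AE x in m. x \<notin> A" using A(2) AE_space by eventually_elim (use gpos in force)
    then show "A \<in> null_sets m" using A(1) by (simp add: AE_iff_null_sets)
  qed
  ultimately have "equivalent_prob m (density m g)"
    by (simp add: equivalent_prob_def absolutely_continuousI_density[OF g])
  then show ?thesis by blast
qed

text \<open>Open sets of finite measure cover the space, and by Lindelof countably many of them
  already do.\<close>

lemma sigma_finite_metric_measure_space:
  fixes m :: "'x::polish_space measure"
  assumes "metric_measure_space m"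
  shows "sigma_finite_measure m"
proof
  have s: "sets m = sets borel" and fin: "\<forall>x. \<exists>U. open U \<and> x \<in> U \<and> emeasure m U < \<infinity>"
    using assms by (auto simp: metric_measure_space_def radon_measure_def)
  obtain U where U: "\<And>x. open (U x)" "\<And>x. x \<in> U x" "\<And>x. emeasure m (U x) < \<infinity>"
    using fin by metis
  obtain F where "F \<subseteq> range U" "countable F" "\<Union>F = \<Union>(range U)"
    using Lindelof[of "range U"] U(1) by auto
  then have F: "countable F" "\<Union>F = UNIV" "\<And>a. a \<in> F \<Longrightarrow> a \<in> sets borel \<and> emeasure m a \<noteq> \<infinity>"
    using U by (auto simp: less_top)
  then show "\<exists>A. countable A \<and> A \<subseteq> sets m \<and> \<Union>A = space m \<and> (\<forall>a\<in>A. emeasure m a \<noteq> \<infinity>)"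
    using sets_eq_imp_space_eq[OF s] s by (intro exI[of _ F]) auto
qed

section \<open>Calculus of pointwise norms\<close>

text \<open>All axioms of a normed module except completeness, so that the calculus is available for
  the dual and for transported modules before they are known to be complete.\<close>

locale pn_module = module "L0 m" M
  for m :: "'x measure" and M :: "('x L0, 'v) normed_module" +
  assumes pointwise_norm: "pointwise_norm m M"
begin

abbreviation nm :: "'v \<Rightarrow> 'x \<Rightarrow> real" where "nm v \<equiv> L0_rep (pnorm M v)"

lemma pnorm_closed [simp]: "v \<in> carrier M \<Longrightarrow> pnorm M v \<in> carrier (L0 m)"
  using pointwise_norm by (auto simp: pointwise_norm_def)

lemma nm_nonneg: "v \<in> carrier M \<Longrightarrow> AE x in m. 0 \<le> nm v x"
  using pointwise_norm L0_rep_zero[of m]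
  by (auto simp: pointwise_norm_def L0_le_def elim!: eventually_elim2)

lemma nm_add:
  assumes "v \<in> carrier M" "w \<in> carrier M"
  shows "AE x in m. nm (v \<oplus>\<^bsub>M\<^esub> w) x \<le> nm v x + nm w x"
proof -
  have "AE x in m. nm (v \<oplus>\<^bsub>M\<^esub> w) x \<le> L0_rep (pnorm M v \<oplus>\<^bsub>L0 m\<^esub> pnorm M w) x"
    using pointwise_norm assms by (auto simp: pointwise_norm_def L0_le_def)
  moreover have "AE x in m. L0_rep (pnorm M v \<oplus>\<^bsub>L0 m\<^esub> pnorm M w) x = nm v x + nm w x"
    using assms by (intro L0_rep_add) auto
  ultimately show ?thesis by eventually_elim simp
qed

lemma nm_smult:
  assumes "f \<in> carrier (L0 m)" "v \<in> carrier M"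
  shows "AE x in m. nm (f \<odot>\<^bsub>M\<^esub> v) x = \<bar>L0_rep f x\<bar> * nm v x"
proof -
  have "pnorm M (f \<odot>\<^bsub>M\<^esub> v) = L0_abs m f \<otimes>\<^bsub>L0 m\<^esub> pnorm M v"
    using pointwise_norm assms by (auto simp: pointwise_norm_def)
  moreover have "AE x in m. L0_rep (L0_abs m f \<otimes>\<^bsub>L0 m\<^esub> pnorm M v) x = L0_rep (L0_abs m f) x * nm v x"
    using assms by (intro L0_rep_mult) auto
  ultimately show ?thesis using L0_rep_abs[OF assms(1)] by (auto elim!: eventually_elim2)
qed

lemma nm_eq_0_iff:
  assumes "v \<in> carrier M"
  shows "(AE x in m. nm v x = 0) \<longleftrightarrow> v = \<zero>\<^bsub>M\<^esub>"
proof -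
  have "pnorm M v = \<zero>\<^bsub>L0 m\<^esub> \<longleftrightarrow> v = \<zero>\<^bsub>M\<^esub>"
    using pointwise_norm assms by (auto simp: pointwise_norm_def)
  moreover have "(AE x in m. nm v x = 0) \<longleftrightarrow> pnorm M v = \<zero>\<^bsub>L0 m\<^esub>"
  proof
    assume "AE x in m. nm v x = 0"
    then show "pnorm M v = \<zero>\<^bsub>L0 m\<^esub>"
      using L0_rep_zero[of m] assms by (intro L0_eqI) (auto elim!: eventually_elim2)
  qed (use L0_rep_zero[of m] in auto)
  ultimately show ?thesis by simp
qed

lemma nm_uminus:
  assumes "v \<in> carrier M"
  shows "AE x in m. nm (\<ominus>\<^bsub>M\<^esub> v) x = nm v x"
proof -
  have "\<ominus>\<^bsub>M\<^esub> v = (\<ominus>\<^bsub>L0 m\<^esub> \<one>\<^bsub>L0 m\<^esub>) \<odot>\<^bsub>M\<^esub> v"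
    using smult_l_minus[of "\<one>\<^bsub>L0 m\<^esub>" v] assms by simp
  then have "AE x in m. nm (\<ominus>\<^bsub>M\<^esub> v) x = \<bar>L0_rep (\<ominus>\<^bsub>L0 m\<^esub> \<one>\<^bsub>L0 m\<^esub>) x\<bar> * nm v x"
    using nm_smult[of "\<ominus>\<^bsub>L0 m\<^esub> \<one>\<^bsub>L0 m\<^esub>" v] assms by simp
  with L0_rep_uminus[OF L0_ops_closed(2), of m] L0_rep_one[of m] show ?thesis
    by eventually_elim simp
qed

lemma nm_minus_commute:
  assumes "v \<in> carrier M" "w \<in> carrier M"
  shows "AE x in m. nm (v \<ominus>\<^bsub>M\<^esub> w) x = nm (w \<ominus>\<^bsub>M\<^esub> v) x"
proof -
  have "v \<ominus>\<^bsub>M\<^esub> w = \<ominus>\<^bsub>M\<^esub> (w \<ominus>\<^bsub>M\<^esub> v)"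
    using assms by (simp add: a_minus_def minus_add a_comm)
  then show ?thesis using nm_uminus[of "w \<ominus>\<^bsub>M\<^esub> v"] assms by simp
qed

lemma nm_triangle:
  assumes "u \<in> carrier M" "v \<in> carrier M" "w \<in> carrier M"
  shows "AE x in m. nm (u \<ominus>\<^bsub>M\<^esub> w) x \<le> nm (u \<ominus>\<^bsub>M\<^esub> v) x + nm (v \<ominus>\<^bsub>M\<^esub> w) x"
proof -
  have "u \<ominus>\<^bsub>M\<^esub> w = (u \<ominus>\<^bsub>M\<^esub> v) \<oplus>\<^bsub>M\<^esub> (v \<ominus>\<^bsub>M\<^esub> w)"
    using assms by (simp add: a_minus_def a_assoc r_neg1)
  then show ?thesis using nm_add[of "u \<ominus>\<^bsub>M\<^esub> v" "v \<ominus>\<^bsub>M\<^esub> w"] assms by simp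
qed

section \<open>The distance and its completeness\<close>

lemma integrable_min_nm:
  assumes "equivalent_prob m m'" "v \<in> carrier M"
  shows "integrable m' (\<lambda>x. min (nm v x) 1)"
proof -
  interpret P: prob_space m' using assms by (simp add: equivalent_prob_def)
  have [measurable]: "nm v \<in> borel_measurable m'"
    using assms by (simp add: equivalent_prob_measurable)
  have "AE x in m'. 0 \<le> nm v x" using nm_nonneg assms by (simp add: equivalent_prob_AE)
  then have "AE x in m'. norm (min (nm v x) 1) \<le> 1" by eventually_elim simp
  then show ?thesis by (rule P.integrable_const_bound) measurable
qed

lemma AE_eq_0_if_integral_min_eq_0:
  assumes "equivalent_prob m m'" "v \<in> carrier M" "(\<integral>x. min (nm v x) 1 \<partial>m') = 0"
  shows "v = \<zero>\<^bsub>M\<^esub>"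
proof -
  have nn: "AE x in m'. 0 \<le> nm v x" using nm_nonneg assms by (simp add: equivalent_prob_AE)
  then have "AE x in m'. 0 \<le> min (nm v x) 1" by eventually_elim simp
  then have "AE x in m'. min (nm v x) 1 = 0"
    using integral_nonneg_eq_0_iff_AE integrable_min_nm assms by blast
  then have "AE x in m'. nm v x = 0" by eventually_elim (simp add: min_def split: if_splits)
  then show ?thesis using assms by (simp add: equivalent_prob_AE nm_eq_0_iff)
qed

text \<open>The map \<open>t \<mapsto> min t 1\<close> is subadditive on nonnegative reals, so the
  triangle inequality survives the truncation. A nonnegative integrand with zero integral vanishes
  a.e., so definiteness comes from that of the pointwise norm.\<close>

lemma Metric_space_module_dist:
  assumes e: "equivalent_prob m m'"
  shows "Metric_space (carrier M) (module_dist m' M)"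
proof
  fix v w
  show "0 \<le> module_dist m' M v w"
  proof (cases "v \<in> carrier M \<and> w \<in> carrier M")
    case True
    then have "AE x in m'. 0 \<le> nm (v \<ominus>\<^bsub>M\<^esub> w) x"
      using nm_nonneg[of "v \<ominus>\<^bsub>M\<^esub> w"] e by (simp add: equivalent_prob_AE)
    then have "AE x in m'. 0 \<le> min (nm (v \<ominus>\<^bsub>M\<^esub> w) x) 1" by eventually_elim simp
    then have "0 \<le> (\<integral>x. min (nm (v \<ominus>\<^bsub>M\<^esub> w) x) 1 \<partial>m')" by (rule integral_nonneg_AE)
    then show ?thesis by (simp add: module_dist_def)
  qed (auto simp: module_dist_def)
  show "module_dist m' M v w = module_dist m' M w v"
  proof (cases "v \<in> carrier M \<and> w \<in> carrier M")
    case True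
    then have "AE x in m'. nm (v \<ominus>\<^bsub>M\<^esub> w) x = nm (w \<ominus>\<^bsub>M\<^esub> v) x"
      using nm_minus_commute e by (simp add: equivalent_prob_AE)
    then have "AE x in m'. min (nm (v \<ominus>\<^bsub>M\<^esub> w) x) 1 = min (nm (w \<ominus>\<^bsub>M\<^esub> v) x) 1"
      by eventually_elim simp
    then show ?thesis using True integrable_min_nm[OF e] by (auto simp: module_dist_def intro: integral_cong_AE)
  qed (auto simp: module_dist_def)
next
  fix v w assume vw: "v \<in> carrier M" "w \<in> carrier M"
  show "module_dist m' M v w = 0 \<longleftrightarrow> v = w"
  proof
    assume "module_dist m' M v w = 0"
    then have "v \<ominus>\<^bsub>M\<^esub> w = \<zero>\<^bsub>M\<^esub>"
      using vw e by (intro AE_eq_0_if_integral_min_eq_0[OF e]) (auto simp: module_dist_def)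
    then show "v = w" using vw minus_equality[of v "\<ominus>\<^bsub>M\<^esub> w"] by (simp add: a_minus_def)
  next
    assume "v = w"
    then have "AE x in m'. nm (v \<ominus>\<^bsub>M\<^esub> w) x = 0"
      using vw e by (simp add: equivalent_prob_AE nm_eq_0_iff a_minus_def r_neg)
    then have "AE x in m'. min (nm (v \<ominus>\<^bsub>M\<^esub> w) x) 1 = 0" by eventually_elim simp
    then show "module_dist m' M v w = 0" using vw by (simp add: module_dist_def integral_eq_zero_AE)
  qed
next
  fix u v w assume c: "u \<in> carrier M" "v \<in> carrier M" "w \<in> carrier M"
  have "AE x in m'. nm (u \<ominus>\<^bsub>M\<^esub> w) x \<le> nm (u \<ominus>\<^bsub>M\<^esub> v) x + nm (v \<ominus>\<^bsub>M\<^esub> w) x"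
    "AE x in m'. 0 \<le> nm (u \<ominus>\<^bsub>M\<^esub> v) x" "AE x in m'. 0 \<le> nm (v \<ominus>\<^bsub>M\<^esub> w) x"
    using nm_triangle[OF c] nm_nonneg c e by (simp_all add: equivalent_prob_AE)
  then have "AE x in m'. min (nm (u \<ominus>\<^bsub>M\<^esub> w) x) 1 \<le> min (nm (u \<ominus>\<^bsub>M\<^esub> v) x) 1 + min (nm (v \<ominus>\<^bsub>M\<^esub> w) x) 1"
    by eventually_elim simp
  then have "(\<integral>x. min (nm (u \<ominus>\<^bsub>M\<^esub> w) x) 1 \<partial>m') \<le>
      (\<integral>x. min (nm (u \<ominus>\<^bsub>M\<^esub> v) x) 1 + min (nm (v \<ominus>\<^bsub>M\<^esub> w) x) 1 \<partial>m')"
    using integrable_min_nm[OF e] c by (intro integral_mono_AE) auto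
  then show "module_dist m' M u w \<le> module_dist m' M u v + module_dist m' M v w"
    using integrable_min_nm[OF e] c by (simp add: module_dist_def)
qed

text \<open>Dominated convergence: the truncated norms are bounded by 1, which is integrable for a
  probability.\<close>

lemma module_dist_tendsto_0:
  assumes e: "equivalent_prob m m'" and c: "\<And>n. v n \<in> carrier M" "l \<in> carrier M"
    and "AE x in m. (\<lambda>n. nm (v n \<ominus>\<^bsub>M\<^esub> l) x) \<longlonglongrightarrow> 0"
  shows "(\<lambda>n. module_dist m' M (v n) l) \<longlonglongrightarrow> 0"
proof -
  interpret P: prob_space m' using e by (simp add: equivalent_prob_def)
  have "(\<lambda>n. \<integral>x. min (nm (v n \<ominus>\<^bsub>M\<^esub> l) x) 1 \<partial>m') \<longlonglongrightarrow> (\<integral>x. 0 \<partial>m')"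
  proof (rule integral_dominated_convergence[where w = "\<lambda>x. 1"])
    show "(\<lambda>x. min (nm (v n \<ominus>\<^bsub>M\<^esub> l) x) 1) \<in> borel_measurable m'" for n
      using integrable_min_nm[OF e, of "v n \<ominus>\<^bsub>M\<^esub> l"] c by auto
    have "AE x in m'. (\<lambda>n. nm (v n \<ominus>\<^bsub>M\<^esub> l) x) \<longlonglongrightarrow> 0"
      using assms(4) e by (simp add: equivalent_prob_AE)
    then show "AE x in m'. (\<lambda>n. min (nm (v n \<ominus>\<^bsub>M\<^esub> l) x) 1) \<longlonglongrightarrow> 0"
    proof eventually_elim
      case (elim x)
      then show ?case using tendsto_min[OF elim tendsto_const[of 1]] by simp
    qed
    show "AE x in m'. norm (min (nm (v n \<ominus>\<^bsub>M\<^esub> l) x) 1) \<le> 1" for n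
    proof -
      have "AE x in m'. 0 \<le> nm (v n \<ominus>\<^bsub>M\<^esub> l) x"
        using nm_nonneg[of "v n \<ominus>\<^bsub>M\<^esub> l"] c e by (simp add: equivalent_prob_AE)
      then show ?thesis by eventually_elim simp
    qed
  qed auto
  then show ?thesis using c by (simp add: module_dist_def)
qed

text \<open>The truncated increments have a finite sum of integrals, hence are summable at almost
  every point. There they tend to 0, so eventually the truncation at 1 has no effect.\<close>

lemma AE_summable_if_fast_Cauchy:
  assumes e: "equivalent_prob m m'" and c: "\<And>n. v n \<in> carrier M"
    and fast: "\<And>n. module_dist m' M (v (Suc n)) (v n) \<le> (1/2) ^ n"
  shows "AE x in m. summable (\<lambda>n. nm (v (Suc n) \<ominus>\<^bsub>M\<^esub> v n) x)"
proof -
  define g where "g n x = min (nm (v (Suc n) \<ominus>\<^bsub>M\<^esub> v n) x) 1" for n x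
  have gi: "integrable m' (g n)" for n
    unfolding g_def using integrable_min_nm[OF e] c by simp
  have nn: "AE x in m'. \<forall>n. 0 \<le> nm (v (Suc n) \<ominus>\<^bsub>M\<^esub> v n) x"
    using nm_nonneg c e by (simp add: equivalent_prob_AE AE_all_countable)
  then have g0: "AE x in m'. 0 \<le> g n x" for n by eventually_elim (simp add: g_def)
  have [measurable]: "g n \<in> borel_measurable m'" for n using gi by auto
  have "(\<integral>\<^sup>+x. (\<Sum>n. ennreal (g n x)) \<partial>m') = (\<Sum>n. \<integral>\<^sup>+x. ennreal (g n x) \<partial>m')"
    by (rule nn_integral_suminf) measurable
  also have "\<dots> = (\<Sum>n. ennreal (\<integral>x. g n x \<partial>m'))"
    using gi g0 by (simp add: nn_integral_eq_integral)
  also have "\<dots> \<le> (\<Sum>n. ennreal ((1/2) ^ n))"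
    using fast c by (intro suminf_le ennreal_leI) (auto simp: g_def module_dist_def)
  also have "\<dots> = ennreal (\<Sum>n. (1/2) ^ n)"
    by (rule suminf_ennreal2) auto
  also have "\<dots> < \<infinity>" by simp
  finally have "AE x in m'. (\<Sum>n. ennreal (g n x)) \<noteq> \<infinity>"
    by (intro nn_integral_PInf_AE) auto
  with nn have "AE x in m'. summable (\<lambda>n. nm (v (Suc n) \<ominus>\<^bsub>M\<^esub> v n) x)"
  proof eventually_elim
    case (elim x)
    then have s: "summable (\<lambda>n. g n x)"
      by (intro summable_suminf_not_top) (auto simp: g_def)
    then have "eventually (\<lambda>n. g n x < 1) sequentially"
      by (intro order_tendstoD[OF summable_LIMSEQ_zero]) auto
    then have "eventually (\<lambda>n. g n x = nm (v (Suc n) \<ominus>\<^bsub>M\<^esub> v n) x) sequentially"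
      by eventually_elim (auto simp: g_def min_def split: if_splits)
    with s show ?case using summable_cong by fastforce
  qed
  then show ?thesis using e by (simp add: equivalent_prob_AE)
qed

text \<open>Handles all equivalent probabilities at once: a Cauchy sequence has a subsequence with
  increments at most \<open>(1/2) ^ n\<close>, the criterion supplies a limit of it, and a Cauchy
  sequence converges as soon as some subsequence does.\<close>

lemma normed_L0_moduleI:
  assumes lim: "\<And>v. (\<And>n. v n \<in> carrier M) \<Longrightarrow> AE x in m. summable (\<lambda>n. nm (v (Suc n) \<ominus>\<^bsub>M\<^esub> v n) x) \<Longrightarrow>
      \<exists>l\<in>carrier M. AE x in m. (\<lambda>n. nm (v n \<ominus>\<^bsub>M\<^esub> l) x) \<longlonglongrightarrow> 0"
  shows "normed_L0_module m M"
  unfolding normed_L0_module_def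
proof (intro conjI allI impI)
  show "Module.module (L0 m) M" by (rule module_axioms)
  show "pointwise_norm m M" by (rule pointwise_norm)
  fix m' assume e: "equivalent_prob m m'"
  interpret D: Metric_space "carrier M" "module_dist m' M" using e by (rule Metric_space_module_dist)
  show "D.mcomplete"
    unfolding D.mcomplete_def
  proof (intro allI impI)
    fix s assume s: "D.MCauchy s"
    then have sc: "s n \<in> carrier M" for n by (auto simp: D.MCauchy_def)
    have "\<exists>N. \<forall>i\<ge>N. \<forall>j\<ge>N. module_dist m' M (s i) (s j) < (1/2) ^ n" for n
      using s unfolding D.MCauchy_def by (meson half_gt_zero_iff zero_less_divide_1_iff zero_less_numeral zero_less_power)
    then obtain N where N: "\<And>n i j. N n \<le> i \<Longrightarrow> N n \<le> j \<Longrightarrow> module_dist m' M (s i) (s j) < (1/2) ^ n"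
      by metis
    \<comment> \<open>\<open>Suc k\<close> makes \<open>r\<close> strictly increasing;
      \<open>N (Suc n)\<close> puts the new index where mutual distances are below
      \<open>(1/2) ^ Suc n\<close>.\<close>
    define r where "r = rec_nat (N 0) (\<lambda>n k. max (Suc k) (N (Suc n)))"
    have r: "r (Suc n) = max (Suc (r n)) (N (Suc n))" "N n \<le> r n" for n
      by (auto simp: r_def split: nat.splits) (cases n; auto)
    have "strict_mono r" by (rule strict_mono_Suc_iff[THEN iffD2]) (simp add: r(1) less_max_iff_disj)
    have "module_dist m' M (s (r (Suc n))) (s (r n)) \<le> (1/2) ^ n" for n
    proof -
      have "N n \<le> r (Suc n)" using r(2)[of n] by (auto simp: r(1) le_max_iff_disj)
      then show ?thesis using N[OF _ r(2)[of n]] by (auto intro: less_imp_le)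
    qed
    then have "AE x in m. summable (\<lambda>n. nm (s (r (Suc n)) \<ominus>\<^bsub>M\<^esub> s (r n)) x)"
      using AE_summable_if_fast_Cauchy[OF e, of "\<lambda>n. s (r n)"] sc by simp
    then obtain l where l: "l \<in> carrier M" "AE x in m. (\<lambda>n. nm (s (r n) \<ominus>\<^bsub>M\<^esub> l) x) \<longlonglongrightarrow> 0"
      using lim[of "\<lambda>n. s (r n)"] sc by auto
    then have "(\<lambda>n. module_dist m' M (s (r n)) l) \<longlonglongrightarrow> 0"
      using e sc by (intro module_dist_tendsto_0) auto
    then have "limitin D.mtopology (s \<circ> r) l sequentially"
      using l(1) sc by (simp add: D.limitin_metric_dist_null)
    then show "\<exists>l. limitin D.mtopology s l sequentially"
      using D.MCauchy_convergent_subsequence s \<open>strict_mono r\<close> by blast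
  qed
qed

end

lemma normed_L0_module_pn: "normed_L0_module m M \<Longrightarrow> pn_module m M"
  by (simp add: normed_L0_module_def pn_module_def pn_module_axioms_def)

section \<open>Functionals, continuity and boundedness\<close>

lemma L0_module_simps [simp]:
  "carrier (L0_module m) = carrier (L0 m)" "add (L0_module m) = add (L0 m)"
  "zero (L0_module m) = zero (L0 m)" "smult (L0_module m) = mult (L0 m)"
  "pnorm (L0_module m) = L0_abs m"
  by (simp_all add: L0_module_def)

lemma L0_module_minus [simp]: "a \<ominus>\<^bsub>L0_module m\<^esub> b = a \<ominus>\<^bsub>L0 m\<^esub> b"
  by (simp add: a_minus_def a_inv_def m_inv_def)

lemma pn_module_L0_module: "pn_module m (L0_module m)"
proof -
  interpret cring "L0 m" by (rule cring_L0)
  have "Module.module (L0 m) (L0_module m)"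
  proof (rule moduleI)
    show "abelian_group (L0_module m)"
    proof (rule abelian_groupI)
      show "\<exists>b\<in>carrier (L0_module m). b \<oplus>\<^bsub>L0_module m\<^esub> a = \<zero>\<^bsub>L0_module m\<^esub>"
        if "a \<in> carrier (L0_module m)" for a
        using that by (intro bexI[of _ "\<ominus>\<^bsub>L0 m\<^esub> a"]) (auto simp: l_neg)
    qed (simp_all add: a_ac)
  qed (auto simp: cring_L0 l_distr r_distr m_assoc)
  moreover have "pointwise_norm m (L0_module m)"
    unfolding pointwise_norm_def
  proof (intro conjI ballI)
    fix v assume v: "v \<in> carrier (L0_module m)"
    show "L0_le m \<zero>\<^bsub>L0 m\<^esub> (pnorm (L0_module m) v)"
      unfolding L0_le_def using L0_rep_zero[of m] L0_rep_abs[of v m] v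
      by (auto elim!: eventually_elim2)
    show "pnorm (L0_module m) v = \<zero>\<^bsub>L0 m\<^esub> \<longleftrightarrow> v = \<zero>\<^bsub>L0_module m\<^esub>"
    proof
      assume "pnorm (L0_module m) v = \<zero>\<^bsub>L0 m\<^esub>"
      then have "AE x in m. L0_rep v x = 0"
        using L0_rep_zero[of m] L0_rep_abs[of v m] v by (auto elim!: eventually_elim2)
      then show "v = \<zero>\<^bsub>L0_module m\<^esub>"
        using L0_rep_zero[of m] v by (intro L0_eqI[where m = m]) (auto elim!: eventually_elim2)
    next
      assume "v = \<zero>\<^bsub>L0_module m\<^esub>"
      then show "pnorm (L0_module m) v = \<zero>\<^bsub>L0 m\<^esub>"
        using L0_rep_zero[of m] L0_rep_abs[of v m] v
        by (intro L0_eqI[where m = m]) (auto elim!: eventually_elim2)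
    qed
    fix w assume w: "w \<in> carrier (L0_module m)"
    have "AE x in m. L0_rep (v \<oplus>\<^bsub>L0 m\<^esub> w) x = L0_rep v x + L0_rep w x"
      "AE x in m. L0_rep (L0_abs m v \<oplus>\<^bsub>L0 m\<^esub> L0_abs m w) x = L0_rep (L0_abs m v) x + L0_rep (L0_abs m w) x"
      "AE x in m. L0_rep (L0_abs m (v \<oplus>\<^bsub>L0 m\<^esub> w)) x = \<bar>L0_rep (v \<oplus>\<^bsub>L0 m\<^esub> w) x\<bar>"
      "AE x in m. L0_rep (L0_abs m v) x = \<bar>L0_rep v x\<bar>" "AE x in m. L0_rep (L0_abs m w) x = \<bar>L0_rep w x\<bar>"
      using v w by (intro L0_rep_add L0_rep_abs; simp)+
    then show "L0_le m (pnorm (L0_module m) (v \<oplus>\<^bsub>L0_module m\<^esub> w))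
        (pnorm (L0_module m) v \<oplus>\<^bsub>L0 m\<^esub> pnorm (L0_module m) w)"
      unfolding L0_le_def L0_module_simps by eventually_elim simp
  next
    fix f v assume f: "f \<in> carrier (L0 m)" and v: "v \<in> carrier (L0_module m)"
    have "AE x in m. L0_rep (f \<otimes>\<^bsub>L0 m\<^esub> v) x = L0_rep f x * L0_rep v x"
      "AE x in m. L0_rep (L0_abs m f \<otimes>\<^bsub>L0 m\<^esub> L0_abs m v) x = L0_rep (L0_abs m f) x * L0_rep (L0_abs m v) x"
      "AE x in m. L0_rep (L0_abs m (f \<otimes>\<^bsub>L0 m\<^esub> v)) x = \<bar>L0_rep (f \<otimes>\<^bsub>L0 m\<^esub> v) x\<bar>"
      "AE x in m. L0_rep (L0_abs m f) x = \<bar>L0_rep f x\<bar>" "AE x in m. L0_rep (L0_abs m v) x = \<bar>L0_rep v x\<bar>"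
      using f v by (intro L0_rep_mult L0_rep_abs; simp)+
    then have "AE x in m. L0_rep (L0_abs m (f \<otimes>\<^bsub>L0 m\<^esub> v)) x = L0_rep (L0_abs m f \<otimes>\<^bsub>L0 m\<^esub> L0_abs m v) x"
      by eventually_elim (simp add: abs_mult)
    then show "pnorm (L0_module m) (f \<odot>\<^bsub>L0_module m\<^esub> v) = L0_abs m f \<otimes>\<^bsub>L0 m\<^esub> pnorm (L0_module m) v"
      using f v by (intro L0_eqI[where m = m]) simp_all
  qed auto
  ultimately show ?thesis by (simp add: pn_module_def pn_module_axioms_def)
qed

lemma L0_rep_abs_minus:
  assumes "a \<in> carrier (L0 m)" "b \<in> carrier (L0 m)"
  shows "AE x in m. L0_rep (L0_abs m (a \<ominus>\<^bsub>L0 m\<^esub> b)) x = \<bar>L0_rep a x - L0_rep b x\<bar>"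
  using L0_rep_minus[OF assms] L0_rep_abs[OF L0_ops_closed(6)[OF assms]] by eventually_elim simp

lemma L0_ex_limit:
  assumes a: "\<And>n. a n \<in> carrier (L0 m)"
    and s: "AE x in m. summable (\<lambda>n. \<bar>L0_rep (a (Suc n)) x - L0_rep (a n) x\<bar>)"
  shows "\<exists>l\<in>carrier (L0 m). AE x in m. (\<lambda>n. L0_rep (a n) x) \<longlonglongrightarrow> L0_rep l x"
proof
  \<comment> \<open>\<open>lim\<close> yields a measurable function outright; its arbitrary values
    at points of divergence fall into a null set.\<close>
  define f where "f x = lim (\<lambda>n. L0_rep (a n) x)" for x
  have f: "f \<in> borel_measurable m" using a unfolding f_def by measurable
  then show "L0_class m f \<in> carrier (L0 m)" by simp
  show "AE x in m. (\<lambda>n. L0_rep (a n) x) \<longlonglongrightarrow> L0_rep (L0_class m f) x"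
    using s AE_L0_rep_class[OF f]
  proof eventually_elim
    case (elim x)
    let ?d = "\<lambda>n. L0_rep (a (Suc n)) x - L0_rep (a n) x"
    have "summable ?d" using elim(1) by (intro summable_norm_cancel[of ?d]) simp
    then have "(\<lambda>n. L0_rep (a 0) x + (\<Sum>k<n. ?d k)) \<longlonglongrightarrow> L0_rep (a 0) x + suminf ?d"
      by (intro tendsto_intros summable_LIMSEQ)
    then have "(\<lambda>n. L0_rep (a n) x) \<longlonglongrightarrow> L0_rep (a 0) x + suminf ?d"
      using sum_lessThan_telescope[of "\<lambda>n. L0_rep (a n) x"] by simp
    then show ?case using elim(2) by (simp add: f_def limI)
  qed
qed

text \<open>Makes \<open>L0 m\<close> admissible as the vertex of a target, which is how the
  universal property of the direct limit reaches functionals.\<close>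

lemma normed_L0_module_L0: "normed_L0_module m (L0_module m)"
proof -
  interpret pn_module m "L0_module m" by (rule pn_module_L0_module)
  show ?thesis
  proof (rule normed_L0_moduleI)
    fix v :: "nat \<Rightarrow> 'a L0"
    assume "\<And>n. v n \<in> carrier (L0_module m)"
      and s: "AE x in m. summable (\<lambda>n. nm (v (Suc n) \<ominus>\<^bsub>L0_module m\<^esub> v n) x)"
    then have v: "v n \<in> carrier (L0 m)" for n by simp
    have "AE x in m. \<forall>n. L0_rep (L0_abs m (v (Suc n) \<ominus>\<^bsub>L0 m\<^esub> v n)) x = \<bar>L0_rep (v (Suc n)) x - L0_rep (v n) x\<bar>"
      using v by (simp add: AE_all_countable L0_rep_abs_minus)
    then have "AE x in m. summable (\<lambda>n. \<bar>L0_rep (v (Suc n)) x - L0_rep (v n) x\<bar>)"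
      using s by eventually_elim simp
    then obtain l where l: "l \<in> carrier (L0 m)" "AE x in m. (\<lambda>n. L0_rep (v n) x) \<longlonglongrightarrow> L0_rep l x"
      using L0_ex_limit[of v m] v by blast
    have "AE x in m. \<forall>n. L0_rep (L0_abs m (v n \<ominus>\<^bsub>L0 m\<^esub> l)) x = \<bar>L0_rep (v n) x - L0_rep l x\<bar>"
      using v l(1) by (simp add: AE_all_countable L0_rep_abs_minus)
    then have "AE x in m. (\<lambda>n. nm (v n \<ominus>\<^bsub>L0_module m\<^esub> l) x) \<longlonglongrightarrow> 0"
      using l(2)
    proof eventually_elim
      case (elim x)
      then show ?case using tendsto_rabs_zero[OF LIM_zero[OF elim(2)]] by simp
    qed
    then show "\<exists>l\<in>carrier (L0_module m). AE x in m. (\<lambda>n. nm (v n \<ominus>\<^bsub>L0_module m\<^esub> l) x) \<longlonglongrightarrow> 0"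
      using l(1) by auto
  qed
qed

section \<open>Linear functionals: continuity and boundedness\<close>

locale L0_functional = pn_module m M
  for m :: "'x measure" and M :: "('x L0, 'v) normed_module" and T :: "'v \<Rightarrow> 'x L0" +
  assumes linear: "L0_linear m M (L0_module m) T"
begin

lemma T_closed [simp]: "v \<in> carrier M \<Longrightarrow> T v \<in> carrier (L0 m)"
  using linear by (auto simp: L0_linear_def)

lemma T_add: "v \<in> carrier M \<Longrightarrow> w \<in> carrier M \<Longrightarrow> T (v \<oplus>\<^bsub>M\<^esub> w) = T v \<oplus>\<^bsub>L0 m\<^esub> T w"
  using linear by (auto simp: L0_linear_def)

lemma T_smult: "f \<in> carrier (L0 m) \<Longrightarrow> v \<in> carrier M \<Longrightarrow> T (f \<odot>\<^bsub>M\<^esub> v) = f \<otimes>\<^bsub>L0 m\<^esub> T v"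
  using linear by (auto simp: L0_linear_def)

lemma T_zero: "T \<zero>\<^bsub>M\<^esub> = \<zero>\<^bsub>L0 m\<^esub>"
  using T_smult[of "\<zero>\<^bsub>L0 m\<^esub>" "\<zero>\<^bsub>M\<^esub>"] by simp

lemma rep_T_add:
  "v \<in> carrier M \<Longrightarrow> w \<in> carrier M \<Longrightarrow> AE x in m. L0_rep (T (v \<oplus>\<^bsub>M\<^esub> w)) x = L0_rep (T v) x + L0_rep (T w) x"
  by (simp add: T_add L0_rep_add)

lemma rep_T_smult:
  "f \<in> carrier (L0 m) \<Longrightarrow> v \<in> carrier M \<Longrightarrow> AE x in m. L0_rep (T (f \<odot>\<^bsub>M\<^esub> v)) x = L0_rep f x * L0_rep (T v) x"
  by (simp add: T_smult L0_rep_mult)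

lemma rep_T_minus:
  assumes "v \<in> carrier M" "w \<in> carrier M"
  shows "AE x in m. L0_rep (T (v \<ominus>\<^bsub>M\<^esub> w)) x = L0_rep (T v) x - L0_rep (T w) x"
proof -
  have "(v \<ominus>\<^bsub>M\<^esub> w) \<oplus>\<^bsub>M\<^esub> w = v" using assms by (simp add: a_minus_def a_assoc l_neg)
  then show ?thesis using rep_T_add[of "v \<ominus>\<^bsub>M\<^esub> w" w] assms by (auto elim!: eventually_mono)
qed

text \<open>Off the set \<open>{c > C}\<close>, whose probability is small, \<open>T\<close> is \<open>C\<close>-Lipschitz.\<close>

lemma continuous_if_bounded:
  assumes c: "c \<in> carrier (L0 m)"
    and bound: "\<And>v. v \<in> carrier M \<Longrightarrow> AE x in m. \<bar>L0_rep (T v) x\<bar> \<le> L0_rep c x * nm v x"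
  shows "L0_continuous m M (L0_module m) T"
  unfolding L0_continuous_def
proof (intro allI impI)
  fix m' assume e: "equivalent_prob m m'"
  interpret N: pn_module m "L0_module m" by (rule pn_module_L0_module)
  interpret P: prob_space m' using e by (simp add: equivalent_prob_def)
  interpret D: Metric_space "carrier M" "module_dist m' M" using e by (rule Metric_space_module_dist)
  have cm: "L0_rep c \<in> borel_measurable m'" using c e by (simp add: equivalent_prob_measurable)
  have "\<exists>\<delta>>0. \<forall>w. w \<in> carrier M \<and> module_dist m' M v w < \<delta> \<longrightarrow> module_dist m' (L0_module m) (T v) (T w) < \<epsilon>"
    if v: "v \<in> carrier M" and \<epsilon>: "\<epsilon> > 0" for v and \<epsilon> :: real
  proof -
    \<comment> \<open>As \<open>c\<close> is finite everywhere, these sets decrease to the empty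
      set, so some of them has small probability.\<close>
    define A where "A n = {x \<in> space m'. L0_rep c x > real n}" for n
    have A: "A n \<in> sets m'" for n using cm by (simp add: A_def)
    have "(\<lambda>n. measure m' (A n)) \<longlonglongrightarrow> measure m' (\<Inter>n. A n)"
      using A by (intro P.finite_Lim_measure_decseq) (auto simp: A_def decseq_def)
    moreover have "(\<Inter>n. A n) = {}"
      by (auto simp: A_def) (meson less_le_not_le order_less_le real_arch_simple)
    ultimately have "(\<lambda>n. measure m' (A n)) \<longlonglongrightarrow> 0" by simp
    then have "eventually (\<lambda>n. measure m' (A n) < \<epsilon>/2) sequentially"
      using \<epsilon> by (intro order_tendstoD) auto
    \<comment> \<open>The requirement \<open>n \<ge> 1\<close> lets the truncation pass through the
      Lipschitz bound: \<open>min (C * t) 1 \<le> C * min t 1\<close> holds for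
      \<open>C \<ge> 1\<close> and \<open>t \<ge> 0\<close>.\<close>
    then have "eventually (\<lambda>n. measure m' (A n) < \<epsilon>/2 \<and> n \<ge> 1) sequentially"
      using eventually_ge_at_top by (rule eventually_conj)
    then obtain C where C: "measure m' (A C) < \<epsilon>/2" "C \<ge> 1"
      by (auto simp: eventually_sequentially)
    show ?thesis
    proof (intro exI[of _ "\<epsilon> / (2 * C)"] conjI allI impI)
      show "\<epsilon> / (2 * C) > 0" using C \<epsilon> by simp
      fix w assume w: "w \<in> carrier M \<and> module_dist m' M v w < \<epsilon> / (2 * C)"
      have "AE x in m. L0_rep (L0_abs m (T v \<ominus>\<^bsub>L0 m\<^esub> T w)) x = \<bar>L0_rep (T v) x - L0_rep (T w) x\<bar>"
        "AE x in m. L0_rep (T (v \<ominus>\<^bsub>M\<^esub> w)) x = L0_rep (T v) x - L0_rep (T w) x"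
        "AE x in m. \<bar>L0_rep (T (v \<ominus>\<^bsub>M\<^esub> w)) x\<bar> \<le> L0_rep c x * nm (v \<ominus>\<^bsub>M\<^esub> w) x"
        "AE x in m. 0 \<le> nm (v \<ominus>\<^bsub>M\<^esub> w) x"
        using v w by (simp_all add: L0_rep_abs_minus rep_T_minus bound nm_nonneg)
      then have "AE x in m'. L0_rep (L0_abs m (T v \<ominus>\<^bsub>L0 m\<^esub> T w)) x = \<bar>L0_rep (T v) x - L0_rep (T w) x\<bar>"
        "AE x in m'. L0_rep (T (v \<ominus>\<^bsub>M\<^esub> w)) x = L0_rep (T v) x - L0_rep (T w) x"
        "AE x in m'. \<bar>L0_rep (T (v \<ominus>\<^bsub>M\<^esub> w)) x\<bar> \<le> L0_rep c x * nm (v \<ominus>\<^bsub>M\<^esub> w) x"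
        "AE x in m'. 0 \<le> nm (v \<ominus>\<^bsub>M\<^esub> w) x"
        using e by (simp_all add: equivalent_prob_AE)
      moreover have "AE x in m'. x \<in> space m'" by simp
      ultimately have "AE x in m'. min (N.nm (T v \<ominus>\<^bsub>L0_module m\<^esub> T w) x) 1
          \<le> real C * min (nm (v \<ominus>\<^bsub>M\<^esub> w) x) 1 + indicator (A C) x"
      proof eventually_elim
        case (elim x)
        show ?case
        proof (cases "x \<in> A C")
          case True
          moreover have "0 \<le> real C * min (nm (v \<ominus>\<^bsub>M\<^esub> w) x) 1" using elim(4) by simp
          ultimately show ?thesis by simp
        next
          case False
          then have "L0_rep c x \<le> real C" using elim(5) by (simp add: A_def not_less)
          then have "L0_rep c x * nm (v \<ominus>\<^bsub>M\<^esub> w) x \<le> real C * nm (v \<ominus>\<^bsub>M\<^esub> w) x"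
            using elim(4) by (rule mult_right_mono)
          then show ?thesis using elim False C by (auto simp: min_def)
        qed
      qed
      moreover have iM: "integrable m' (\<lambda>x. min (nm (v \<ominus>\<^bsub>M\<^esub> w) x) 1)"
        and iN: "integrable m' (\<lambda>x. min (N.nm (T v \<ominus>\<^bsub>L0_module m\<^esub> T w) x) 1)"
        using integrable_min_nm[OF e] N.integrable_min_nm[OF e] v w by simp_all
      moreover have iA: "integrable m' (indicator (A C) :: _ \<Rightarrow> real)"
        using A by (simp add: less_top[symmetric])
      ultimately have "(\<integral>x. min (N.nm (T v \<ominus>\<^bsub>L0_module m\<^esub> T w) x) 1 \<partial>m')
          \<le> (\<integral>x. real C * min (nm (v \<ominus>\<^bsub>M\<^esub> w) x) 1 + indicator (A C) x \<partial>m')"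
        by (intro integral_mono_AE) auto
      also have "\<dots> = real C * (\<integral>x. min (nm (v \<ominus>\<^bsub>M\<^esub> w) x) 1 \<partial>m') + measure m' (A C)"
        using iM iA A by simp
      finally have "module_dist m' (L0_module m) (T v) (T w) \<le> real C * module_dist m' M v w + measure m' (A C)"
        using v w by (simp add: module_dist_def)
      also have "\<dots> < \<epsilon>"
      proof -
        have "real C * module_dist m' M v w \<le> \<epsilon> / 2" using w C by (simp add: field_simps)
        then show ?thesis using C(1) by simp
      qed
      finally show "module_dist m' (L0_module m) (T v) (T w) < \<epsilon>" .
    qed
  qed
  then show "continuous_map D.mtopology (Metric_space.mtopology (carrier (L0_module m)) (module_dist m' (L0_module m))) T"
    using D.metric_continuous_map[OF N.Metric_space_module_dist[OF e], of T] by auto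
qed

definition unit_ball :: "'v set" where "unit_ball = {v \<in> carrier M. AE x in m. nm v x \<le> 1}"

lemma unit_ball_closed [simp]: "v \<in> unit_ball \<Longrightarrow> v \<in> carrier M" by (simp add: unit_ball_def)

lemma unit_ball_nm: "v \<in> unit_ball \<Longrightarrow> AE x in m. nm v x \<le> 1" unfolding unit_ball_def by blast

text \<open>Gluing: with \<open>p\<close> the indicator of the set where
  \<open>\<bar>T w\<bar> \<le> \<bar>T v\<bar>\<close>, the vector
  \<open>u = p v + (1 - p) w\<close> stays in the unit ball, because at each point only one
  coefficient is nonzero, and linearity over \<open>L0 m\<close> makes
  \<open>\<bar>T u\<bar>\<close> the maximum of \<open>\<bar>T v\<bar>\<close> and
  \<open>\<bar>T w\<bar>\<close> a.e.\<close>

lemma unit_ball_directed: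
  assumes v: "v \<in> unit_ball" and w: "w \<in> unit_ball"
  shows "\<exists>u\<in>unit_ball. AE x in m. \<bar>L0_rep (T v) x\<bar> \<le> \<bar>L0_rep (T u) x\<bar> \<and> \<bar>L0_rep (T w) x\<bar> \<le> \<bar>L0_rep (T u) x\<bar>"
proof -
  define p q :: "'x \<Rightarrow> real" where
    "p x = (if \<bar>L0_rep (T w) x\<bar> \<le> \<bar>L0_rep (T v) x\<bar> then 1 else 0)" and "q x = 1 - p x" for x
  have [measurable]: "L0_rep (T v) \<in> borel_measurable m" "L0_rep (T w) \<in> borel_measurable m"
    using v w by simp_all
  have p: "p \<in> borel_measurable m" unfolding p_def by measurable
  then have q: "q \<in> borel_measurable m" unfolding q_def by measurable
  have pc: "L0_class m p \<in> carrier (L0 m)" and qc: "L0_class m q \<in> carrier (L0 m)"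
    using p q by simp_all
  have vc: "v \<in> carrier M" "AE x in m. nm v x \<le> 1" and wc: "w \<in> carrier M" "AE x in m. nm w x \<le> 1"
    using v w by (simp_all add: unit_ball_nm)
  define u where "u = (L0_class m p \<odot>\<^bsub>M\<^esub> v) \<oplus>\<^bsub>M\<^esub> (L0_class m q \<odot>\<^bsub>M\<^esub> w)"
  have pv: "L0_class m p \<odot>\<^bsub>M\<^esub> v \<in> carrier M" and qw: "L0_class m q \<odot>\<^bsub>M\<^esub> w \<in> carrier M"
    using pc qc vc wc by simp_all
  then have u: "u \<in> carrier M" by (simp add: u_def)
  have "AE x in m. nm u x \<le> 1"
    using nm_add[OF pv qw] nm_smult[OF pc vc(1)] nm_smult[OF qc wc(1)] vc(2) wc(2)
      AE_L0_rep_class[OF p] AE_L0_rep_class[OF q] unfolding u_def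
    by eventually_elim (auto simp: p_def q_def split: if_splits)
  then have "u \<in> unit_ball" using u unfolding unit_ball_def by blast
  moreover have "AE x in m. \<bar>L0_rep (T v) x\<bar> \<le> \<bar>L0_rep (T u) x\<bar> \<and> \<bar>L0_rep (T w) x\<bar> \<le> \<bar>L0_rep (T u) x\<bar>"
    using rep_T_add[OF pv qw] rep_T_smult[OF pc vc(1)] rep_T_smult[OF qc wc(1)]
      AE_L0_rep_class[OF p] AE_L0_rep_class[OF q] unfolding u_def
    by eventually_elim (auto simp: p_def q_def split: if_splits)
  ultimately show ?thesis by blast
qed

lemma unit_ball_finite_upper_bound:
  assumes "\<And>k. v k \<in> unit_ball"
  shows "\<exists>u\<in>unit_ball. AE x in m. \<forall>k\<le>(n::nat). \<bar>L0_rep (T (v k)) x\<bar> \<le> \<bar>L0_rep (T u) x\<bar>"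
proof (induction n)
  case 0
  show ?case using assms[of 0] by (intro bexI[of _ "v 0"]) simp_all
next
  case (Suc n)
  then obtain u where u: "u \<in> unit_ball" "AE x in m. \<forall>k\<le>n. \<bar>L0_rep (T (v k)) x\<bar> \<le> \<bar>L0_rep (T u) x\<bar>"
    by blast
  obtain u' where u': "u' \<in> unit_ball"
    "AE x in m. \<bar>L0_rep (T u) x\<bar> \<le> \<bar>L0_rep (T u') x\<bar> \<and> \<bar>L0_rep (T (v (Suc n))) x\<bar> \<le> \<bar>L0_rep (T u') x\<bar>"
    using unit_ball_directed[OF u(1) assms] by blast
  have "AE x in m. \<forall>k\<le>Suc n. \<bar>L0_rep (T (v k)) x\<bar> \<le> \<bar>L0_rep (T u') x\<bar>"
    using u(2) u'(2)
  proof eventually_elim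
    case (elim x)
    show ?case
    proof (intro allI impI)
      fix k assume "k \<le> Suc n"
      then consider "k \<le> n" | "k = Suc n" by (auto simp: le_Suc_eq)
      then show "\<bar>L0_rep (T (v k)) x\<bar> \<le> \<bar>L0_rep (T u') x\<bar>"
        using elim by cases (blast intro: order_trans, blast)
    qed
  qed
  then show ?case using u'(1) by blast
qed

text \<open>Markov's inequality for \<open>k v\<close> with the constant
  \<open>k = \<delta> / 2\<close>: this vector lies within \<open>\<delta>\<close> of 0, so the
  integral of \<open>min \<bar>T (k v)\<bar> 1\<close> is below \<open>\<epsilon>\<close>, and the
  integrand is 1 wherever \<open>\<bar>T v\<bar> > 2 / \<delta>\<close>. That the threshold does not
  depend on \<open>v\<close> is what directedness exploits later.\<close>

lemma unit_ball_tail: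
  assumes cont: "L0_continuous m M (L0_module m) T" and e: "equivalent_prob m m'" and \<epsilon>: "\<epsilon> > 0"
  shows "\<exists>K>0. \<forall>v\<in>unit_ball. measure m' {x \<in> space m'. \<bar>L0_rep (T v) x\<bar> > K} \<le> \<epsilon>"
proof -
  interpret N: pn_module m "L0_module m" by (rule pn_module_L0_module)
  interpret P: prob_space m' using e by (simp add: equivalent_prob_def)
  interpret D: Metric_space "carrier M" "module_dist m' M" using e by (rule Metric_space_module_dist)
  interpret E: Metric_space "carrier (L0_module m)" "module_dist m' (L0_module m)"
    using e by (rule N.Metric_space_module_dist)
  have "continuous_map D.mtopology E.mtopology T"
    using cont e unfolding L0_continuous_def by blast
  then have "\<forall>a\<in>carrier M. \<forall>\<epsilon>>0. \<exists>\<delta>>0. \<forall>w. w \<in> carrier M \<and> module_dist m' M a w < \<delta> \<longrightarrow>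
      module_dist m' (L0_module m) (T a) (T w) < \<epsilon>"
    using D.metric_continuous_map[OF E.Metric_space_axioms, of T] by blast
  then obtain \<delta> where \<delta>0: "\<delta> > 0" and "\<forall>w. w \<in> carrier M \<and> module_dist m' M \<zero>\<^bsub>M\<^esub> w < \<delta> \<longrightarrow>
      module_dist m' (L0_module m) (T \<zero>\<^bsub>M\<^esub>) (T w) < \<epsilon>"
    using M.zero_closed \<epsilon> by blast
  then have \<delta>: "module_dist m' (L0_module m) (T w) \<zero>\<^bsub>L0 m\<^esub> < \<epsilon>"
    if "w \<in> carrier M" "module_dist m' M w \<zero>\<^bsub>M\<^esub> < \<delta>" for w
    using that D.commute[of w] E.commute[of "T w"] by (simp add: T_zero)
  show ?thesis
  proof (intro exI[of _ "2 / \<delta>"] conjI ballI)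
    show "2 / \<delta> > 0" using \<delta>0 by simp
    fix v assume v: "v \<in> unit_ball"
    define k where "k = L0_class m (\<lambda>x. \<delta> / 2)"
    have k: "k \<in> carrier (L0 m)" by (simp add: k_def)
    have krep: "AE x in m. L0_rep k x = \<delta> / 2" unfolding k_def by (rule AE_L0_rep_class) simp
    have kv: "k \<odot>\<^bsub>M\<^esub> v \<in> carrier M" using k v by simp
    have mn: "u \<ominus>\<^bsub>M\<^esub> \<zero>\<^bsub>M\<^esub> = u" if "u \<in> carrier M" for u using that by (simp add: a_minus_def)
    have mn0: "u \<ominus>\<^bsub>L0 m\<^esub> \<zero>\<^bsub>L0 m\<^esub> = u" if "u \<in> carrier (L0 m)" for u
      using that by (simp add: a_minus_def)
    have "AE x in m. nm (k \<odot>\<^bsub>M\<^esub> v) x = \<bar>L0_rep k x\<bar> * nm v x" "AE x in m. nm v x \<le> 1" "AE x in m. 0 \<le> nm v x"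
      using nm_smult[of k v] k v nm_nonneg by (simp_all add: unit_ball_nm)
    with krep have "AE x in m. nm (k \<odot>\<^bsub>M\<^esub> v) x \<le> \<delta> / 2"
    proof eventually_elim
      case (elim x)
      have "\<bar>\<delta> / 2\<bar> * nm v x \<le> \<bar>\<delta> / 2\<bar> * 1"
        using elim(3) by (intro mult_left_mono) auto
      then show ?case unfolding elim(1,2) using \<delta>0 by linarith
    qed
    then have "AE x in m'. min (nm (k \<odot>\<^bsub>M\<^esub> v) x) 1 \<le> \<delta> / 2"
      using e by (auto simp: equivalent_prob_AE elim!: eventually_mono)
    then have "(\<integral>x. min (nm (k \<odot>\<^bsub>M\<^esub> v) x) 1 \<partial>m') \<le> (\<integral>x. \<delta> / 2 \<partial>m')"
      using integrable_min_nm[OF e kv] by (intro integral_mono_AE) auto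
    then have "module_dist m' M (k \<odot>\<^bsub>M\<^esub> v) \<zero>\<^bsub>M\<^esub> < \<delta>"
      using kv \<delta>0 by (simp add: module_dist_def mn P.prob_space)
    then have lt: "module_dist m' (L0_module m) (T (k \<odot>\<^bsub>M\<^esub> v)) \<zero>\<^bsub>L0 m\<^esub> < \<epsilon>"
      using \<delta>[OF kv] by blast
    let ?B = "{x \<in> space m'. \<bar>L0_rep (T v) x\<bar> > 2 / \<delta>}"
    have [measurable]: "L0_rep (T v) \<in> borel_measurable m'" using v e by (simp add: equivalent_prob_measurable)
    have B: "?B \<in> sets m'" by measurable
    have "AE x in m. N.nm (T (k \<odot>\<^bsub>M\<^esub> v)) x = \<bar>L0_rep (T (k \<odot>\<^bsub>M\<^esub> v)) x\<bar>"
      "AE x in m. L0_rep (T (k \<odot>\<^bsub>M\<^esub> v)) x = L0_rep k x * L0_rep (T v) x"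
      using L0_rep_abs[of "T (k \<odot>\<^bsub>M\<^esub> v)" m] rep_T_smult[of k v] kv k v by simp_all
    with krep have "AE x in m. indicator ?B x \<le> min (N.nm (T (k \<odot>\<^bsub>M\<^esub> v)) x) 1"
    proof eventually_elim
      case (elim x)
      then show ?case using \<delta>0 by (auto simp: indicator_def abs_mult field_simps)
    qed
    then have "(\<integral>x. indicator ?B x \<partial>m') \<le> (\<integral>x. min (N.nm (T (k \<odot>\<^bsub>M\<^esub> v)) x) 1 \<partial>m')"
      using N.integrable_min_nm[OF e, of "T (k \<odot>\<^bsub>M\<^esub> v)"] kv B e
      by (intro integral_mono_AE) (auto simp: equivalent_prob_AE less_top[symmetric])
    also have "\<dots> < \<epsilon>" using lt kv by (simp add: module_dist_def mn0)
    finally show "measure m' ?B \<le> \<epsilon>" using B by simp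
  qed
qed

text \<open>Continuity at 0 makes \<open>{\<bar>T v\<bar> | \<bar>v\<bar> \<le> 1}\<close> bounded in probability, uniformly in \<open>v\<close>. As this family is
  directed, the bound survives in its essential supremum, which is therefore finite a.e.\<close>

lemma ex_L0_sup:
  assumes cont: "L0_continuous m M (L0_module m) T" and sf: "sigma_finite_measure m"
  shows "\<exists>s\<in>carrier (L0 m). (\<forall>v\<in>unit_ball. AE x in m. \<bar>L0_rep (T v) x\<bar> \<le> L0_rep s x) \<and>
    (\<forall>t\<in>carrier (L0 m). (\<forall>v\<in>unit_ball. AE x in m. \<bar>L0_rep (T v) x\<bar> \<le> L0_rep t x) \<longrightarrow>
      (AE x in m. L0_rep s x \<le> L0_rep t x))"
proof (cases "\<forall>P. AE x in m. P x")
  case True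
  \<comment> \<open>This is \<open>m = 0\<close>, where no equivalent probability exists and any
    class serves as supremum.\<close>
  then have "AE x in m. P x" for P by blast
  then show ?thesis by (intro bexI[of _ "\<zero>\<^bsub>L0 m\<^esub>"] conjI ballI impI) simp_all
next
  case False
  then obtain m' where e: "equivalent_prob m m'" using ex_equivalent_prob[OF sf] by blast
  interpret P: prob_space m' using e by (simp add: equivalent_prob_def)
  define A where "A = (\<lambda>v x. \<bar>L0_rep (T v) x\<bar>) ` unit_ball"
  have T_meas [measurable]: "L0_rep (T v) \<in> borel_measurable m'" if "v \<in> unit_ball" for v
    using that e by (simp add: equivalent_prob_measurable)
  have "AE x in m. nm \<zero>\<^bsub>M\<^esub> x = 0" using nm_eq_0_iff[of "\<zero>\<^bsub>M\<^esub>"] by simp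
  then have "AE x in m. nm \<zero>\<^bsub>M\<^esub> x \<le> 1" by eventually_elim simp
  then have "\<zero>\<^bsub>M\<^esub> \<in> unit_ball" unfolding unit_ball_def by simp
  then have Ane: "A \<noteq> {}" by (auto simp: A_def)
  have Am: "a \<in> borel_measurable m'" if "a \<in> A" for a using that by (auto simp: A_def)
  obtain s :: "nat \<Rightarrow> 'x \<Rightarrow> real" where s: "range s \<subseteq> A"
      and h_meas: "(\<lambda>x. SUP n. arctan (s n x)) \<in> borel_measurable m'"
      and h: "\<And>a. a \<in> A \<Longrightarrow> AE x in m'. arctan (a x) \<le> (SUP n. arctan (s n x))"
    by (rule P.countable_ess_upper_bound[OF Ane]) (erule Am, rule that, assumption+)
  have "\<exists>v\<in>unit_ball. s n = (\<lambda>x. \<bar>L0_rep (T v) x\<bar>)" for n using s by (auto simp: A_def)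
  then obtain v where v: "\<And>n. v n \<in> unit_ball" "\<And>n. s n = (\<lambda>x. \<bar>L0_rep (T (v n)) x\<bar>)"
    by metis
  define h where "h x = (SUP n. arctan (s n x))" for x
  have h_m: "h \<in> borel_measurable m'" using h_meas by (simp add: h_def[abs_def])
  have bdd: "bdd_above (range (\<lambda>n. arctan (s n x)))" for x
    using arctan_ubound by (intro bdd_aboveI[of _ "pi/2"]) (auto simp: less_imp_le)
  have h_lower: "- (pi / 2) < h x" for x
    using cSUP_upper[OF UNIV_I bdd, of 0 x] arctan_lbound[of "s 0 x"] by (simp add: h_def)
  \<comment> \<open>The points where the sequence \<open>s n x\<close> is unbounded: each single
    arctangent stays below \<open>pi / 2\<close>, so only an unbounded sequence has this
    supremum.\<close>
  define E where "E = {x \<in> space m'. pi / 2 \<le> h x}"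
  have E: "E \<in> sets m'" using h_m by (simp add: E_def)
  have "measure m' E \<le> \<epsilon>" if \<epsilon>: "\<epsilon> > 0" for \<epsilon>
  proof -
    obtain K where K: "\<And>v. v \<in> unit_ball \<Longrightarrow> measure m' {x \<in> space m'. \<bar>L0_rep (T v) x\<bar> > K} \<le> \<epsilon>"
      using unit_ball_tail[OF cont e \<epsilon>] by blast
    define B where "B n = {x \<in> space m'. \<exists>k\<le>n. \<bar>L0_rep (T (v k)) x\<bar> > K}" for n
    have B: "B n \<in> sets m'" for n using T_meas[OF v(1)] unfolding B_def by measurable
    have "measure m' (B n) \<le> \<epsilon>" for n
    proof -
      \<comment> \<open>One vector dominates \<open>v 0\<close>, ..., \<open>v n\<close>, so the
        uniform tail bound applies to the whole union \<open>B n\<close> and does not grow with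
        \<open>n\<close>.\<close>
      obtain u where u: "u \<in> unit_ball" "AE x in m. \<forall>k\<le>n. \<bar>L0_rep (T (v k)) x\<bar> \<le> \<bar>L0_rep (T u) x\<bar>"
        using unit_ball_finite_upper_bound[of v n, OF v(1)] by blast
      have "AE x in m'. \<forall>k\<le>n. \<bar>L0_rep (T (v k)) x\<bar> \<le> \<bar>L0_rep (T u) x\<bar>"
        using u(2) e by (simp add: equivalent_prob_AE)
      then have "AE x in m'. x \<in> B n \<longrightarrow> x \<in> {x \<in> space m'. \<bar>L0_rep (T u) x\<bar> > K}"
        by eventually_elim (force simp: B_def)
      then have "measure m' (B n) \<le> measure m' {x \<in> space m'. \<bar>L0_rep (T u) x\<bar> > K}"
        using T_meas[OF u(1)] by (intro P.finite_measure_mono_AE) auto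
      then show ?thesis using K[OF u(1)] by simp
    qed
    moreover have "(\<lambda>n. measure m' (B n)) \<longlonglongrightarrow> measure m' (\<Union>n. B n)"
    proof (rule P.finite_Lim_measure_incseq)
      show "range B \<subseteq> sets m'" using B by blast
      show "incseq B" by (rule incseq_SucI) (auto simp: B_def intro: le_SucI)
    qed
    ultimately have "measure m' (\<Union>n. B n) \<le> \<epsilon>" by (intro LIMSEQ_le_const2) auto
    moreover have "E \<subseteq> (\<Union>n. B n)"
    proof
      fix x assume x: "x \<in> E"
      then have "arctan K < (SUP n. arctan (s n x))" using arctan_ubound[of K] by (simp add: E_def h_def)
      then obtain n where "arctan K < arctan (s n x)" using less_cSUP_iff[OF _ bdd] by auto
      then show "x \<in> (\<Union>n. B n)" using x by (auto simp: B_def E_def v(2) arctan_less_iff)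
    qed
    ultimately show ?thesis using P.finite_measure_mono[of E "\<Union>n. B n"] B by auto
  qed
  then have "measure m' E \<le> 0" using field_le_epsilon[of "measure m' E" 0] by simp
  then have "measure m' E = 0" using measure_nonneg[of m' E] by linarith
  then have "E \<in> null_sets m'" using E by (simp add: P.emeasure_eq_measure null_sets_def)
  then have "AE x in m'. x \<notin> E" by (rule AE_not_in)
  then have "AE x in m'. h x < pi / 2" using AE_space by eventually_elim (auto simp: E_def)
  then have hlt: "AE x in m. h x < pi / 2" using e by (simp add: equivalent_prob_AE)
  \<comment> \<open>Almost everywhere \<open>h\<close> lies strictly between \<open>- pi / 2\<close>
    and \<open>pi / 2\<close>, where \<open>tan\<close> inverts \<open>arctan\<close>; so
    \<open>S\<close> is real-valued and has \<open>h\<close> as its arctangent.\<close>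
  define S where "S = L0_class m (\<lambda>x. tan (h x))"
  have tm: "(\<lambda>x. tan (h x)) \<in> borel_measurable m"
    using h_m e by (simp add: tan_def equivalent_prob_measurable)
  have S: "AE x in m. arctan (L0_rep S x) = h x"
    unfolding S_def using AE_L0_rep_class[OF tm] hlt
    by eventually_elim (simp add: arctan_tan h_lower)
  show ?thesis
  proof (intro bexI[of _ S] conjI ballI impI)
    show "S \<in> carrier (L0 m)" using tm by (simp add: S_def)
    fix w assume w: "w \<in> unit_ball"
    have "AE x in m. arctan \<bar>L0_rep (T w) x\<bar> \<le> h x"
      using h[of "\<lambda>x. \<bar>L0_rep (T w) x\<bar>"] w e by (simp add: A_def h_def equivalent_prob_AE)
    with S show "AE x in m. \<bar>L0_rep (T w) x\<bar> \<le> L0_rep S x"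
      by eventually_elim (metis arctan_le_iff)
  next
    fix t assume "\<forall>v\<in>unit_ball. AE x in m. \<bar>L0_rep (T v) x\<bar> \<le> L0_rep t x"
    then have "AE x in m. \<forall>n. s n x \<le> L0_rep t x" using v by (simp add: AE_all_countable)
    with S show "AE x in m. L0_rep S x \<le> L0_rep t x"
    proof eventually_elim
      case (elim x)
      have "h x \<le> arctan (L0_rep t x)"
        unfolding h_def using elim(2) by (intro cSUP_least) (auto simp: arctan_le_iff)
      then show ?case using elim(1) by (metis arctan_le_iff)
    qed
  qed
qed

end

lemma L0_functional_dual:
  "pn_module m M \<Longrightarrow> T \<in> carrier (dual_module m M) \<Longrightarrow> L0_functional m M T"
  by (simp add: dual_module_def L0_functional_def L0_functional_axioms_def)

section \<open>The dual norm\<close>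

text \<open>Sigma-finiteness supplies the equivalent probability on which finiteness of the dual
  norm rests.\<close>

locale sf_pn_module = pn_module m M
  for m :: "'x measure" and M :: "('x L0, 'v) normed_module" +
  assumes sigma_finite: "sigma_finite_measure m"
begin

abbreviation dnm :: "('v \<Rightarrow> 'x L0) \<Rightarrow> 'x \<Rightarrow> real" where "dnm T \<equiv> L0_rep (pnorm (dual_module m M) T)"

context
  fixes T assumes T: "T \<in> carrier (dual_module m M)"
begin

interpretation L0_functional m M T
  using L0_functional_dual[OF pn_module_axioms T] .

text \<open>By \<open>ex_L0_sup\<close> the definite description behind the dual norm has a value.
  Later arguments see the dual norm only through these three facts.\<close>

lemma
  shows dual_pnorm_closed: "pnorm (dual_module m M) T \<in> carrier (L0 m)"
    and dual_pnorm_upper: "\<And>v. v \<in> unit_ball \<Longrightarrow> AE x in m. \<bar>L0_rep (T v) x\<bar> \<le> dnm T x"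
    and dual_pnorm_least: "\<And>t. t \<in> carrier (L0 m) \<Longrightarrow>
      (\<And>v. v \<in> unit_ball \<Longrightarrow> AE x in m. \<bar>L0_rep (T v) x\<bar> \<le> L0_rep t x) \<Longrightarrow> AE x in m. dnm T x \<le> L0_rep t x"
proof -
  have cont: "L0_continuous m M (L0_module m) T" using T by (simp add: dual_module_def)
  obtain s where s: "s \<in> carrier (L0 m)" "\<forall>v\<in>unit_ball. AE x in m. \<bar>L0_rep (T v) x\<bar> \<le> L0_rep s x"
    "\<forall>t\<in>carrier (L0 m). (\<forall>v\<in>unit_ball. AE x in m. \<bar>L0_rep (T v) x\<bar> \<le> L0_rep t x) \<longrightarrow>
      (AE x in m. L0_rep s x \<le> L0_rep t x)"
    using ex_L0_sup[OF cont sigma_finite] by (elim bexE conjE) (rule that)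
  have ball: "v \<in> unit_ball \<longleftrightarrow> v \<in> carrier M \<and> L0_le m (pnorm M v) \<one>\<^bsub>L0 m\<^esub>" for v
    using L0_rep_one[of m] unfolding unit_ball_def L0_le_def by (auto elim!: eventually_elim2)
  have le: "L0_le m (L0_abs m (T v)) t \<longleftrightarrow> (AE x in m. \<bar>L0_rep (T v) x\<bar> \<le> L0_rep t x)"
    if "v \<in> unit_ball" for v t
    using L0_rep_abs[of "T v" m] that unfolding L0_le_def by (auto elim!: eventually_elim2)
  have "pnorm (dual_module m M) T = L0_esssup m {L0_abs m (T v) |v. v \<in> unit_ball}"
    by (simp add: dual_module_def ball)
  also have "\<dots> = s"
  proof (rule L0_esssup_eqI)
    fix t assume "t \<in> carrier (L0 m)" "\<And>a. a \<in> {L0_abs m (T v) |v. v \<in> unit_ball} \<Longrightarrow> L0_le m a t"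
    then have "AE x in m. L0_rep s x \<le> L0_rep t x"
      using le by (intro s(3)[rule_format]) blast+
    then show "L0_le m s t" unfolding L0_le_def .
  next
    fix a assume "a \<in> {L0_abs m (T v) |v. v \<in> unit_ball}"
    then obtain v where "v \<in> unit_ball" "a = L0_abs m (T v)" by blast
    then show "L0_le m a s" using s(2)[rule_format, of v] le[of v s] by simp
  qed (rule s(1))
  finally have eq: "pnorm (dual_module m M) T = s" .
  show "pnorm (dual_module m M) T \<in> carrier (L0 m)" using s(1) eq by simp
  show "AE x in m. \<bar>L0_rep (T v) x\<bar> \<le> dnm T x" if "v \<in> unit_ball" for v unfolding eq using that by (rule s(2)[rule_format])
  show "AE x in m. dnm T x \<le> L0_rep t x" if "t \<in> carrier (L0 m)"
    "\<And>v. v \<in> unit_ball \<Longrightarrow> AE x in m. \<bar>L0_rep (T v) x\<bar> \<le> L0_rep t x" for t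
    unfolding eq using that by (intro s(3)[rule_format]) blast+
qed

lemma dnm_nonneg: "AE x in m. 0 \<le> dnm T x"
proof -
  have "AE x in m. nm \<zero>\<^bsub>M\<^esub> x = 0" using nm_eq_0_iff[of "\<zero>\<^bsub>M\<^esub>"] by simp
  then have "AE x in m. nm \<zero>\<^bsub>M\<^esub> x \<le> 1" by eventually_elim simp
  then have "\<zero>\<^bsub>M\<^esub> \<in> unit_ball" unfolding unit_ball_def by simp
  from dual_pnorm_upper[OF this] show ?thesis by eventually_elim simp
qed

text \<open>Apply the bound on the unit ball to \<open>v\<close> divided by its norm, where
  \<open>inverse 0 = 0\<close> keeps the quotient in the unit ball. On the set where the norm of
  \<open>v\<close> vanishes this says nothing; there \<open>q v\<close>, with \<open>q\<close> the
  indicator of that set, is the zero vector by definiteness, so \<open>T v\<close> vanishes.\<close>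

lemma dual_bound:
  assumes v: "v \<in> carrier M"
  shows "AE x in m. \<bar>L0_rep (T v) x\<bar> \<le> dnm T x * nm v x"
proof -
  have [measurable]: "nm v \<in> borel_measurable m" by (intro L0_rep_measurable pnorm_closed v)
  define p q :: "'x \<Rightarrow> real" where "p x = inverse (nm v x)" and "q x = (if nm v x = 0 then 1 else 0)" for x
  have p: "p \<in> borel_measurable m" and q: "q \<in> borel_measurable m"
    unfolding p_def q_def by measurable
  have pc: "L0_class m p \<in> carrier (L0 m)" and qc: "L0_class m q \<in> carrier (L0 m)"
    using p q by simp_all
  have pv: "L0_class m p \<odot>\<^bsub>M\<^esub> v \<in> carrier M" and qv: "L0_class m q \<odot>\<^bsub>M\<^esub> v \<in> carrier M"
    using pc qc v by simp_all
  have "AE x in m. nm (L0_class m p \<odot>\<^bsub>M\<^esub> v) x \<le> 1"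
    using nm_smult[OF pc v] AE_L0_rep_class[OF p] nm_nonneg[OF v]
  proof eventually_elim
    case (elim x)
    then show ?case by (cases "nm v x = 0") (auto simp: p_def)
  qed
  then have "L0_class m p \<odot>\<^bsub>M\<^esub> v \<in> unit_ball" using pv unfolding unit_ball_def by blast
  note le = dual_pnorm_upper[OF this]
  have "AE x in m. nm (L0_class m q \<odot>\<^bsub>M\<^esub> v) x = 0"
    using nm_smult[OF qc v] AE_L0_rep_class[OF q] by eventually_elim (auto simp: q_def)
  then have "L0_class m q \<odot>\<^bsub>M\<^esub> v = \<zero>\<^bsub>M\<^esub>" using nm_eq_0_iff[OF qv] by blast
  then have "AE x in m. L0_rep (T (L0_class m q \<odot>\<^bsub>M\<^esub> v)) x = 0" using L0_rep_zero T_zero by simp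
  with le rep_T_smult[OF pc v] rep_T_smult[OF qc v] AE_L0_rep_class[OF p] AE_L0_rep_class[OF q] nm_nonneg[OF v]
  show ?thesis
  proof eventually_elim
    case (elim x)
    show ?case
    proof (cases "nm v x = 0")
      case True
      then show ?thesis using elim by (simp add: q_def)
    next
      case False
      then show ?thesis using elim by (simp add: p_def abs_mult field_simps)
    qed
  qed
qed

text \<open>Converse to \<open>dual_bound\<close>: together they make the dual norm the least
  nonnegative \<open>c\<close> with \<open>\<bar>T v\<bar> \<le> c \<bar>v\<bar>\<close>, the form
  in which it is estimated from here on.\<close>

lemma dual_pnorm_le:
  assumes c: "c \<in> carrier (L0 m)" and c0: "AE x in m. 0 \<le> L0_rep c x"
    and bound: "\<And>v. v \<in> carrier M \<Longrightarrow> AE x in m. \<bar>L0_rep (T v) x\<bar> \<le> L0_rep c x * nm v x"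
  shows "AE x in m. dnm T x \<le> L0_rep c x"
proof (rule dual_pnorm_least[OF c])
  fix v assume v: "v \<in> unit_ball"
  show "AE x in m. \<bar>L0_rep (T v) x\<bar> \<le> L0_rep c x"
    using bound[OF unit_ball_closed[OF v]] unit_ball_nm[OF v] c0
  proof eventually_elim
    case (elim x)
    then show ?case using mult_left_le[of "nm v x" "L0_rep c x"] by simp
  qed
qed

end

end

section \<open>The dual module\<close>

context sf_pn_module
begin

abbreviation dual where "dual \<equiv> dual_module m M"

lemma dual_apply [simp]:
  "v \<in> carrier M \<Longrightarrow> (T \<oplus>\<^bsub>dual\<^esub> S) v = T v \<oplus>\<^bsub>L0 m\<^esub> S v"
  "v \<in> carrier M \<Longrightarrow> (f \<odot>\<^bsub>dual\<^esub> T) v = f \<otimes>\<^bsub>L0 m\<^esub> T v"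
  "v \<in> carrier M \<Longrightarrow> \<zero>\<^bsub>dual\<^esub> v = \<zero>\<^bsub>L0 m\<^esub>"
  by (simp_all add: dual_module_def)

lemma dual_ops_extensional:
  "T \<oplus>\<^bsub>dual\<^esub> S \<in> extensional (carrier M)" "f \<odot>\<^bsub>dual\<^esub> T \<in> extensional (carrier M)"
  "\<zero>\<^bsub>dual\<^esub> \<in> extensional (carrier M)"
  by (simp_all add: dual_module_def)

text \<open>Confines continuity to \<open>continuous_if_bounded\<close>: functionals are placed in
  the dual by naming a bound in \<open>L0 m\<close>.\<close>

lemma dualI:
  assumes "L0_linear m M (L0_module m) T" "c \<in> carrier (L0 m)"
    and "\<And>v. v \<in> carrier M \<Longrightarrow> AE x in m. \<bar>L0_rep (T v) x\<bar> \<le> L0_rep c x * nm v x"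
  shows "T \<in> carrier dual"
proof -
  interpret F: L0_functional m M T
    using pn_module_axioms assms(1) by (simp add: L0_functional_def L0_functional_axioms_def)
  show ?thesis using F.continuous_if_bounded[OF assms(2,3)] assms(1) by (simp add: dual_module_def)
qed

lemma dual_closed [simp]: "T \<in> carrier dual \<Longrightarrow> v \<in> carrier M \<Longrightarrow> T v \<in> carrier (L0 m)"
  by (rule L0_functional.T_closed[OF L0_functional_dual[OF pn_module_axioms]])

lemma dual_add: "T \<in> carrier dual \<Longrightarrow> v \<in> carrier M \<Longrightarrow> w \<in> carrier M \<Longrightarrow> T (v \<oplus>\<^bsub>M\<^esub> w) = T v \<oplus>\<^bsub>L0 m\<^esub> T w"
  by (rule L0_functional.T_add[OF L0_functional_dual[OF pn_module_axioms]])

lemma dual_smult: "T \<in> carrier dual \<Longrightarrow> f \<in> carrier (L0 m) \<Longrightarrow> v \<in> carrier M \<Longrightarrow> T (f \<odot>\<^bsub>M\<^esub> v) = f \<otimes>\<^bsub>L0 m\<^esub> T v"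
  by (rule L0_functional.T_smult[OF L0_functional_dual[OF pn_module_axioms]])

lemma dual_linear: "T \<in> carrier dual \<Longrightarrow> L0_linear m M (L0_module m) T"
  by (simp add: dual_module_def)

lemma dual_extensional: "T \<in> carrier dual \<Longrightarrow> T \<in> extensional (carrier M)"
  using dual_linear[of T] by (simp add: L0_linear_def PiE_iff)

lemma dual_eqI:
  "T \<in> carrier dual \<Longrightarrow> S \<in> carrier dual \<Longrightarrow> (\<And>v. v \<in> carrier M \<Longrightarrow> T v = S v) \<Longrightarrow> T = S"
  by (rule extensionalityI[OF dual_extensional dual_extensional])

lemma L0_linearI:
  assumes "T \<in> extensional (carrier M)" "\<And>v. v \<in> carrier M \<Longrightarrow> T v \<in> carrier (L0 m)"
    and "\<And>v w. v \<in> carrier M \<Longrightarrow> w \<in> carrier M \<Longrightarrow> T (v \<oplus>\<^bsub>M\<^esub> w) = T v \<oplus>\<^bsub>L0 m\<^esub> T w"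
    and "\<And>f v. f \<in> carrier (L0 m) \<Longrightarrow> v \<in> carrier M \<Longrightarrow> T (f \<odot>\<^bsub>M\<^esub> v) = f \<otimes>\<^bsub>L0 m\<^esub> T v"
  shows "L0_linear m M (L0_module m) T"
  unfolding L0_linear_def L0_module_simps PiE_iff using assms by blast

lemma dual_add_closed:
  assumes T: "T \<in> carrier dual" and S: "S \<in> carrier dual"
  shows "T \<oplus>\<^bsub>dual\<^esub> S \<in> carrier dual"
proof (rule dualI)
  show "L0_linear m M (L0_module m) (T \<oplus>\<^bsub>dual\<^esub> S)"
    using T S by (intro L0_linearI dual_ops_extensional) (auto simp: dual_add dual_smult R.a_ac R.r_distr)
  show c: "pnorm dual T \<oplus>\<^bsub>L0 m\<^esub> pnorm dual S \<in> carrier (L0 m)"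
    using T S by (simp add: dual_pnorm_closed)
  fix v assume v: "v \<in> carrier M"
  show "AE x in m. \<bar>L0_rep ((T \<oplus>\<^bsub>dual\<^esub> S) v) x\<bar> \<le> L0_rep (pnorm dual T \<oplus>\<^bsub>L0 m\<^esub> pnorm dual S) x * nm v x"
    using L0_rep_add[OF dual_pnorm_closed[OF T] dual_pnorm_closed[OF S]]
      L0_rep_add[OF dual_closed[OF T v] dual_closed[OF S v]] dual_bound[OF T v] dual_bound[OF S v]
    unfolding dual_apply(1)[OF v] by eventually_elim (simp add: distrib_right)
qed

lemma dual_smult_closed:
  assumes f: "f \<in> carrier (L0 m)" and T: "T \<in> carrier dual"
  shows "f \<odot>\<^bsub>dual\<^esub> T \<in> carrier dual"
proof (rule dualI)
  show "L0_linear m M (L0_module m) (f \<odot>\<^bsub>dual\<^esub> T)"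
    using T f by (intro L0_linearI dual_ops_extensional) (auto simp: dual_add dual_smult R.m_ac R.r_distr)
  have fa: "L0_abs m f \<in> carrier (L0 m)" using f by simp
  show c: "L0_abs m f \<otimes>\<^bsub>L0 m\<^esub> pnorm dual T \<in> carrier (L0 m)"
    using T f by (simp add: dual_pnorm_closed)
  fix v assume v: "v \<in> carrier M"
  show "AE x in m. \<bar>L0_rep ((f \<odot>\<^bsub>dual\<^esub> T) v) x\<bar> \<le> L0_rep (L0_abs m f \<otimes>\<^bsub>L0 m\<^esub> pnorm dual T) x * nm v x"
    using L0_rep_mult[OF fa dual_pnorm_closed[OF T]] L0_rep_abs[OF f]
      L0_rep_mult[OF f dual_closed[OF T v]] dual_bound[OF T v]
    unfolding dual_apply(2)[OF v]
    by eventually_elim (simp add: abs_mult mult.assoc mult_left_mono)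
qed

lemma dual_zero_closed: "\<zero>\<^bsub>dual\<^esub> \<in> carrier dual"
proof (rule dualI)
  show "L0_linear m M (L0_module m) \<zero>\<^bsub>dual\<^esub>"
    by (intro L0_linearI dual_ops_extensional) simp_all
  fix v assume v: "v \<in> carrier M"
  show "AE x in m. \<bar>L0_rep (\<zero>\<^bsub>dual\<^esub> v) x\<bar> \<le> L0_rep \<zero>\<^bsub>L0 m\<^esub> x * nm v x"
    using L0_rep_zero[of m] unfolding dual_apply(3)[OF v] by eventually_elim simp
qed simp

lemma module_dual: "Module.module (L0 m) dual"
proof (rule moduleI)
  show "abelian_group dual"
  proof (rule abelian_groupI)
    fix T assume T: "T \<in> carrier dual"
    have "(\<ominus>\<^bsub>L0 m\<^esub> \<one>\<^bsub>L0 m\<^esub>) \<odot>\<^bsub>dual\<^esub> T \<oplus>\<^bsub>dual\<^esub> T = \<zero>\<^bsub>dual\<^esub>"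
      using T by (intro dual_eqI) (auto simp: dual_add_closed dual_smult_closed dual_zero_closed R.l_minus R.l_neg)
    then show "\<exists>S\<in>carrier dual. S \<oplus>\<^bsub>dual\<^esub> T = \<zero>\<^bsub>dual\<^esub>"
      using T by (intro bexI[of _ "(\<ominus>\<^bsub>L0 m\<^esub> \<one>\<^bsub>L0 m\<^esub>) \<odot>\<^bsub>dual\<^esub> T"]) (simp_all add: dual_smult_closed)
  qed (auto intro!: dual_eqI simp: dual_add_closed dual_zero_closed R.a_ac)
qed (auto intro!: dual_eqI cring_L0 simp: dual_add_closed dual_smult_closed R.l_distr R.r_distr R.m_assoc)

lemma dual_eq_zero_if_dnm_zero:
  assumes T: "T \<in> carrier dual" and "AE x in m. dnm T x = 0"
  shows "T = \<zero>\<^bsub>dual\<^esub>"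
proof (rule dual_eqI[OF T dual_zero_closed])
  fix v assume v: "v \<in> carrier M"
  have "AE x in m. L0_rep (T v) x = L0_rep \<zero>\<^bsub>L0 m\<^esub> x"
    using assms(2) dual_bound[OF T v] L0_rep_zero by eventually_elim simp
  then show "T v = \<zero>\<^bsub>dual\<^esub> v" using T v by (intro L0_eqI[where m = m]) auto
qed

lemma dnm_smult:
  assumes f: "f \<in> carrier (L0 m)" and T: "T \<in> carrier dual"
  shows "AE x in m. dnm (f \<odot>\<^bsub>dual\<^esub> T) x = \<bar>L0_rep f x\<bar> * dnm T x"
proof -
  have fa: "L0_abs m f \<in> carrier (L0 m)" using f by simp
  have fT: "f \<odot>\<^bsub>dual\<^esub> T \<in> carrier dual" by (rule dual_smult_closed[OF f T])
  note nT = dual_pnorm_closed[OF T] and nfT = dual_pnorm_closed[OF fT]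
  have [measurable]: "dnm T \<in> borel_measurable m" "dnm (f \<odot>\<^bsub>dual\<^esub> T) \<in> borel_measurable m"
    "L0_rep f \<in> borel_measurable m"
    by (rule L0_rep_measurable nT nfT f)+
  have le: "AE x in m. dnm (f \<odot>\<^bsub>dual\<^esub> T) x \<le> \<bar>L0_rep f x\<bar> * dnm T x"
  proof -
    have "AE x in m. dnm (f \<odot>\<^bsub>dual\<^esub> T) x \<le> L0_rep (L0_abs m f \<otimes>\<^bsub>L0 m\<^esub> pnorm dual T) x"
    proof (rule dual_pnorm_le[OF fT])
      show "L0_abs m f \<otimes>\<^bsub>L0 m\<^esub> pnorm dual T \<in> carrier (L0 m)" using fa nT by simp
      show "AE x in m. 0 \<le> L0_rep (L0_abs m f \<otimes>\<^bsub>L0 m\<^esub> pnorm dual T) x"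
        using L0_rep_mult[OF fa nT] L0_rep_abs[OF f] dnm_nonneg[OF T] by eventually_elim simp
      fix v assume v: "v \<in> carrier M"
      show "AE x in m. \<bar>L0_rep ((f \<odot>\<^bsub>dual\<^esub> T) v) x\<bar> \<le> L0_rep (L0_abs m f \<otimes>\<^bsub>L0 m\<^esub> pnorm dual T) x * nm v x"
        using L0_rep_mult[OF fa nT] L0_rep_abs[OF f] L0_rep_mult[OF f dual_closed[OF T v]] dual_bound[OF T v]
        unfolding dual_apply(2)[OF v]
        by eventually_elim (simp add: abs_mult mult.assoc mult_left_mono)
    qed
    then show ?thesis using L0_rep_mult[OF fa nT] L0_rep_abs[OF f] by eventually_elim simp
  qed
  \<comment> \<open>For the reverse inequality one divides by \<open>\<bar>f\<bar>\<close>. Where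
    \<open>f\<close> vanishes, \<open>p\<close> is filled up with the norm of \<open>T\<close>
    itself, so that it bounds \<open>T\<close> everywhere; on that set the final equality comes from
    \<open>le\<close> and nonnegativity instead.\<close>
  define p where "p x = (if L0_rep f x = 0 then dnm T x else dnm (f \<odot>\<^bsub>dual\<^esub> T) x / \<bar>L0_rep f x\<bar>)" for x
  have p: "p \<in> borel_measurable m" unfolding p_def by measurable
  have "AE x in m. dnm T x \<le> L0_rep (L0_class m p) x"
  proof (rule dual_pnorm_le[OF T])
    show "L0_class m p \<in> carrier (L0 m)" using p by simp
    show "AE x in m. 0 \<le> L0_rep (L0_class m p) x"
      using AE_L0_rep_class[OF p] dnm_nonneg[OF T] dnm_nonneg[OF fT] by eventually_elim (simp add: p_def)
    fix v assume v: "v \<in> carrier M"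
    show "AE x in m. \<bar>L0_rep (T v) x\<bar> \<le> L0_rep (L0_class m p) x * nm v x"
      using AE_L0_rep_class[OF p] dual_bound[OF T v] dual_bound[OF fT v] L0_rep_mult[OF f dual_closed[OF T v]]
      unfolding dual_apply(2)[OF v]
      by eventually_elim (auto simp: p_def abs_mult field_simps)
  qed
  with le AE_L0_rep_class[OF p] dnm_nonneg[OF fT] show ?thesis
    by eventually_elim (auto simp: p_def field_simps split: if_splits)
qed

lemma dnm_add:
  assumes T: "T \<in> carrier dual" and S: "S \<in> carrier dual"
  shows "AE x in m. dnm (T \<oplus>\<^bsub>dual\<^esub> S) x \<le> L0_rep (pnorm dual T \<oplus>\<^bsub>L0 m\<^esub> pnorm dual S) x"
proof (rule dual_pnorm_le[OF dual_add_closed[OF T S]])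
  note add = L0_rep_add[OF dual_pnorm_closed[OF T] dual_pnorm_closed[OF S]]
  show "pnorm dual T \<oplus>\<^bsub>L0 m\<^esub> pnorm dual S \<in> carrier (L0 m)"
    using T S by (simp add: dual_pnorm_closed)
  show "AE x in m. 0 \<le> L0_rep (pnorm dual T \<oplus>\<^bsub>L0 m\<^esub> pnorm dual S) x"
    using add dnm_nonneg[OF T] dnm_nonneg[OF S] by eventually_elim simp
  fix v assume v: "v \<in> carrier M"
  show "AE x in m. \<bar>L0_rep ((T \<oplus>\<^bsub>dual\<^esub> S) v) x\<bar> \<le> L0_rep (pnorm dual T \<oplus>\<^bsub>L0 m\<^esub> pnorm dual S) x * nm v x"
    using add L0_rep_add[OF dual_closed[OF T v] dual_closed[OF S v]] dual_bound[OF T v] dual_bound[OF S v]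
    unfolding dual_apply(1)[OF v] by eventually_elim (simp add: distrib_right)
qed

lemma pn_module_dual: "pn_module m dual"
proof -
  have "pointwise_norm m dual"
    unfolding pointwise_norm_def
  proof (intro conjI ballI)
    fix T assume T: "T \<in> carrier dual"
    show "L0_le m \<zero>\<^bsub>L0 m\<^esub> (pnorm dual T)"
      unfolding L0_le_def using L0_rep_zero[of m] dnm_nonneg[OF T] by eventually_elim simp
    show "pnorm dual T = \<zero>\<^bsub>L0 m\<^esub> \<longleftrightarrow> T = \<zero>\<^bsub>dual\<^esub>"
    proof
      assume "pnorm dual T = \<zero>\<^bsub>L0 m\<^esub>"
      then show "T = \<zero>\<^bsub>dual\<^esub>" using L0_rep_zero[of m] T by (intro dual_eq_zero_if_dnm_zero) simp_all
    next
      assume T0: "T = \<zero>\<^bsub>dual\<^esub>"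
      have "AE x in m. dnm T x \<le> L0_rep \<zero>\<^bsub>L0 m\<^esub> x"
      proof (rule dual_pnorm_le[OF T L0_ops_closed(1)])
        show "AE x in m. 0 \<le> L0_rep \<zero>\<^bsub>L0 m\<^esub> x" using L0_rep_zero[of m] by eventually_elim simp
        fix v assume v: "v \<in> carrier M"
        show "AE x in m. \<bar>L0_rep (T v) x\<bar> \<le> L0_rep \<zero>\<^bsub>L0 m\<^esub> x * nm v x"
          using L0_rep_zero[of m] unfolding T0 dual_apply(3)[OF v] by eventually_elim simp
      qed
      then have "AE x in m. dnm T x = L0_rep \<zero>\<^bsub>L0 m\<^esub> x"
        using L0_rep_zero[of m] dnm_nonneg[OF T] by eventually_elim simp
      then show "pnorm dual T = \<zero>\<^bsub>L0 m\<^esub>"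
        by (rule L0_eqI[OF dual_pnorm_closed[OF T] L0_ops_closed(1)])
    qed
    fix S assume S: "S \<in> carrier dual"
    show "L0_le m (pnorm dual (T \<oplus>\<^bsub>dual\<^esub> S)) (pnorm dual T \<oplus>\<^bsub>L0 m\<^esub> pnorm dual S)"
      unfolding L0_le_def by (rule dnm_add[OF T S])
  next
    fix f T assume f: "f \<in> carrier (L0 m)" and T: "T \<in> carrier dual"
    have fa: "L0_abs m f \<in> carrier (L0 m)" using f by simp
    have "AE x in m. dnm (f \<odot>\<^bsub>dual\<^esub> T) x = L0_rep (L0_abs m f \<otimes>\<^bsub>L0 m\<^esub> pnorm dual T) x"
      using L0_rep_mult[OF fa dual_pnorm_closed[OF T]] L0_rep_abs[OF f] dnm_smult[OF f T]
      by eventually_elim simp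
    then show "pnorm dual (f \<odot>\<^bsub>dual\<^esub> T) = L0_abs m f \<otimes>\<^bsub>L0 m\<^esub> pnorm dual T"
      using fa dual_pnorm_closed[OF T] dual_pnorm_closed[OF dual_smult_closed[OF f T]]
      by (intro L0_eqI[where m = m]) simp_all
  qed (simp add: dual_pnorm_closed)
  then show ?thesis using module_dual by (simp add: pn_module_def pn_module_axioms_def)
qed

text \<open>Subtraction is available only through the group structure; adding \<open>S\<close> back
  reduces it to the pointwise addition of functionals.\<close>

lemma rep_dual_minus:
  assumes T: "T \<in> carrier dual" and S: "S \<in> carrier dual" and v: "v \<in> carrier M"
  shows "AE x in m. L0_rep ((T \<ominus>\<^bsub>dual\<^esub> S) v) x = L0_rep (T v) x - L0_rep (S v) x"
proof -
  interpret D: pn_module m dual by (rule pn_module_dual)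
  have TS: "T \<ominus>\<^bsub>dual\<^esub> S \<in> carrier dual" using T S by simp
  have "(T \<ominus>\<^bsub>dual\<^esub> S) \<oplus>\<^bsub>dual\<^esub> S = T" using T S by (simp add: a_minus_def D.a_assoc D.l_neg)
  then have "T v = (T \<ominus>\<^bsub>dual\<^esub> S) v \<oplus>\<^bsub>L0 m\<^esub> S v" using dual_apply(1)[OF v] by metis
  then show ?thesis using L0_rep_add[OF dual_closed[OF TS v] dual_closed[OF S v]]
    by (auto elim!: eventually_mono)
qed

end

section \<open>Completeness of the dual\<close>

text \<open>Telescoping from index \<open>K\<close>; the first factor on the right is the tail
  \<open>d K + d (K + 1) + ...\<close>. It is kept at the level of real sequences since it is
  applied separately at almost every point.\<close>

lemma abs_limit_minus_le_tail:
  fixes a d :: "nat \<Rightarrow> real"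
  assumes step: "\<And>n. \<bar>a (Suc n) - a n\<bar> \<le> d n * c" and d: "summable d" "\<And>n. 0 \<le> d n" and c: "0 \<le> c"
    and lim: "a \<longlonglongrightarrow> l"
  shows "\<bar>l - a K\<bar> \<le> (suminf d - sum d {..<K}) * c"
proof -
  have dK: "summable (\<lambda>j. d (j + K))" using d(1) by (simp add: summable_iff_shift)
  have "\<bar>a (n + K) - a K\<bar> \<le> (\<Sum>j<n. d (j + K)) * c" for n
  proof (induction n)
    case (Suc n)
    then show ?case using step[of "n + K"] by (simp add: distrib_right)
  qed simp
  moreover have "(\<Sum>j<n. d (j + K)) * c \<le> (suminf d - sum d {..<K}) * c" for n
    using sum_le_suminf[OF dK, of "{..<n}"] d c
    by (intro mult_right_mono) (simp_all add: suminf_minus_initial_segment)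
  ultimately have "\<bar>a (n + K) - a K\<bar> \<le> (suminf d - sum d {..<K}) * c" for n
    by (rule order_trans)
  moreover have "(\<lambda>n. \<bar>a (n + K) - a K\<bar>) \<longlonglongrightarrow> \<bar>l - a K\<bar>"
    by (intro tendsto_intros LIMSEQ_ignore_initial_segment lim)
  ultimately show ?thesis by (intro LIMSEQ_le_const2) auto
qed

text \<open>Limits exist first for each \<open>v\<close> separately, by \<open>L0_ex_limit\<close>.
  Passing to the dual norm works because the tail \<open>g K\<close> of the summed increments is one
  function for all \<open>v\<close>: it bounds the functional \<open>L - T K\<close>, with
  \<open>K = 0\<close> for membership of \<open>L\<close> in the dual and arbitrary \<open>K\<close>
  for convergence.\<close>

lemma (in sf_pn_module) normed_L0_module_dual: "normed_L0_module m dual"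
proof -
  interpret D: pn_module m dual by (rule pn_module_dual)
  show ?thesis
  proof (rule D.normed_L0_moduleI)
    fix T :: "nat \<Rightarrow> 'v \<Rightarrow> 'x L0"
    define d where "d n = dnm (T (Suc n) \<ominus>\<^bsub>dual\<^esub> T n)" for n
    assume T: "\<And>n. T n \<in> carrier dual"
      and "AE x in m. summable (\<lambda>n. dnm (T (Suc n) \<ominus>\<^bsub>dual\<^esub> T n) x)"
    then have sd: "AE x in m. summable (\<lambda>n. d n x)" by (simp add: d_def)
    have diff: "T (Suc n) \<ominus>\<^bsub>dual\<^esub> T n \<in> carrier dual" for n using T by simp
    have d_m [measurable]: "d n \<in> borel_measurable m" for n
      unfolding d_def by (intro L0_rep_measurable dual_pnorm_closed diff)
    have d0: "AE x in m. \<forall>n. 0 \<le> d n x"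
      unfolding d_def AE_all_countable by (intro allI dnm_nonneg diff)
    have step: "AE x in m. \<forall>n. \<bar>L0_rep (T (Suc n) v) x - L0_rep (T n v) x\<bar> \<le> d n x * nm v x"
      if v: "v \<in> carrier M" for v
      unfolding AE_all_countable
    proof
      fix n
      show "AE x in m. \<bar>L0_rep (T (Suc n) v) x - L0_rep (T n v) x\<bar> \<le> d n x * nm v x"
        using rep_dual_minus[OF T T v, of "Suc n" n] dual_bound[OF diff v, of n]
        unfolding d_def by eventually_elim simp
    qed
    have "\<exists>l\<in>carrier (L0 m). AE x in m. (\<lambda>n. L0_rep (T n v) x) \<longlonglongrightarrow> L0_rep l x" if v: "v \<in> carrier M" for v
    proof (rule L0_ex_limit[of "\<lambda>n. T n v"])
      show "T n v \<in> carrier (L0 m)" for n by (rule dual_closed[OF T v])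
      show "AE x in m. summable (\<lambda>n. \<bar>L0_rep (T (Suc n) v) x - L0_rep (T n v) x\<bar>)"
        using step[OF v] sd
      proof eventually_elim
        case (elim x)
        show ?case
        proof (rule summable_comparison_test'[where g = "\<lambda>n. d n x * nm v x" and N = 0])
          show "summable (\<lambda>n. d n x * nm v x)" by (rule summable_mult2[OF elim(2)])
          show "norm \<bar>L0_rep (T (Suc n) v) x - L0_rep (T n v) x\<bar> \<le> d n x * nm v x" for n
            unfolding real_norm_def abs_idempotent by (rule elim(1)[rule_format])
        qed
      qed
    qed
    then have "\<forall>v\<in>carrier M. \<exists>l. l \<in> carrier (L0 m) \<and> (AE x in m. (\<lambda>n. L0_rep (T n v) x) \<longlonglongrightarrow> L0_rep l x)"
      by blast
    \<comment> \<open>The limits are picked vector by vector; linearity is recovered from uniqueness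
      of real limits.\<close>
    from bchoice[OF this] obtain l where l: "\<forall>v\<in>carrier M. l v \<in> carrier (L0 m) \<and>
        (AE x in m. (\<lambda>n. L0_rep (T n v) x) \<longlonglongrightarrow> L0_rep (l v) x)" by (rule exE)
    define L where "L = restrict l (carrier M)"
    have L: "L v \<in> carrier (L0 m)" "AE x in m. (\<lambda>n. L0_rep (T n v) x) \<longlonglongrightarrow> L0_rep (L v) x"
      if "v \<in> carrier M" for v
      using l[rule_format, OF that] that by (simp_all add: L_def)
    have lin: "L0_linear m M (L0_module m) L"
    proof (rule L0_linearI)
      fix v w assume v: "v \<in> carrier M" and w: "w \<in> carrier M"
      have vw: "v \<oplus>\<^bsub>M\<^esub> w \<in> carrier M" using v w by simp
      have "AE x in m. \<forall>n. L0_rep (T n (v \<oplus>\<^bsub>M\<^esub> w)) x = L0_rep (T n v) x + L0_rep (T n w) x"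
        unfolding AE_all_countable dual_add[OF T v w]
        by (intro allI L0_rep_add dual_closed T v w)
      with L(2)[OF v] L(2)[OF w] L(2)[OF vw] L0_rep_add[OF L(1)[OF v] L(1)[OF w]]
      have "AE x in m. L0_rep (L (v \<oplus>\<^bsub>M\<^esub> w)) x = L0_rep (L v \<oplus>\<^bsub>L0 m\<^esub> L w) x"
      proof eventually_elim
        case (elim x)
        then have "(\<lambda>n. L0_rep (T n (v \<oplus>\<^bsub>M\<^esub> w)) x) \<longlonglongrightarrow> L0_rep (L v) x + L0_rep (L w) x"
          using tendsto_add[OF elim(1,2)] elim(5) by simp
        then show ?case using LIMSEQ_unique[OF elim(3)] elim(4) by simp
      qed
      then show "L (v \<oplus>\<^bsub>M\<^esub> w) = L v \<oplus>\<^bsub>L0 m\<^esub> L w"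
        using L(1) v w by (intro L0_eqI[where m = m]) simp_all
    next
      fix f v assume f: "f \<in> carrier (L0 m)" and v: "v \<in> carrier M"
      have fv: "f \<odot>\<^bsub>M\<^esub> v \<in> carrier M" using f v by simp
      have "AE x in m. \<forall>n. L0_rep (T n (f \<odot>\<^bsub>M\<^esub> v)) x = L0_rep f x * L0_rep (T n v) x"
        unfolding AE_all_countable dual_smult[OF T f v]
        by (intro allI L0_rep_mult dual_closed T v f)
      with L(2)[OF v] L(2)[OF fv] L0_rep_mult[OF f L(1)[OF v]]
      have "AE x in m. L0_rep (L (f \<odot>\<^bsub>M\<^esub> v)) x = L0_rep (f \<otimes>\<^bsub>L0 m\<^esub> L v) x"
      proof eventually_elim
        case (elim x)
        then have "(\<lambda>n. L0_rep (T n (f \<odot>\<^bsub>M\<^esub> v)) x) \<longlonglongrightarrow> L0_rep f x * L0_rep (L v) x"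
          using tendsto_mult_left[OF elim(1), of "L0_rep f x"] elim(4) by simp
        then show ?case using LIMSEQ_unique[OF elim(2)] elim(3) by simp
      qed
      then show "L (f \<odot>\<^bsub>M\<^esub> v) = f \<otimes>\<^bsub>L0 m\<^esub> L v"
        using L(1) f v by (intro L0_eqI[where m = m]) simp_all
    qed (use L in \<open>auto simp: L_def\<close>)
    define g where "g K x = (\<Sum>n. d n x) - (\<Sum>n<K. d n x)" for K x
    have g: "g K \<in> borel_measurable m" for K unfolding g_def by measurable
    have g0: "AE x in m. \<forall>K. 0 \<le> g K x"
      using d0 sd by eventually_elim (auto simp: g_def intro!: sum_le_suminf)
    have g_lim: "AE x in m. (\<lambda>K. g K x) \<longlonglongrightarrow> 0"
      using sd
    proof eventually_elim
      case (elim x)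
      have "(\<lambda>K. g K x) \<longlonglongrightarrow> (\<Sum>n. d n x) - (\<Sum>n. d n x)"
        unfolding g_def by (intro tendsto_intros summable_LIMSEQ elim)
      then show ?case by simp
    qed
    have tail: "AE x in m. \<bar>L0_rep (L v) x - L0_rep (T K v) x\<bar> \<le> g K x * nm v x" if v: "v \<in> carrier M" for v K
      using step[OF v] d0 sd L(2)[OF v] nm_nonneg[OF v]
    proof eventually_elim
      case (elim x)
      then show ?case
        using abs_limit_minus_le_tail[of "\<lambda>n. L0_rep (T n v) x" "\<lambda>n. d n x" "nm v x" "L0_rep (L v) x" K]
        by (simp add: g_def)
    qed
    have LD: "L \<in> carrier dual"
    proof (rule dualI[OF lin])
      have gc: "L0_class m (g 0) \<in> carrier (L0 m)" using g by simp
      note nT = dual_pnorm_closed[OF T[of 0]]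
      show "pnorm dual (T 0) \<oplus>\<^bsub>L0 m\<^esub> L0_class m (g 0) \<in> carrier (L0 m)" using nT gc by simp
      fix v assume v: "v \<in> carrier M"
      show "AE x in m. \<bar>L0_rep (L v) x\<bar> \<le> L0_rep (pnorm dual (T 0) \<oplus>\<^bsub>L0 m\<^esub> L0_class m (g 0)) x * nm v x"
        using L0_rep_add[OF nT gc] AE_L0_rep_class[OF g, of 0] tail[OF v, of 0] dual_bound[OF T v, of 0]
        by eventually_elim (simp add: distrib_right)
    qed
    have le: "AE x in m. dnm (T K \<ominus>\<^bsub>dual\<^esub> L) x \<le> g K x" for K
    proof -
      have TL: "T K \<ominus>\<^bsub>dual\<^esub> L \<in> carrier dual" using T LD by simp
      have "AE x in m. dnm (T K \<ominus>\<^bsub>dual\<^esub> L) x \<le> L0_rep (L0_class m (g K)) x"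
      proof (rule dual_pnorm_le[OF TL])
        show "AE x in m. 0 \<le> L0_rep (L0_class m (g K)) x"
          using g0 AE_L0_rep_class[OF g, of K] by eventually_elim simp
        fix v assume v: "v \<in> carrier M"
        show "AE x in m. \<bar>L0_rep ((T K \<ominus>\<^bsub>dual\<^esub> L) v) x\<bar> \<le> L0_rep (L0_class m (g K)) x * nm v x"
          using tail[OF v, of K] rep_dual_minus[OF T LD v, of K] AE_L0_rep_class[OF g, of K]
          by eventually_elim (simp add: abs_minus_commute)
      qed (use g in simp)
      then show ?thesis using AE_L0_rep_class[OF g, of K] by eventually_elim simp
    qed
    have "AE x in m. \<forall>K. 0 \<le> dnm (T K \<ominus>\<^bsub>dual\<^esub> L) x \<and> dnm (T K \<ominus>\<^bsub>dual\<^esub> L) x \<le> g K x"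
      unfolding AE_all_countable
    proof
      fix K
      have "T K \<ominus>\<^bsub>dual\<^esub> L \<in> carrier dual" using T LD by simp
      from dnm_nonneg[OF this] le[of K]
      show "AE x in m. 0 \<le> dnm (T K \<ominus>\<^bsub>dual\<^esub> L) x \<and> dnm (T K \<ominus>\<^bsub>dual\<^esub> L) x \<le> g K x"
        by eventually_elim simp
    qed
    then have "AE x in m. (\<lambda>K. dnm (T K \<ominus>\<^bsub>dual\<^esub> L) x) \<longlonglongrightarrow> 0"
      using g_lim
    proof eventually_elim
      case (elim x)
      show ?case by (rule tendsto_sandwich[OF _ _ tendsto_const elim(2)]) (use elim(1) in auto)
    qed
    then show "\<exists>l\<in>carrier dual. AE x in m. (\<lambda>n. dnm (T n \<ominus>\<^bsub>dual\<^esub> l) x) \<longlonglongrightarrow> 0" using LD by blast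
  qed
qed

section \<open>Morphisms, adjoints and transport of structure\<close>

lemma sf_pn_moduleI: "sigma_finite_measure m \<Longrightarrow> normed_L0_module m M \<Longrightarrow> sf_pn_module m M"
  by (simp add: sf_pn_module_def sf_pn_module_axioms_def normed_L0_module_pn)

lemma morphism_closed: "morphism m M N \<phi> \<Longrightarrow> v \<in> carrier M \<Longrightarrow> \<phi> v \<in> carrier N"
  unfolding morphism_def L0_linear_def by blast

lemma morphism_funcset: "morphism m M N \<phi> \<Longrightarrow> \<phi> \<in> carrier M \<rightarrow> carrier N"
  unfolding morphism_def L0_linear_def by blast

lemma morphism_extensional: "morphism m M N \<phi> \<Longrightarrow> \<phi> \<in> extensional (carrier M)"
  unfolding morphism_def L0_linear_def PiE_def by blast

lemma morphism_add:
  "morphism m M N \<phi> \<Longrightarrow> v \<in> carrier M \<Longrightarrow> w \<in> carrier M \<Longrightarrow> \<phi> (v \<oplus>\<^bsub>M\<^esub> w) = \<phi> v \<oplus>\<^bsub>N\<^esub> \<phi> w"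
  unfolding morphism_def L0_linear_def by blast

lemma morphism_smult:
  "morphism m M N \<phi> \<Longrightarrow> f \<in> carrier (L0 m) \<Longrightarrow> v \<in> carrier M \<Longrightarrow> \<phi> (f \<odot>\<^bsub>M\<^esub> v) = f \<odot>\<^bsub>N\<^esub> \<phi> v"
  unfolding morphism_def L0_linear_def by blast

lemma morphism_le:
  "morphism m M N \<phi> \<Longrightarrow> v \<in> carrier M \<Longrightarrow> AE x in m. L0_rep (pnorm N (\<phi> v)) x \<le> L0_rep (pnorm M v) x"
  unfolding morphism_def L0_le_def by blast

lemma morphismI:
  assumes "\<phi> \<in> extensional (carrier M)" "\<And>v. v \<in> carrier M \<Longrightarrow> \<phi> v \<in> carrier N"
    and "\<And>v w. v \<in> carrier M \<Longrightarrow> w \<in> carrier M \<Longrightarrow> \<phi> (v \<oplus>\<^bsub>M\<^esub> w) = \<phi> v \<oplus>\<^bsub>N\<^esub> \<phi> w"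
    and "\<And>f v. f \<in> carrier (L0 m) \<Longrightarrow> v \<in> carrier M \<Longrightarrow> \<phi> (f \<odot>\<^bsub>M\<^esub> v) = f \<odot>\<^bsub>N\<^esub> \<phi> v"
    and "\<And>v. v \<in> carrier M \<Longrightarrow> AE x in m. L0_rep (pnorm N (\<phi> v)) x \<le> L0_rep (pnorm M v) x"
  shows "morphism m M N \<phi>"
  unfolding morphism_def L0_linear_def L0_le_def PiE_iff using assms by blast

lemma morphism_eqI:
  "morphism m M N \<phi> \<Longrightarrow> morphism m M N \<psi> \<Longrightarrow> (\<And>v. v \<in> carrier M \<Longrightarrow> \<phi> v = \<psi> v) \<Longrightarrow> \<phi> = \<psi>"
  by (rule extensionalityI[OF morphism_extensional morphism_extensional])

lemma (in pn_module) morphism_identity: "morphism m M M (identity M)"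
  by (rule morphismI) (simp_all add: identity_def)

lemma (in pn_module) morphism_compose:
  assumes \<phi>: "morphism m M N \<phi>" and \<psi>: "morphism m N K \<psi>"
  shows "morphism m M K (compose (carrier M) \<psi> \<phi>)"
proof (rule morphismI)
  fix v assume v: "v \<in> carrier M"
  have \<phi>v: "\<phi> v \<in> carrier N" using \<phi> v by (rule morphism_closed)
  then show "compose (carrier M) \<psi> \<phi> v \<in> carrier K" using \<psi> v by (simp add: compose_eq morphism_closed)
  show "AE x in m. L0_rep (pnorm K (compose (carrier M) \<psi> \<phi> v)) x \<le> nm v x"
    using morphism_le[OF \<phi> v] morphism_le[OF \<psi> \<phi>v] unfolding compose_eq[OF v]
    by eventually_elim simp
qed (use \<phi> \<psi> in \<open>simp_all add: compose_eq morphism_add[OF \<phi>] morphism_add[OF \<psi>] morphism_smult[OF \<phi>]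
    morphism_smult[OF \<psi>] morphism_closed[OF \<phi>]\<close>)

lemma compose_identity:
  assumes "morphism m M N \<phi>"
  shows "compose (carrier M) (identity N) \<phi> = \<phi>" "compose (carrier M) \<phi> (identity M) = \<phi>"
  by (rule extensionalityI[OF compose_extensional morphism_extensional[OF assms]];
      simp add: compose_eq identity_def morphism_closed[OF assms])+

text \<open>The bridge to the universal property, which only knows contractions: a functional
  becomes accessible to it once it is scaled into the unit ball of the dual.\<close>

lemma (in sf_pn_module) dual_le_one_iff_morphism:
  "morphism m M (L0_module m) T \<longleftrightarrow> T \<in> carrier dual \<and> (AE x in m. dnm T x \<le> 1)"
proof safe
  assume T: "morphism m M (L0_module m) T"
  have bound: "AE x in m. \<bar>L0_rep (T v) x\<bar> \<le> L0_rep \<one>\<^bsub>L0 m\<^esub> x * nm v x" if v: "v \<in> carrier M" for v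
  proof -
    have "T v \<in> carrier (L0 m)" using morphism_closed[OF T v] by simp
    then show ?thesis using morphism_le[OF T v] L0_rep_abs[of "T v" m] L0_rep_one[of m]
      unfolding L0_module_simps by (auto elim!: eventually_elim2)
  qed
  have "L0_linear m M (L0_module m) T" using T by (simp add: morphism_def)
  then show TD: "T \<in> carrier dual" using bound by (rule dualI[OF _ L0_ops_closed(2)])
  have "AE x in m. dnm T x \<le> L0_rep \<one>\<^bsub>L0 m\<^esub> x"
  proof (rule dual_pnorm_le[OF TD L0_ops_closed(2) _ bound])
    show "AE x in m. 0 \<le> L0_rep \<one>\<^bsub>L0 m\<^esub> x" using L0_rep_one[of m] by eventually_elim simp
  qed
  then show "AE x in m. dnm T x \<le> 1" using L0_rep_one[of m] by eventually_elim simp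
next
  assume T: "T \<in> carrier dual" and le: "AE x in m. dnm T x \<le> 1"
  have "AE x in m. L0_rep (L0_abs m (T v)) x \<le> nm v x" if v: "v \<in> carrier M" for v
    using le dual_bound[OF T v] L0_rep_abs[OF dual_closed[OF T v]] nm_nonneg[OF v]
  proof eventually_elim
    case (elim x)
    then show ?case using mult_right_mono[OF elim(1) elim(4)] by simp
  qed
  then show "morphism m M (L0_module m) T"
    using dual_linear[OF T] by (simp add: morphism_def L0_le_def)
qed

section \<open>Adjoint morphisms\<close>

locale module_pair = M: sf_pn_module m M + N: sf_pn_module m N
  for m :: "'x measure" and M :: "('x L0, 'v) normed_module" and N :: "('x L0, 'w) normed_module"
begin

text \<open>The chain \<open>\<bar>\<omega> (\<phi> v)\<bar> \<le> \<bar>\<omega>\<bar> \<bar>\<phi>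
  v\<bar> \<le> \<bar>\<omega>\<bar> \<bar>v\<bar>\<close> yields continuity and the norm estimate
  at the same time.\<close>

lemma dual_compose:
  assumes \<phi>: "morphism m M N \<phi>" and \<omega>: "\<omega> \<in> carrier (dual_module m N)"
  shows "compose (carrier M) \<omega> \<phi> \<in> carrier (dual_module m M)"
    and "AE x in m. M.dnm (compose (carrier M) \<omega> \<phi>) x \<le> N.dnm \<omega> x"
proof -
  let ?T = "compose (carrier M) \<omega> \<phi>"
  note \<phi>c = morphism_closed[OF \<phi>]
  have lin: "L0_linear m M (L0_module m) ?T"
  proof (rule M.L0_linearI)
    fix v assume v: "v \<in> carrier M"
    show "?T v \<in> carrier (L0 m)" using N.dual_closed[OF \<omega> \<phi>c[OF v]] v by (simp add: compose_eq)
    show "?T (v \<oplus>\<^bsub>M\<^esub> w) = ?T v \<oplus>\<^bsub>L0 m\<^esub> ?T w" if w: "w \<in> carrier M" for w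
      using v w N.dual_add[OF \<omega> \<phi>c[OF v] \<phi>c[OF w]] morphism_add[OF \<phi> v w] by (simp add: compose_eq)
    show "?T (f \<odot>\<^bsub>M\<^esub> v) = f \<otimes>\<^bsub>L0 m\<^esub> ?T v" if f: "f \<in> carrier (L0 m)" for f
      using v f N.dual_smult[OF \<omega> f \<phi>c[OF v]] morphism_smult[OF \<phi> f v] by (simp add: compose_eq)
  qed (rule compose_extensional)
  have bound: "AE x in m. \<bar>L0_rep (?T v) x\<bar> \<le> N.dnm \<omega> x * M.nm v x" if v: "v \<in> carrier M" for v
    using N.dual_bound[OF \<omega> \<phi>c[OF v]] morphism_le[OF \<phi> v] N.dnm_nonneg[OF \<omega>] unfolding compose_eq[OF v]
  proof eventually_elim
    case (elim x)
    then show ?case using mult_left_mono[OF elim(2) elim(3)] by simp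
  qed
  show T: "?T \<in> carrier (dual_module m M)"
    by (rule M.dualI[OF lin N.dual_pnorm_closed[OF \<omega>] bound])
  show "AE x in m. M.dnm ?T x \<le> N.dnm \<omega> x"
    by (rule M.dual_pnorm_le[OF T N.dual_pnorm_closed[OF \<omega>] N.dnm_nonneg[OF \<omega>] bound])
qed

lemma adjoint_apply:
  "\<omega> \<in> carrier (dual_module m N) \<Longrightarrow> adjoint_map m M N \<phi> \<omega> = compose (carrier M) \<omega> \<phi>"
  by (simp add: adjoint_map_def)

lemma morphism_adjoint:
  assumes \<phi>: "morphism m M N \<phi>"
  shows "morphism m (dual_module m N) (dual_module m M) (adjoint_map m M N \<phi>)"
proof (rule morphismI)
  interpret D: pn_module m "dual_module m N" by (rule N.pn_module_dual)
  show "adjoint_map m M N \<phi> \<in> extensional (carrier (dual_module m N))" by (simp add: adjoint_map_def)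
  fix \<omega> assume \<omega>: "\<omega> \<in> carrier (dual_module m N)"
  show "adjoint_map m M N \<phi> \<omega> \<in> carrier (dual_module m M)"
    unfolding adjoint_apply[OF \<omega>] by (rule dual_compose(1)[OF \<phi> \<omega>])
  show "AE x in m. M.dnm (adjoint_map m M N \<phi> \<omega>) x \<le> N.dnm \<omega> x"
    unfolding adjoint_apply[OF \<omega>] by (rule dual_compose(2)[OF \<phi> \<omega>])
  show "adjoint_map m M N \<phi> (\<omega> \<oplus>\<^bsub>dual_module m N\<^esub> \<eta>) =
      adjoint_map m M N \<phi> \<omega> \<oplus>\<^bsub>dual_module m M\<^esub> adjoint_map m M N \<phi> \<eta>"
    if \<eta>: "\<eta> \<in> carrier (dual_module m N)" for \<eta>
    unfolding adjoint_apply[OF \<omega>] adjoint_apply[OF \<eta>] adjoint_apply[OF N.dual_add_closed[OF \<omega> \<eta>]]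
    by (rule extensionalityI[OF compose_extensional M.dual_ops_extensional(1)])
      (simp add: compose_eq morphism_closed[OF \<phi>])
  show "adjoint_map m M N \<phi> (f \<odot>\<^bsub>dual_module m N\<^esub> \<omega>) = f \<odot>\<^bsub>dual_module m M\<^esub> adjoint_map m M N \<phi> \<omega>"
    if f: "f \<in> carrier (L0 m)" for f
    unfolding adjoint_apply[OF \<omega>] adjoint_apply[OF N.dual_smult_closed[OF f \<omega>]]
    by (rule extensionalityI[OF compose_extensional M.dual_ops_extensional(2)])
      (simp add: compose_eq morphism_closed[OF \<phi>])
qed

end

lemma (in sf_pn_module) adjoint_identity: "adjoint_map m M M (identity M) = identity dual"
proof (rule extensionalityI)
  fix \<omega> assume \<omega>: "\<omega> \<in> carrier dual"
  have "compose (carrier M) \<omega> (identity M) = \<omega>"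
    by (rule extensionalityI[OF compose_extensional dual_extensional[OF \<omega>]])
      (simp add: compose_eq identity_def)
  then show "adjoint_map m M M (identity M) \<omega> = identity dual \<omega>"
    using \<omega> by (simp add: adjoint_map_def identity_def)
qed (simp_all add: adjoint_map_def identity_def)

text \<open>Contravariance is associativity of composition; it carries the relations of the direct
  system and of its limit over to the duals.\<close>

lemma adjoint_compose:
  assumes "sf_pn_module m M" "sf_pn_module m N" "sf_pn_module m K"
    and \<phi>: "morphism m M N \<phi>" and \<psi>: "morphism m N K \<psi>"
  shows "adjoint_map m M K (compose (carrier M) \<psi> \<phi>) =
    compose (carrier (dual_module m K)) (adjoint_map m M N \<phi>) (adjoint_map m N K \<psi>)"
proof (rule extensionalityI)
  interpret MN: module_pair m M N using assms by (simp add: module_pair_def)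
  interpret NK: module_pair m N K using assms by (simp add: module_pair_def)
  interpret MK: module_pair m M K using assms by (simp add: module_pair_def)
  fix \<omega> assume \<omega>: "\<omega> \<in> carrier (dual_module m K)"
  have "compose (carrier M) \<omega> (compose (carrier M) \<psi> \<phi>) = compose (carrier M) (compose (carrier N) \<omega> \<psi>) \<phi>"
    by (rule compose_assoc[OF morphism_funcset[OF \<phi>]])
  then show "adjoint_map m M K (compose (carrier M) \<psi> \<phi>) \<omega> =
      compose (carrier (dual_module m K)) (adjoint_map m M N \<phi>) (adjoint_map m N K \<psi>) \<omega>"
    using MK.adjoint_apply[OF \<omega>] NK.adjoint_apply[OF \<omega>] MN.adjoint_apply[OF NK.dual_compose(1)[OF \<psi> \<omega>]]
    by (simp add: compose_eq[OF \<omega>])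
qed (simp_all add: adjoint_map_def)

section \<open>Transport of structure along injections\<close>

text \<open>The universal properties are assumed for objects on one fixed type; copying a module
  onto the image of an injection brings objects on other types there.\<close>

definition transport :: "('v \<Rightarrow> 'u) \<Rightarrow> ('x L0, 'v) normed_module \<Rightarrow> ('x L0, 'u) normed_module" where
  "transport f N =
     (let g = inv_into (carrier N) f in
      \<lparr>carrier = f ` carrier N, mult = undefined, one = undefined, zero = f \<zero>\<^bsub>N\<^esub>,
       add = (\<lambda>a b. f (g a \<oplus>\<^bsub>N\<^esub> g b)), smult = (\<lambda>r a. f (r \<odot>\<^bsub>N\<^esub> g a)), pnorm = (\<lambda>a. pnorm N (g a))\<rparr>)"

context
  fixes m :: "'x measure" and N :: "('x L0, 'v) normed_module" and f :: "'v \<Rightarrow> 'u"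
  assumes N: "normed_L0_module m N" and inj: "inj_on f (carrier N)"
begin

interpretation N: pn_module m N using N by (rule normed_L0_module_pn)

lemma transport_simps:
  shows "carrier (transport f N) = f ` carrier N" "\<zero>\<^bsub>transport f N\<^esub> = f \<zero>\<^bsub>N\<^esub>"
    and "v \<in> carrier N \<Longrightarrow> w \<in> carrier N \<Longrightarrow> f v \<oplus>\<^bsub>transport f N\<^esub> f w = f (v \<oplus>\<^bsub>N\<^esub> w)"
    and "v \<in> carrier N \<Longrightarrow> r \<odot>\<^bsub>transport f N\<^esub> f v = f (r \<odot>\<^bsub>N\<^esub> v)"
    and "v \<in> carrier N \<Longrightarrow> pnorm (transport f N) (f v) = pnorm N v"
  using inv_into_f_f[OF inj] by (simp_all add: transport_def Let_def)

lemma pn_module_transport: "pn_module m (transport f N)"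
proof -
  have "Module.module (L0 m) (transport f N)"
  proof (rule moduleI)
    show "abelian_group (transport f N)"
    proof (rule abelian_groupI)
      fix a assume "a \<in> carrier (transport f N)"
      then obtain v where v: "v \<in> carrier N" "a = f v" by (auto simp: transport_simps)
      then show "\<exists>b\<in>carrier (transport f N). b \<oplus>\<^bsub>transport f N\<^esub> a = \<zero>\<^bsub>transport f N\<^esub>"
        by (intro bexI[of _ "f (\<ominus>\<^bsub>N\<^esub> v)"]) (simp_all add: transport_simps N.l_neg)
    qed (auto simp: transport_simps N.M.a_ac)
  qed (auto simp: transport_simps cring_L0 N.smult_l_distr N.smult_r_distr N.smult_assoc1)
  moreover have "pointwise_norm m (transport f N)"
    using N.pointwise_norm inj
    by (auto simp: pointwise_norm_def transport_simps inj_on_eq_iff)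
  ultimately show ?thesis by (simp add: pn_module_def pn_module_axioms_def)
qed

lemma module_dist_transport:
  assumes v: "v \<in> carrier N" and w: "w \<in> carrier N"
  shows "module_dist m' (transport f N) (f v) (f w) = module_dist m' N v w"
proof -
  interpret T: pn_module m "transport f N" by (rule pn_module_transport)
  have "\<ominus>\<^bsub>transport f N\<^esub> f w = f (\<ominus>\<^bsub>N\<^esub> w)"
    using w by (intro T.minus_equality) (simp_all add: transport_simps N.l_neg)
  then have "f v \<ominus>\<^bsub>transport f N\<^esub> f w = f (v \<ominus>\<^bsub>N\<^esub> w)"
    using v w by (simp add: a_minus_def transport_simps)
  then show ?thesis using v w by (simp add: module_dist_def transport_simps)
qed

text \<open>The copy is isometric, so Cauchy sequences are pulled back along \<open>f\<close> and
  their limits pushed forward.\<close>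

lemma normed_L0_module_transport: "normed_L0_module m (transport f N)"
proof -
  interpret T: pn_module m "transport f N" by (rule pn_module_transport)
  have "Metric_space.mcomplete (carrier (transport f N)) (module_dist m' (transport f N))"
    if e: "equivalent_prob m m'" for m'
  proof -
    interpret D: Metric_space "carrier N" "module_dist m' N" using e by (rule N.Metric_space_module_dist)
    interpret E: Metric_space "carrier (transport f N)" "module_dist m' (transport f N)"
      using e by (rule T.Metric_space_module_dist)
    show ?thesis unfolding E.mcomplete_def
    proof (intro allI impI)
      fix s assume s: "E.MCauchy s"
      then have "range s \<subseteq> carrier (transport f N)" unfolding E.MCauchy_def by blast
      then have "s n \<in> f ` carrier N" for n unfolding transport_simps by blast
      then have "\<exists>v. v \<in> carrier N \<and> s n = f v" for n by blast
      then obtain t where t: "\<And>n. t n \<in> carrier N" "\<And>n. s n = f (t n)" by metis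
      then have "D.MCauchy t"
        using s unfolding D.MCauchy_def E.MCauchy_def by (simp add: module_dist_transport image_subset_iff)
      moreover have "D.mcomplete" using N e unfolding normed_L0_module_def by blast
      ultimately obtain l where "limitin D.mtopology t l sequentially" unfolding D.mcomplete_def by blast
      then have "limitin E.mtopology s (f l) sequentially"
        using t unfolding D.limitin_metric E.limitin_metric
        by (simp add: transport_simps module_dist_transport)
      then show "\<exists>l. limitin E.mtopology s l sequentially" by blast
    qed
  qed
  then show ?thesis
    using T.module_axioms T.pointwise_norm unfolding normed_L0_module_def by blast
qed

lemma isomorphism_transport: "isomorphism m N (transport f N) (restrict f (carrier N))"
proof -
  let ?g = "restrict (inv_into (carrier N) f) (f ` carrier N)"
  have g: "?g (f v) = v" if "v \<in> carrier N" for v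
    using that inv_into_f_f[OF inj that] by (simp add: transport_simps)
  have "morphism m N (transport f N) (restrict f (carrier N))"
    by (rule morphismI) (simp_all add: transport_simps)
  moreover have "morphism m (transport f N) N ?g"
    by (rule morphismI) (auto simp: transport_simps g simp del: restrict_apply restrict_apply')
  moreover have "compose (carrier N) ?g (restrict f (carrier N)) = identity N"
    by (rule ext) (simp add: compose_def identity_def transport_simps inv_into_f_f[OF inj])
  moreover have "compose (carrier (transport f N)) (restrict f (carrier N)) ?g = identity (transport f N)"
    by (rule ext) (auto simp: compose_def identity_def transport_simps inv_into_f_f[OF inj])
  ultimately show ?thesis unfolding isomorphism_def by blast
qed

end

section \<open>Universal properties\<close>

text \<open>Serves twice: to move a target to a transported vertex, and to make a target with vertex
  \<open>L0 m\<close> out of a contraction on the limit.\<close>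

lemma direct_target_compose:
  assumes t: "direct_target m I r M \<phi> N \<psi>" and sys: "direct_system m I r M \<phi>" and r: "r \<subseteq> I \<times> I"
    and N': "normed_L0_module m N'" and F: "morphism m N N' F"
  shows "direct_target m I r M \<phi> N' (\<lambda>i. compose (carrier (M i)) F (\<psi> i))"
  unfolding direct_target_def
proof (intro conjI ballI allI impI)
  fix i assume i: "i \<in> I"
  then interpret pn_module m "M i"
    using sys by (intro normed_L0_module_pn) (auto simp: direct_system_def)
  show "morphism m (M i) N' (compose (carrier (M i)) F (\<psi> i))"
    by (rule morphism_compose[OF _ F]) (use t i in \<open>auto simp: direct_target_def\<close>)
next
  fix i j assume ij: "(i, j) \<in> r"
  then have "morphism m (M i) (M j) (\<phi> i j)" using sys by (auto simp: direct_system_def)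
  from compose_assoc[OF morphism_funcset[OF this], of F "\<psi> j"]
  show "compose (carrier (M i)) (compose (carrier (M j)) F (\<psi> j)) (\<phi> i j) = compose (carrier (M i)) F (\<psi> i)"
    using t ij unfolding direct_target_def by metis
qed (rule N')

text \<open>The problem is solved for the transported copy of \<open>N\<close>, and the solution is
  brought back by the inverse \<open>G\<close> of the transport map \<open>F\<close>. Uniqueness
  comes back as well, because \<open>F\<close> has a left inverse and can be cancelled.\<close>

lemma direct_limit_universal:
  fixes N :: "('x L0, 'w) normed_module" and f :: "'w \<Rightarrow> 'u"
  assumes lim: "direct_limit TYPE('u) m I r M \<phi> L \<eta>" and sys: "direct_system m I r M \<phi>"
    and r: "r \<subseteq> I \<times> I" and t: "direct_target m I r M \<phi> N \<psi>" and f: "inj_on f (carrier N)"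
  shows "\<exists>!\<Phi>. morphism m L N \<Phi> \<and> (\<forall>i\<in>I. compose (carrier (M i)) \<Phi> (\<eta> i) = \<psi> i)"
proof -
  have N: "normed_L0_module m N" using t by (simp add: direct_target_def)
  have L: "pn_module m L" and \<eta>: "\<And>i. i \<in> I \<Longrightarrow> morphism m (M i) L (\<eta> i)"
    using lim by (auto simp: direct_limit_def direct_target_def intro: normed_L0_module_pn)
  have \<psi>: "\<And>i. i \<in> I \<Longrightarrow> morphism m (M i) N (\<psi> i)" using t by (simp add: direct_target_def)
  obtain F G where F: "morphism m N (transport f N) F" and G: "morphism m (transport f N) N G"
    and GF: "compose (carrier N) G F = identity N"
    using isomorphism_transport[OF N f] unfolding isomorphism_def by blast
  let ?\<psi> = "\<lambda>i. compose (carrier (M i)) F (\<psi> i)"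
  have "direct_target m I r M \<phi> (transport f N) ?\<psi>"
    by (rule direct_target_compose[OF t sys r normed_L0_module_transport[OF N f] F])
  then have ex1: "\<exists>!\<Phi>. morphism m L (transport f N) \<Phi> \<and> (\<forall>i\<in>I. compose (carrier (M i)) \<Phi> (\<eta> i) = ?\<psi> i)"
    using lim unfolding direct_limit_def by blast
  then obtain \<Phi> where \<Phi>: "morphism m L (transport f N) \<Phi>"
    "\<And>i. i \<in> I \<Longrightarrow> compose (carrier (M i)) \<Phi> (\<eta> i) = ?\<psi> i" by blast
  show ?thesis
  proof (rule ex_ex1I)
    have "compose (carrier (M i)) (compose (carrier L) G \<Phi>) (\<eta> i) = \<psi> i" if i: "i \<in> I" for i
    proof -
      have "compose (carrier (M i)) (compose (carrier L) G \<Phi>) (\<eta> i) = compose (carrier (M i)) G (?\<psi> i)"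
        using compose_assoc[OF morphism_funcset[OF \<eta>[OF i]], of G \<Phi>] \<Phi>(2)[OF i] by simp
      also have "\<dots> = compose (carrier (M i)) (identity N) (\<psi> i)"
        using compose_assoc[OF morphism_funcset[OF \<psi>[OF i]], of G F] GF by simp
      finally show ?thesis using compose_identity(1)[OF \<psi>[OF i]] by simp
    qed
    then show "\<exists>\<Phi>. morphism m L N \<Phi> \<and> (\<forall>i\<in>I. compose (carrier (M i)) \<Phi> (\<eta> i) = \<psi> i)"
      using pn_module.morphism_compose[OF L \<Phi>(1) G] by blast
  next
    fix \<Phi>1 \<Phi>2
    assume 1: "morphism m L N \<Phi>1 \<and> (\<forall>i\<in>I. compose (carrier (M i)) \<Phi>1 (\<eta> i) = \<psi> i)"
      and 2: "morphism m L N \<Phi>2 \<and> (\<forall>i\<in>I. compose (carrier (M i)) \<Phi>2 (\<eta> i) = \<psi> i)"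
    have F\<Phi>: "morphism m L (transport f N) (compose (carrier L) F \<Phi>) \<and>
        (\<forall>i\<in>I. compose (carrier (M i)) (compose (carrier L) F \<Phi>) (\<eta> i) = ?\<psi> i)"
      if "morphism m L N \<Phi> \<and> (\<forall>i\<in>I. compose (carrier (M i)) \<Phi> (\<eta> i) = \<psi> i)" for \<Phi>
    proof (intro conjI ballI)
      show "morphism m L (transport f N) (compose (carrier L) F \<Phi>)"
        using that by (intro pn_module.morphism_compose[OF L _ F]) blast
      fix i assume i: "i \<in> I"
      show "compose (carrier (M i)) (compose (carrier L) F \<Phi>) (\<eta> i) = ?\<psi> i"
        using compose_assoc[OF morphism_funcset[OF \<eta>[OF i]], of F \<Phi>] that i by simp
    qed
    have cancel: "compose (carrier L) G (compose (carrier L) F \<Phi>) = \<Phi>" if "morphism m L N \<Phi>" for \<Phi>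
      using compose_assoc[OF morphism_funcset[OF that], of G F] GF compose_identity(1)[OF that] by simp
    have "compose (carrier L) F \<Phi>1 = compose (carrier L) F \<Phi>2"
      using ex1 F\<Phi>[OF 1] F\<Phi>[OF 2] by blast
    then have "compose (carrier L) G (compose (carrier L) F \<Phi>1) = compose (carrier L) G (compose (carrier L) F \<Phi>2)"
      by (rule arg_cong)
    then show "\<Phi>1 = \<Phi>2" unfolding cancel[OF conjunct1[OF 1]] cancel[OF conjunct1[OF 2]] .
  qed
qed

text \<open>Here the test object is the source of the maps, so cones are transported by
  precomposition with \<open>G\<close>, which precomposition with \<open>F\<close> undoes.\<close>

lemma inverse_limit_universal:
  fixes Ob :: "('x L0, 'w) normed_module" and f :: "'w \<Rightarrow> 'u"
  assumes lim: "inverse_limit TYPE('u) m I r N P L \<pi>" and r: "r \<subseteq> I \<times> I"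
    and cone: "inverse_cone m I r N P Ob Q" and f: "inj_on f (carrier Ob)"
  shows "\<exists>!\<Phi>. morphism m Ob L \<Phi> \<and> (\<forall>i\<in>I. compose (carrier Ob) (\<pi> i) \<Phi> = Q i)"
proof -
  have Ob: "normed_L0_module m Ob" and Q: "\<And>i. i \<in> I \<Longrightarrow> morphism m Ob (N i) (Q i)"
    and QP: "\<And>i j. (i, j) \<in> r \<Longrightarrow> Q i = compose (carrier Ob) (P i j) (Q j)"
    using cone by (simp_all add: inverse_cone_def)
  let ?O = "transport f Ob"
  have pO: "pn_module m Ob" by (rule normed_L0_module_pn[OF Ob])
  have pT: "pn_module m ?O" by (rule pn_module_transport[OF Ob f])
  obtain F G where F: "morphism m Ob ?O F" and G: "morphism m ?O Ob G"
    and GF: "compose (carrier Ob) G F = identity Ob"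
    using isomorphism_transport[OF Ob f] unfolding isomorphism_def by blast
  let ?Q = "\<lambda>i. compose (carrier ?O) (Q i) G"
  have "inverse_cone m I r N P ?O ?Q"
    unfolding inverse_cone_def
  proof (intro conjI ballI allI impI)
    show "normed_L0_module m ?O" by (rule normed_L0_module_transport[OF Ob f])
    show "morphism m ?O (N i) (?Q i)" if "i \<in> I" for i
      by (rule pn_module.morphism_compose[OF pT G Q[OF that]])
    show "?Q i = compose (carrier ?O) (P i j) (?Q j)" if "(i, j) \<in> r" for i j
      using compose_assoc[OF morphism_funcset[OF G], of "P i j" "Q j"] QP[OF that] by simp
  qed
  then have ex1: "\<exists>!\<Phi>. morphism m ?O L \<Phi> \<and> (\<forall>i\<in>I. compose (carrier ?O) (\<pi> i) \<Phi> = ?Q i)"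
    using lim unfolding inverse_limit_def by blast
  then obtain \<Phi> where \<Phi>: "morphism m ?O L \<Phi>" "\<And>i. i \<in> I \<Longrightarrow> compose (carrier ?O) (\<pi> i) \<Phi> = ?Q i"
    by blast
  have cancel: "compose (carrier Ob) (compose (carrier ?O) h G) F = h" if "morphism m Ob K h" for K :: "('x L0, 'z) normed_module" and h
    using compose_assoc[OF morphism_funcset[OF F], of h G] GF compose_identity(2)[OF that] by simp
  show ?thesis
  proof (rule ex_ex1I)
    have "compose (carrier Ob) (\<pi> i) (compose (carrier Ob) \<Phi> F) = Q i" if i: "i \<in> I" for i
      using compose_assoc[OF morphism_funcset[OF F], of "\<pi> i" \<Phi>] \<Phi>(2)[OF i] cancel[OF Q[OF i]] by simp
    then show "\<exists>\<Phi>. morphism m Ob L \<Phi> \<and> (\<forall>i\<in>I. compose (carrier Ob) (\<pi> i) \<Phi> = Q i)"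
      using pn_module.morphism_compose[OF pO F \<Phi>(1)] by blast
  next
    fix \<Phi>1 \<Phi>2
    assume 1: "morphism m Ob L \<Phi>1 \<and> (\<forall>i\<in>I. compose (carrier Ob) (\<pi> i) \<Phi>1 = Q i)"
      and 2: "morphism m Ob L \<Phi>2 \<and> (\<forall>i\<in>I. compose (carrier Ob) (\<pi> i) \<Phi>2 = Q i)"
    have \<Phi>G: "morphism m ?O L (compose (carrier ?O) \<Phi> G) \<and>
        (\<forall>i\<in>I. compose (carrier ?O) (\<pi> i) (compose (carrier ?O) \<Phi> G) = ?Q i)"
      if "morphism m Ob L \<Phi> \<and> (\<forall>i\<in>I. compose (carrier Ob) (\<pi> i) \<Phi> = Q i)" for \<Phi>
    proof (intro conjI ballI)
      show "morphism m ?O L (compose (carrier ?O) \<Phi> G)"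
        using that by (intro pn_module.morphism_compose[OF pT G]) blast
      fix i assume i: "i \<in> I"
      show "compose (carrier ?O) (\<pi> i) (compose (carrier ?O) \<Phi> G) = ?Q i"
        using compose_assoc[OF morphism_funcset[OF G], of "\<pi> i" \<Phi>] that i by simp
    qed
    have "compose (carrier ?O) \<Phi>1 G = compose (carrier ?O) \<Phi>2 G"
      using ex1 \<Phi>G[OF 1] \<Phi>G[OF 2] by blast
    then have "compose (carrier Ob) (compose (carrier ?O) \<Phi>1 G) F = compose (carrier Ob) (compose (carrier ?O) \<Phi>2 G) F"
      by (rule arg_cong)
    then show "\<Phi>1 = \<Phi>2" unfolding cancel[OF conjunct1[OF 1]] cancel[OF conjunct1[OF 2]] .
  qed
qed

section \<open>Functionals on a direct limit\<close>

locale direct_limit_of_modules =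
  fixes m :: "'x measure" and I :: "'i set" and r :: "'i rel"
    and M :: "'i \<Rightarrow> ('x L0, 'v) normed_module" and \<phi> :: "'i \<Rightarrow> 'i \<Rightarrow> 'v \<Rightarrow> 'v"
    and L :: "('x L0, 'l) normed_module" and \<eta> :: "'i \<Rightarrow> 'v \<Rightarrow> 'l"
  assumes sigma_finite: "sigma_finite_measure m" and r: "r \<subseteq> I \<times> I"
    and system: "direct_system m I r M \<phi>"
    and limit: "direct_limit TYPE(('x, 'i, 'v, 'l) direct_tests) m I r M \<phi> L \<eta>"
begin

abbreviation dM where "dM i \<equiv> dual_module m (M i)"
abbreviation dL where "dL \<equiv> dual_module m L"
abbreviation adjL where "adjL i \<equiv> adjoint_map m (M i) L (\<eta> i)"
abbreviation adj where "adj i j \<equiv> adjoint_map m (M i) (M j) (\<phi> i j)"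

lemma sf_M: "i \<in> I \<Longrightarrow> sf_pn_module m (M i)"
  using system by (auto simp: direct_system_def intro: sf_pn_moduleI sigma_finite)

lemma target: "direct_target m I r M \<phi> L \<eta>"
  using limit by (simp add: direct_limit_def)

sublocale L: sf_pn_module m L
  using target by (auto simp: direct_target_def intro: sf_pn_moduleI sigma_finite)

lemma \<eta>: "i \<in> I \<Longrightarrow> morphism m (M i) L (\<eta> i)"
  using target by (simp add: direct_target_def)

lemma pair_M_L: "i \<in> I \<Longrightarrow> module_pair m (M i) L"
  by (simp add: module_pair_def sf_M L.sf_pn_module_axioms)

lemma adjL_apply: "i \<in> I \<Longrightarrow> \<omega> \<in> carrier dL \<Longrightarrow> adjL i \<omega> = compose (carrier (M i)) \<omega> (\<eta> i)"
  by (rule module_pair.adjoint_apply[OF pair_M_L])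

lemma morphism_adjL: "i \<in> I \<Longrightarrow> morphism m dL (dM i) (adjL i)"
  by (rule module_pair.morphism_adjoint[OF pair_M_L \<eta>])

text \<open>The third summand of \<open>direct_tests\<close> holds \<open>L0 m\<close> itself, so
  the injection is immediate.\<close>

lemma L0_universal:
  assumes "direct_target m I r M \<phi> (L0_module m) \<psi>"
  shows "\<exists>!\<Phi>. morphism m L (L0_module m) \<Phi> \<and> (\<forall>i\<in>I. compose (carrier (M i)) \<Phi> (\<eta> i) = \<psi> i)"
  by (rule direct_limit_universal[OF limit system r assms, of "\<lambda>b. Inr (Inr b)"]) (simp add: inj_on_def)

text \<open>The universal property only concerns contractions into \<open>L\<^sup>0(m)\<close>, so a pair of functionals is
  first divided by \<open>1 + \<bar>\<omega>\<bar> + \<bar>\<omega>'\<bar>\<close>.\<close>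

lemma dual_limit_eqI:
  assumes \<omega>: "\<omega> \<in> carrier dL" and \<omega>': "\<omega>' \<in> carrier dL" and eq: "\<And>i. i \<in> I \<Longrightarrow> adjL i \<omega> = adjL i \<omega>'"
  shows "\<omega> = \<omega>'"
proof -
  interpret D: pn_module m dL by (rule L.pn_module_dual)
  note n = L.dual_pnorm_closed[OF \<omega>] and n' = L.dual_pnorm_closed[OF \<omega>']
  have [measurable]: "L.dnm \<omega> \<in> borel_measurable m" "L.dnm \<omega>' \<in> borel_measurable m"
    by (rule L0_rep_measurable n n')+
  \<comment> \<open>The summand 1 keeps \<open>p\<close> away from 0, so \<open>q\<close> is a true
    inverse of \<open>p\<close> in the ring and the rescaling can be undone at the end; the other
    summands make \<open>p\<close> dominate both norms.\<close>
  define p q where "p x = 1 + \<bar>L.dnm \<omega> x\<bar> + \<bar>L.dnm \<omega>' x\<bar>" and "q x = inverse (p x)" for x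
  have p: "p \<in> borel_measurable m" unfolding p_def by measurable
  then have q: "q \<in> borel_measurable m" unfolding q_def by measurable
  have pc: "L0_class m p \<in> carrier (L0 m)" and qc: "L0_class m q \<in> carrier (L0 m)"
    using p q by simp_all
  have p_pos: "p x > 0" for x by (simp add: p_def add_pos_nonneg)
  have "AE x in m. L0_rep (L0_class m p \<otimes>\<^bsub>L0 m\<^esub> L0_class m q) x = L0_rep \<one>\<^bsub>L0 m\<^esub> x"
    using L0_rep_mult[OF pc qc] AE_L0_rep_class[OF p] AE_L0_rep_class[OF q] L0_rep_one[of m]
  proof eventually_elim
    case (elim x)
    then show ?case using p_pos[of x] by (simp add: q_def)
  qed
  then have pq: "L0_class m p \<otimes>\<^bsub>L0 m\<^esub> L0_class m q = \<one>\<^bsub>L0 m\<^esub>"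
    using pc qc by (intro L0_eqI[where m = m]) simp_all
  let ?s = "\<lambda>\<omega>. L0_class m q \<odot>\<^bsub>dL\<^esub> \<omega>"
  have s: "morphism m L (L0_module m) (?s \<xi>)"
    if \<xi>: "\<xi> \<in> carrier dL" and le: "\<And>x. L.dnm \<xi> x \<le> p x" for \<xi>
    unfolding L.dual_le_one_iff_morphism
  proof
    show "?s \<xi> \<in> carrier dL" by (rule L.dual_smult_closed[OF qc \<xi>])
    show "AE x in m. L.dnm (?s \<xi>) x \<le> 1"
      using L.dnm_smult[OF qc \<xi>] AE_L0_rep_class[OF q]
    proof eventually_elim
      case (elim x)
      then have "L.dnm (?s \<xi>) x = L.dnm \<xi> x / p x"
        using p_pos[of x] by (simp add: q_def divide_inverse mult.commute)
      then show ?case using p_pos[of x] le[of x] by (simp add: divide_le_eq)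
    qed
  qed
  have s\<omega>: "morphism m L (L0_module m) (?s \<omega>)" and s\<omega>': "morphism m L (L0_module m) (?s \<omega>')"
    using \<omega> \<omega>' by (auto intro!: s simp: p_def)
  have "direct_target m I r M \<phi> (L0_module m) (\<lambda>i. compose (carrier (M i)) (?s \<omega>) (\<eta> i))"
    by (rule direct_target_compose[OF target system r normed_L0_module_L0 s\<omega>])
  moreover have "compose (carrier (M i)) (?s \<omega>') (\<eta> i) = compose (carrier (M i)) (?s \<omega>) (\<eta> i)"
    if i: "i \<in> I" for i
  proof -
    have "adjL i (?s \<omega>') = adjL i (?s \<omega>)"
      using morphism_smult[OF morphism_adjL[OF i] qc] \<omega> \<omega>' eq[OF i] by simp
    then show ?thesis
      using adjL_apply[OF i] L.dual_smult_closed[OF qc \<omega>] L.dual_smult_closed[OF qc \<omega>'] by simp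
  qed
  \<comment> \<open>Both are mediating morphisms for the same target, whose legs are the composites
    of the scaled \<open>\<omega>\<close> with the maps \<open>\<eta> i\<close>.\<close>
  ultimately have "?s \<omega> = ?s \<omega>'"
    using L0_universal s\<omega> s\<omega>' by blast
  then have "L0_class m p \<odot>\<^bsub>dL\<^esub> ?s \<omega> = L0_class m p \<odot>\<^bsub>dL\<^esub> ?s \<omega>'" by simp
  then show ?thesis using pc qc \<omega> \<omega>' pq by (simp flip: D.smult_assoc1)
qed

text \<open>The compatible functionals are divided by the common bound \<open>c\<close>. Where \<open>c\<close> vanishes so do all
  of them, hence the junk value \<open>1 / 0 = 0\<close> is harmless.\<close>

lemma dual_limit_ex:
  assumes c: "c \<in> carrier (L0 m)" and T: "\<And>i. i \<in> I \<Longrightarrow> T i \<in> carrier (dM i)"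
    and le: "\<And>i. i \<in> I \<Longrightarrow> AE x in m. L0_rep (pnorm (dM i) (T i)) x \<le> L0_rep c x"
    and compat: "\<And>i j. (i, j) \<in> r \<Longrightarrow> T i = adj i j (T j)"
    and c0: "AE x in m. 0 \<le> L0_rep c x"
  shows "\<exists>\<omega>\<in>carrier dL. (\<forall>i\<in>I. adjL i \<omega> = T i) \<and> (AE x in m. L.dnm \<omega> x \<le> L0_rep c x)"
proof -
  define q where "q x = inverse (L0_rep c x)" for x
  have [measurable]: "L0_rep c \<in> borel_measurable m" using c by simp
  have q: "q \<in> borel_measurable m" unfolding q_def by measurable
  then have qc: "L0_class m q \<in> carrier (L0 m)" by simp
  define \<psi> where "\<psi> i = L0_class m q \<odot>\<^bsub>dM i\<^esub> T i" for i
  have "direct_target m I r M \<phi> (L0_module m) \<psi>"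
    unfolding direct_target_def
  proof (intro conjI ballI allI impI)
    show "normed_L0_module m (L0_module m)" by (rule normed_L0_module_L0)
    fix i assume i: "i \<in> I"
    interpret Mi: sf_pn_module m "M i" using i by (rule sf_M)
    show "morphism m (M i) (L0_module m) (\<psi> i)"
      unfolding Mi.dual_le_one_iff_morphism
    proof
      show "\<psi> i \<in> carrier (dM i)" unfolding \<psi>_def by (rule Mi.dual_smult_closed[OF qc T[OF i]])
      show "AE x in m. Mi.dnm (\<psi> i) x \<le> 1"
        using Mi.dnm_smult[OF qc T[OF i]] AE_L0_rep_class[OF q] le[OF i] c0
        unfolding \<psi>_def
      proof eventually_elim
        case (elim x)
        then have "Mi.dnm (L0_class m q \<odot>\<^bsub>dM i\<^esub> T i) x = Mi.dnm (T i) x / L0_rep c x"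
          by (simp add: q_def divide_inverse mult.commute)
        then show ?case using elim(3,4) by (simp add: divide_le_eq)
      qed
    qed
  next
    fix i j assume ij: "(i, j) \<in> r"
    then have i: "i \<in> I" and j: "j \<in> I" using r by auto
    interpret P: module_pair m "M i" "M j" using sf_M[OF i] sf_M[OF j] by (simp add: module_pair_def)
    have \<phi>: "morphism m (M i) (M j) (\<phi> i j)" using system ij by (simp add: direct_system_def)
    \<comment> \<open>Rescaling by the same \<open>q\<close> at every index preserves compatibility,
      because adjoints are linear over \<open>L0 m\<close>.\<close>
    have "\<psi> i = adj i j (\<psi> j)"
      unfolding \<psi>_def compat[OF ij] by (rule morphism_smult[OF P.morphism_adjoint[OF \<phi>] qc T[OF j], symmetric])
    then show "compose (carrier (M i)) (\<psi> j) (\<phi> i j) = \<psi> i"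
      using P.adjoint_apply[OF P.N.dual_smult_closed[OF qc T[OF j]]] by (simp add: \<psi>_def)
  qed
  then obtain \<Phi> where \<Phi>: "morphism m L (L0_module m) \<Phi>"
    and \<Phi>\<eta>: "\<And>i. i \<in> I \<Longrightarrow> compose (carrier (M i)) \<Phi> (\<eta> i) = \<psi> i"
    using L0_universal by blast
  have \<Phi>D: "\<Phi> \<in> carrier dL" and \<Phi>1: "AE x in m. L.dnm \<Phi> x \<le> 1"
    using \<Phi> unfolding L.dual_le_one_iff_morphism by blast+
  \<comment> \<open>Multiplying the mediating contraction by \<open>c\<close> undoes the division
    and turns its norm bound 1 into \<open>c\<close>.\<close>
  show ?thesis
  proof (intro bexI[of _ "c \<odot>\<^bsub>dL\<^esub> \<Phi>"] conjI ballI)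
    show "c \<odot>\<^bsub>dL\<^esub> \<Phi> \<in> carrier dL" by (rule L.dual_smult_closed[OF c \<Phi>D])
    show "AE x in m. L.dnm (c \<odot>\<^bsub>dL\<^esub> \<Phi>) x \<le> L0_rep c x"
      using L.dnm_smult[OF c \<Phi>D] \<Phi>1 c0
    proof eventually_elim
      case (elim x)
      then show ?case using mult_left_mono[OF elim(2) elim(3)] by simp
    qed
    fix i assume i: "i \<in> I"
    interpret Mi: sf_pn_module m "M i" using i by (rule sf_M)
    have \<psi>i: "\<psi> i \<in> carrier (dM i)" unfolding \<psi>_def by (rule Mi.dual_smult_closed[OF qc T[OF i]])
    have "adjL i (c \<odot>\<^bsub>dL\<^esub> \<Phi>) = c \<odot>\<^bsub>dM i\<^esub> \<psi> i"
      using morphism_smult[OF morphism_adjL[OF i] c \<Phi>D] adjL_apply[OF i \<Phi>D] \<Phi>\<eta>[OF i] by simp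
    also have "\<dots> = T i"
    proof (rule Mi.dual_eqI[OF Mi.dual_smult_closed[OF c \<psi>i] T[OF i]])
      fix v assume v: "v \<in> carrier (M i)"
      note Tv = Mi.dual_closed[OF T[OF i] v]
      have "AE x in m. L0_rep (c \<otimes>\<^bsub>L0 m\<^esub> (L0_class m q \<otimes>\<^bsub>L0 m\<^esub> T i v)) x = L0_rep (T i v) x"
        using L0_rep_mult[OF c L0_ops_closed(4)[OF qc Tv]] L0_rep_mult[OF qc Tv] AE_L0_rep_class[OF q]
          Mi.dual_bound[OF T[OF i] v] le[OF i] Mi.dnm_nonneg[OF T[OF i]]
      proof eventually_elim
        case (elim x)
        then show ?case by (cases "L0_rep c x = 0") (simp_all add: q_def)
      qed
      then have "c \<otimes>\<^bsub>L0 m\<^esub> (L0_class m q \<otimes>\<^bsub>L0 m\<^esub> T i v) = T i v"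
        using c qc Tv by (intro L0_eqI[where m = m]) simp_all
      then show "(c \<odot>\<^bsub>dM i\<^esub> \<psi> i) v = T i v" using v by (simp add: \<psi>_def)
    qed
    finally show "adjL i (c \<odot>\<^bsub>dL\<^esub> \<Phi>) = T i" .
  qed
qed

section \<open>The dual of the direct limit as an inverse limit\<close>

lemma inverse_system_duals: "inverse_system m I r dM adj"
  unfolding inverse_system_def
proof (intro conjI ballI allI impI)
  show "normed_L0_module m (dM i)" if "i \<in> I" for i
    by (rule sf_pn_module.normed_L0_module_dual[OF sf_M[OF that]])
  show "adj i i = identity (dM i)" if "i \<in> I" for i
    using system that sf_pn_module.adjoint_identity[OF sf_M[OF that]] by (simp add: direct_system_def)
  have \<phi>: "morphism m (M i) (M j) (\<phi> i j)" if "(i, j) \<in> r" for i j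
    using system that by (simp add: direct_system_def)
  show "morphism m (dM j) (dM i) (adj i j)" if ij: "(i, j) \<in> r" for i j
    using r ij by (intro module_pair.morphism_adjoint[OF _ \<phi>[OF ij]]) (auto simp: module_pair_def sf_M)
  fix i j k assume ij: "(i, j) \<in> r" and jk: "(j, k) \<in> r"
  then have I: "i \<in> I" "j \<in> I" "k \<in> I" using r by auto
  have "\<phi> i k = compose (carrier (M i)) (\<phi> j k) (\<phi> i j)"
    using system ij jk unfolding direct_system_def by blast
  then show "adj i k = compose (carrier (dM k)) (adj i j) (adj j k)"
    using adjoint_compose[OF sf_M[OF I(1)] sf_M[OF I(2)] sf_M[OF I(3)] \<phi>[OF ij] \<phi>[OF jk]] by simp
qed

lemma inverse_cone_dual_limit: "inverse_cone m I r dM adj dL adjL"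
  unfolding inverse_cone_def
proof (intro conjI ballI allI impI)
  show "normed_L0_module m dL" by (rule L.normed_L0_module_dual)
  show "morphism m dL (dM i) (adjL i)" if "i \<in> I" for i by (rule morphism_adjL[OF that])
  fix i j assume ij: "(i, j) \<in> r"
  then have I: "i \<in> I" "j \<in> I" using r by auto
  have \<phi>: "morphism m (M i) (M j) (\<phi> i j)" using system ij by (simp add: direct_system_def)
  have "\<eta> i = compose (carrier (M i)) (\<eta> j) (\<phi> i j)" using target ij by (simp add: direct_target_def)
  then show "adjL i = compose (carrier dL) (adj i j) (adjL j)"
    using adjoint_compose[OF sf_M[OF I(1)] sf_M[OF I(2)] L.sf_pn_module_axioms \<phi> \<eta>[OF I(2)]] by simp
qed

text \<open>The mediating map is found vector by vector: the family \<open>Q i u\<close> is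
  compatible and bounded by the norm of \<open>u\<close>, so \<open>dual_limit_ex\<close> with that
  norm as \<open>c\<close> gives a functional, and its bound is precisely the contraction
  property.\<close>

lemma dual_limit_universal:
  fixes Ob :: "('x L0, 'o) normed_module"
  assumes cone: "inverse_cone m I r dM adj Ob Q"
  shows "\<exists>!\<Phi>. morphism m Ob dL \<Phi> \<and> (\<forall>i\<in>I. compose (carrier Ob) (adjL i) \<Phi> = Q i)"
proof (rule ex_ex1I)
  have Q: "\<And>i. i \<in> I \<Longrightarrow> morphism m Ob (dM i) (Q i)"
    and QA: "\<And>i j. (i, j) \<in> r \<Longrightarrow> Q i = compose (carrier Ob) (adj i j) (Q j)"
    using cone by (simp_all add: inverse_cone_def)
  interpret O: pn_module m Ob
    using cone by (intro normed_L0_module_pn) (simp add: inverse_cone_def)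
  interpret D: pn_module m dL by (rule L.pn_module_dual)
  have "\<exists>\<omega>\<in>carrier dL. (\<forall>i\<in>I. adjL i \<omega> = Q i u) \<and> (AE x in m. L.dnm \<omega> x \<le> O.nm u x)" if u: "u \<in> carrier Ob" for u
  proof (rule dual_limit_ex)
    show "pnorm Ob u \<in> carrier (L0 m)" using u by simp
    show "AE x in m. 0 \<le> O.nm u x" by (rule O.nm_nonneg[OF u])
    show "Q i u \<in> carrier (dM i)" if "i \<in> I" for i by (rule morphism_closed[OF Q[OF that] u])
    show "AE x in m. L0_rep (pnorm (dM i) (Q i u)) x \<le> O.nm u x" if "i \<in> I" for i
      by (rule morphism_le[OF Q[OF that] u])
    show "Q i u = adj i j (Q j u)" if "(i, j) \<in> r" for i j
      using QA[OF that] u by (simp add: compose_eq)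
  qed
  then have "\<forall>u\<in>carrier Ob. \<exists>\<omega>. \<omega> \<in> carrier dL \<and> (\<forall>i\<in>I. adjL i \<omega> = Q i u) \<and> (AE x in m. L.dnm \<omega> x \<le> O.nm u x)"
    by blast
  \<comment> \<open>The choices for different \<open>u\<close> are unrelated; additivity and
    homogeneity hold because both sides have the same adjoints, which determine a functional by
    \<open>dual_limit_eqI\<close>.\<close>
  from bchoice[OF this] obtain h where h: "\<forall>u\<in>carrier Ob. h u \<in> carrier dL \<and> (\<forall>i\<in>I. adjL i (h u) = Q i u) \<and>
      (AE x in m. L.dnm (h u) x \<le> O.nm u x)" by (rule exE)
  define \<Phi> where "\<Phi> = restrict h (carrier Ob)"
  have \<Phi>c: "\<Phi> u \<in> carrier dL" and \<Phi>a: "\<And>i. i \<in> I \<Longrightarrow> adjL i (\<Phi> u) = Q i u"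
    and \<Phi>n: "AE x in m. L.dnm (\<Phi> u) x \<le> O.nm u x" if u: "u \<in> carrier Ob" for u
    using h[rule_format, OF u] u by (simp_all add: \<Phi>_def)
  have "morphism m Ob dL \<Phi>"
  proof (rule morphismI)
    fix u assume u: "u \<in> carrier Ob"
    show "\<Phi> (u \<oplus>\<^bsub>Ob\<^esub> w) = \<Phi> u \<oplus>\<^bsub>dL\<^esub> \<Phi> w" if w: "w \<in> carrier Ob" for w
    proof (rule dual_limit_eqI)
      fix i assume i: "i \<in> I"
      show "adjL i (\<Phi> (u \<oplus>\<^bsub>Ob\<^esub> w)) = adjL i (\<Phi> u \<oplus>\<^bsub>dL\<^esub> \<Phi> w)"
        using \<Phi>a[OF u i] \<Phi>a[OF w i] \<Phi>a[OF O.add.m_closed[OF u w] i] morphism_add[OF Q[OF i] u w]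
          morphism_add[OF morphism_adjL[OF i] \<Phi>c[OF u] \<Phi>c[OF w]] by simp
    qed (use u w \<Phi>c in simp_all)
    show "\<Phi> (f \<odot>\<^bsub>Ob\<^esub> u) = f \<odot>\<^bsub>dL\<^esub> \<Phi> u" if f: "f \<in> carrier (L0 m)" for f
    proof (rule dual_limit_eqI)
      fix i assume i: "i \<in> I"
      show "adjL i (\<Phi> (f \<odot>\<^bsub>Ob\<^esub> u)) = adjL i (f \<odot>\<^bsub>dL\<^esub> \<Phi> u)"
        using \<Phi>a[OF u i] \<Phi>a[OF O.smult_closed[OF f u] i] morphism_smult[OF Q[OF i] f u]
          morphism_smult[OF morphism_adjL[OF i] f \<Phi>c[OF u]] by simp
    qed (use u f \<Phi>c in simp_all)
  qed (use \<Phi>c \<Phi>n in \<open>simp_all add: \<Phi>_def\<close>)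
  moreover have "compose (carrier Ob) (adjL i) \<Phi> = Q i" if i: "i \<in> I" for i
    by (rule extensionalityI[OF compose_extensional morphism_extensional[OF Q[OF i]]])
      (simp add: compose_eq \<Phi>a i)
  ultimately show "\<exists>\<Phi>. morphism m Ob dL \<Phi> \<and> (\<forall>i\<in>I. compose (carrier Ob) (adjL i) \<Phi> = Q i)" by blast
next
  fix \<Phi>1 \<Phi>2
  assume 1: "morphism m Ob dL \<Phi>1 \<and> (\<forall>i\<in>I. compose (carrier Ob) (adjL i) \<Phi>1 = Q i)"
    and 2: "morphism m Ob dL \<Phi>2 \<and> (\<forall>i\<in>I. compose (carrier Ob) (adjL i) \<Phi>2 = Q i)"
  have M1: "morphism m Ob dL \<Phi>1" and M2: "morphism m Ob dL \<Phi>2" using 1 2 by blast+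
  show "\<Phi>1 = \<Phi>2"
  proof (rule morphism_eqI[OF M1 M2])
    fix u assume u: "u \<in> carrier Ob"
    show "\<Phi>1 u = \<Phi>2 u"
    proof (rule dual_limit_eqI[OF morphism_closed[OF M1 u] morphism_closed[OF M2 u]])
      fix i assume i: "i \<in> I"
      have "compose (carrier Ob) (adjL i) \<Phi>1 = compose (carrier Ob) (adjL i) \<Phi>2" using 1 2 i by simp
      then show "adjL i (\<Phi>1 u) = adjL i (\<Phi>2 u)" using compose_eq[OF u] by metis
    qed
  qed
qed

text \<open>The mediating map is constructed directly from the cone, whatever the carrier of its
  vertex, so \<open>'o\<close> can be any type.\<close>

lemma inverse_limit_dual: "inverse_limit TYPE('o) m I r dM adj dL adjL"
  unfolding inverse_limit_def using inverse_cone_dual_limit dual_limit_universal by blast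

text \<open>Two objects with the same universal property: \<open>\<Psi>\<close> comes from that of
  the dual, its inverse \<open>\<Theta>\<close> from that of \<open>P\<close>, and both composites
  are identities by uniqueness.\<close>

lemma isomorphism_inverse_limit:
  fixes P :: "('x L0, 'p) normed_module"
  assumes lim: "inverse_limit TYPE(('i, 'v \<Rightarrow> 'x L0, 'p) inverse_tests) m I r dM adj P \<pi>"
  shows "\<exists>\<Psi>. isomorphism m P dL \<Psi> \<and> (\<forall>i\<in>I. compose (carrier P) (adjL i) \<Psi> = \<pi> i)"
proof -
  have cone: "inverse_cone m I r dM adj P \<pi>" using lim by (simp add: inverse_limit_def)
  interpret P: pn_module m P
    using cone by (intro normed_L0_module_pn) (simp add: inverse_cone_def)
  interpret D: pn_module m dL by (rule L.pn_module_dual)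
  obtain \<Psi> where \<Psi>: "morphism m P dL \<Psi>" "\<And>i. i \<in> I \<Longrightarrow> compose (carrier P) (adjL i) \<Psi> = \<pi> i"
    using dual_limit_universal[OF cone] by blast
  have \<pi>: "morphism m P (dM i) (\<pi> i)" if "i \<in> I" for i
    using cone that by (simp add: inverse_cone_def)
  \<comment> \<open>The universal property of \<open>P\<close> is tested on
    \<open>inverse_tests\<close> only. A functional on the direct limit is encoded there by the
    family of its adjoints, faithfully by \<open>dual_limit_eqI\<close>.\<close>
  have "inj_on (\<lambda>\<omega>. Inr (\<lambda>i\<in>I. adjL i \<omega>) :: ('i, 'v \<Rightarrow> 'x L0, 'p) inverse_tests) (carrier dL)"
  proof (rule inj_onI)
    fix \<omega> \<omega>' assume \<omega>: "\<omega> \<in> carrier dL" "\<omega>' \<in> carrier dL"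
      and "(Inr (\<lambda>i\<in>I. adjL i \<omega>) :: ('i, 'v \<Rightarrow> 'x L0, 'p) inverse_tests) = Inr (\<lambda>i\<in>I. adjL i \<omega>')"
    then have eq: "(\<lambda>i\<in>I. adjL i \<omega>) = (\<lambda>i\<in>I. adjL i \<omega>')" by blast
    show "\<omega> = \<omega>'"
    proof (rule dual_limit_eqI[OF \<omega>])
      show "adjL i \<omega> = adjL i \<omega>'" if "i \<in> I" for i
        using fun_cong[OF eq, of i] by (simp only: restrict_apply' that)
    qed
  qed
  from inverse_limit_universal[OF lim r inverse_cone_dual_limit this]
  obtain \<Theta> where \<Theta>: "morphism m dL P \<Theta>" "\<And>i. i \<in> I \<Longrightarrow> compose (carrier dL) (\<pi> i) \<Theta> = adjL i"
    by blast
  have "compose (carrier dL) (adjL i) (compose (carrier dL) \<Psi> \<Theta>) = adjL i" if i: "i \<in> I" for i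
    using compose_assoc[OF morphism_funcset[OF \<Theta>(1)], of "adjL i" \<Psi>] \<Psi>(2)[OF i] \<Theta>(2)[OF i] by simp
  moreover have "compose (carrier dL) (adjL i) (identity dL) = adjL i" if i: "i \<in> I" for i
    by (rule compose_identity(2)[OF morphism_adjL[OF i]])
  ultimately have 1: "compose (carrier dL) \<Psi> \<Theta> = identity dL"
    using dual_limit_universal[OF inverse_cone_dual_limit] D.morphism_compose[OF \<Theta>(1) \<Psi>(1)]
      D.morphism_identity by blast
  \<comment> \<open>\<open>P\<close> itself sits in the first summand, which gives uniqueness for
    endomorphisms of \<open>P\<close>.\<close>
  have inl: "inj_on (Inl :: 'p \<Rightarrow> ('i, 'v \<Rightarrow> 'x L0, 'p) inverse_tests) (carrier P)" by simp
  have "compose (carrier P) (\<pi> i) (compose (carrier P) \<Theta> \<Psi>) = \<pi> i" if i: "i \<in> I" for i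
    using compose_assoc[OF morphism_funcset[OF \<Psi>(1)], of "\<pi> i" \<Theta>] \<Psi>(2)[OF i] \<Theta>(2)[OF i] by simp
  moreover have "compose (carrier P) (\<pi> i) (identity P) = \<pi> i" if i: "i \<in> I" for i
    by (rule compose_identity(2)[OF \<pi>[OF i]])
  ultimately have 2: "compose (carrier P) \<Theta> \<Psi> = identity P"
    using inverse_limit_universal[OF lim r cone inl] P.morphism_compose[OF \<Psi>(1) \<Theta>(1)]
      P.morphism_identity by blast
  have "isomorphism m P dL \<Psi>" using \<Psi>(1) \<Theta>(1) 1 2 unfolding isomorphism_def by blast
  then show ?thesis using \<Psi>(2) by blast
qed

end

text \<open>An inverse limit is unique only up to isomorphism, hence the two forms of the
  identification: the dual with the adjoints has the universal property itself, and every other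
  limit is matched with it by an isomorphism respecting the projections.\<close>

theorem corollary3p11:
  fixes m :: "'x::polish_space measure"
    and I :: "'i set" and r :: "'i rel"
    and M :: "'i \<Rightarrow> ('x L0, 'v) normed_module" and \<phi> :: "'i \<Rightarrow> 'i \<Rightarrow> 'v \<Rightarrow> 'v"
    and L :: "('x L0, 'l) normed_module" and \<phi>L :: "'i \<Rightarrow> 'v \<Rightarrow> 'l"
  assumes "metric_measure_space m"
    and "directed_poset I r"
    and "direct_system m I r M \<phi>"
    and "direct_limit TYPE(('x, 'i, 'v, 'l) direct_tests) m I r M \<phi> L \<phi>L"
  shows "inverse_system m I r (\<lambda>i. dual_module m (M i)) (\<lambda>i j. adjoint_map m (M i) (M j) (\<phi> i j)) \<and>
    inverse_limit TYPE('o) m I r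
      (\<lambda>i. dual_module m (M i)) (\<lambda>i j. adjoint_map m (M i) (M j) (\<phi> i j))
      (dual_module m L) (\<lambda>i. adjoint_map m (M i) L (\<phi>L i)) \<and>
    (\<forall>(P :: ('x L0, 'p) normed_module) \<pi>.
      inverse_limit TYPE(('i, 'v \<Rightarrow> 'x L0, 'p) inverse_tests) m I r
        (\<lambda>i. dual_module m (M i)) (\<lambda>i j. adjoint_map m (M i) (M j) (\<phi> i j)) P \<pi> \<longrightarrow>
      (\<exists>\<Psi>. isomorphism m P (dual_module m L) \<Psi> \<and>
           (\<forall>i\<in>I. compose (carrier P) (adjoint_map m (M i) L (\<phi>L i)) \<Psi> = \<pi> i)))"
proof -
  have "r \<subseteq> I \<times> I"
    using assms(2) by (simp add: directed_poset_def partial_order_on_def preorder_on_def)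
  then interpret direct_limit_of_modules m I r M \<phi> L \<phi>L
    using assms by (intro direct_limit_of_modules.intro sigma_finite_metric_measure_space)
  show ?thesis
    using inverse_system_duals inverse_limit_dual isomorphism_inverse_limit by blast
qed

end
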